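(* Let $n\ge 1$. Let $q\in[1,\infty)$, $c\in(0,\infty]$, $\mathbf{B}=(\beta_0,\beta_\infty)\in\mathbb{R}^2$ be such that either $q=c=1$ and $\mathbf{B}=(0,0)$, or $1<q<\infty$ and $0<c\le\infty$ (with $\mathbf{B}\in\mathbb{R}^2$ arbitrary). Let $-\infty<\sigma<\infty$, $\mathbf{\Gamma}=(\gamma_0,\gamma_\infty)\in\mathbb{R}^2$, $0<u\le\infty$, $0<c\le b\le\infty$, and $\mathbf{A}=(\alpha_0,\alpha_\infty)\in\mathbb{R}^2$ with $\alpha_\infty<\beta_\infty$ and $\alpha_0\ge\beta_0$. Then $$\dot B_{(q,c;\mathbf{B}),u}^{\sigma,\,\mathbf{\Gamma}+\overleftarrow{\mathbf{A}}-\overleftarrow{\mathbf{B}}}\subset\dot B_{(q,b;\mathbf{A}),u}^{\sigma,\mathbf{\Gamma}}.$$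
   Context: Convention: $1/\infty=0$. For a pair $\mathbf{A}=(\alpha_0,\alpha_\infty)\in\mathbb{R}^2$ put $\overleftarrow{\mathbf{A}}=(\alpha_\infty,\alpha_0)$; pairs are added and subtracted componentwise. The broken-logarithmic function is $l^{\mathbf{A}}(t)=(1+|\ln t|)^{\alpha_0}$ for $0<t\le 1$ and $l^{\mathbf{A}}(t)=(1+|\ln t|)^{\alpha_\infty}$ for $t>1$. For a complex-valued measurable $f$ on $\mathbb{R}^n$, $f^*$ is its non-increasing rearrangement. For $0<p,b\le\infty$, the Lorentz–Zygmund space $L_{p,b;\mathbf{A}}=L_{p,b;\mathbf{A}}(\mathbb{R}^n)$ consists of all measurable $f$ with $\|f\|_{p,b;\mathbf{A}}:=\left\|t^{\frac1p-\frac1b}l^{\mathbf{A}}(t)f^*(t)\right\|_{L_b(0,\infty)}<\infty$. $S$ and $S'$ are the Schwartz space and the space of tempered distributions on $\mathbb{R}^n$; $\mathcal{F}$ is the Fourier transform, $\mathcal{F}f(\xi)=\int e^{-2\pi i x\xi}f(x)\,dx$, extended to $S'$. Fix $\varphi\in S$ with $\operatorname{supp}\varphi=\{\xi:2^{-1}\le|\xi|\le2\}$, $\varphi(\xi)>0$ for $2^{-1}<|\xi|<2$, and $\sum_{k=-\infty}^\infty\varphi(2^{-k}\xi)=1$ for $\xi\ne0$. Put $\varphi_k(\xi)=\varphi(2^{-k}\xi)$ ($k\in\mathbb{Z}$). For $\sigma\in\mathbb{R}$, $0<p,b,u\le\infty$, $\mathbf{A},\mathbf{\Gamma}\in\mathbb{R}^2$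 with $L_{p,b;\mathbf{A}}\neq\{0\}$, the homogeneous Besov-type space $\dot B^{\sigma,\mathbf{\Gamma}}_{(p,b;\mathbf{A}),u}$ consists of all $f\in S'$ with finite semi-(quasi-)norm $$\|f\|_{\dot B^{\sigma,\mathbf{\Gamma}}_{(p,b;\mathbf{A}),u}}=\left\{\sum_{k=-\infty}^\infty\left(2^{\sigma k}l^{\mathbf{\Gamma}}(2^k)\|\mathcal{F}^{-1}(\varphi_k\mathcal{F}f)\|_{p,b;\mathbf{A}}\right)^u\right\}^{1/u}$$ (supremum over $k\in\mathbb{Z}$ if $u=\infty$). $X\subset Y$ means continuous embedding: every $f\in X$ is in $Y$ and $\|f\|_Y\le C\|f\|_X$ with $C$ independent of $f$. *)

theory Defs
  imports "HOL-Analysis.Analysis" "HOL-Probability.Essential_Supremum"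
begin

section \<open>Lorentz--Zygmund quasi-norms\<close>

text \<open>Integrability exponents in \<open>(0, \<infinity>]\<close> are elements of \<^typ>\<open>ennreal\<close>; quasi-norms take values
  in \<^typ>\<open>ennreal\<close> as well. Powers of elements of \<^typ>\<open>ennreal\<close> are used with positive real
  exponents only.\<close>

definition ennreal_powr :: "ennreal \<Rightarrow> real \<Rightarrow> ennreal" where
  "ennreal_powr x r = (if x = \<infinity> then \<infinity> else ennreal (enn2real x powr r))"

text \<open>The real number \<open>1 / p\<close>, with \<open>1 / \<infinity> = 0\<close>.\<close>

definition recip :: "ennreal \<Rightarrow> real" where
  "recip p = enn2real (inverse p)"

definition Lp_quasinorm :: "'a measure \<Rightarrow> ennreal \<Rightarrow> ('a \<Rightarrow> ennreal) \<Rightarrow> ennreal" where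
  "Lp_quasinorm M b h =
     (if b = \<infinity> then esssup M h
      else ennreal_powr (\<integral>\<^sup>+ t. ennreal_powr (h t) (enn2real b) \<partial>M) (recip b))"

definition broken_log :: "real \<times> real \<Rightarrow> real \<Rightarrow> real" where
  "broken_log A t =
     (if t \<le> 1 then (1 + \<bar>ln t\<bar>) powr fst A else (1 + \<bar>ln t\<bar>) powr snd A)"

definition rearrangement :: "(real ^ 'n \<Rightarrow> complex) \<Rightarrow> real \<Rightarrow> ennreal" where
  "rearrangement f t =
     Inf {s :: ennreal. emeasure lebesgue {x. s < ennreal (norm (f x))} \<le> ennreal t}"

definition lz_norm ::
  "ennreal \<Rightarrow> ennreal \<Rightarrow> real \<times> real \<Rightarrow> (real ^ 'n \<Rightarrow> complex) \<Rightarrow> ennreal" where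
  "lz_norm p b A f =
     Lp_quasinorm (lebesgue_on {0<..}) b
       (\<lambda>t. ennreal (t powr (recip p - recip b) * broken_log A t) * rearrangement f t)"

section \<open>Schwartz functions and tempered distributions\<close>

definition partial :: "'n \<Rightarrow> (real ^ 'n \<Rightarrow> complex) \<Rightarrow> real ^ 'n \<Rightarrow> complex" where
  "partial i f x = frechet_derivative f (at x) (axis i 1)"

text \<open>A multi-index derivative is given by the list of directions of differentiation.\<close>

definition partials :: "'n list \<Rightarrow> (real ^ 'n \<Rightarrow> complex) \<Rightarrow> real ^ 'n \<Rightarrow> complex" where
  "partials is f = foldr partial is f"

definition schwartz :: "(real ^ 'n \<Rightarrow> complex) set" where
  "schwartz = {f. \<forall>is. partials is f differentiable_on UNIV \<and>
     (\<forall>m::nat. bounded (range (\<lambda>x. (1 + norm x) ^ m * norm (partials is f x))))}"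

definition schwartz_seminorm :: "nat \<Rightarrow> 'n list \<Rightarrow> (real ^ 'n \<Rightarrow> complex) \<Rightarrow> real" where
  "schwartz_seminorm m is f = (SUP x. (1 + norm x) ^ m * norm (partials is f x))"

definition schwartz_topology :: "(real ^ 'n \<Rightarrow> complex) topology" where
  "schwartz_topology = topology_generated_by
     {{g \<in> schwartz. schwartz_seminorm m is (\<lambda>x. g x - f x) < e} | f m is e.
        f \<in> schwartz \<and> 0 < e}"

text \<open>Functionals are total in the logic; only their values on Schwartz functions are relevant.\<close>

definition tempered_distributions :: "((real ^ 'n \<Rightarrow> complex) \<Rightarrow> complex) set" where
  "tempered_distributions = {T.
     (\<forall>f\<in>schwartz. \<forall>g\<in>schwartz. T (\<lambda>x. f x + g x) = T f + T g) \<and>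
     (\<forall>a. \<forall>f\<in>schwartz. T (\<lambda>x. a * f x) = a * T f) \<and>
     continuous_map schwartz_topology euclidean T}"

definition fourier :: "(real ^ 'n \<Rightarrow> complex) \<Rightarrow> real ^ 'n \<Rightarrow> complex" where
  "fourier f \<xi> = (\<integral>x. exp (- 2 * of_real pi * \<i> * of_real (x \<bullet> \<xi>)) * f x \<partial>lborel)"

definition inv_fourier :: "(real ^ 'n \<Rightarrow> complex) \<Rightarrow> real ^ 'n \<Rightarrow> complex" where
  "inv_fourier f x = (\<integral>\<xi>. exp (2 * of_real pi * \<i> * of_real (x \<bullet> \<xi>)) * f \<xi> \<partial>lborel)"

definition fourier_dist ::
  "((real ^ 'n \<Rightarrow> complex) \<Rightarrow> complex) \<Rightarrow> (real ^ 'n \<Rightarrow> complex) \<Rightarrow> complex" where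
  "fourier_dist T = (\<lambda>\<psi>. T (fourier \<psi>))"

definition inv_fourier_dist ::
  "((real ^ 'n \<Rightarrow> complex) \<Rightarrow> complex) \<Rightarrow> (real ^ 'n \<Rightarrow> complex) \<Rightarrow> complex" where
  "inv_fourier_dist T = (\<lambda>\<psi>. T (inv_fourier \<psi>))"

definition mult_dist :: "(real ^ 'n \<Rightarrow> complex) \<Rightarrow>
    ((real ^ 'n \<Rightarrow> complex) \<Rightarrow> complex) \<Rightarrow> (real ^ 'n \<Rightarrow> complex) \<Rightarrow> complex" where
  "mult_dist g T = (\<lambda>\<psi>. T (\<lambda>x. g x * \<psi> x))"

definition represents ::
  "(real ^ 'n \<Rightarrow> complex) \<Rightarrow> ((real ^ 'n \<Rightarrow> complex) \<Rightarrow> complex) \<Rightarrow> bool" where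
  "represents g T \<longleftrightarrow> g \<in> borel_measurable lebesgue \<and>
     (\<forall>\<psi>\<in>schwartz. integrable lebesgue (\<lambda>x. g x * \<psi> x) \<and>
        T \<psi> = (\<integral>x. g x * \<psi> x \<partial>lebesgue))"

text \<open>The Lorentz--Zygmund quasi-norm of a distribution is that of the function representing it.
  This function is unique up to null sets, on which the quasi-norm does not depend, so the infimum
  is over a single value; it is \<open>\<infinity>\<close> if the distribution is not a function.\<close>

definition lz_norm_dist ::
  "ennreal \<Rightarrow> ennreal \<Rightarrow> real \<times> real \<Rightarrow> ((real ^ 'n \<Rightarrow> complex) \<Rightarrow> complex) \<Rightarrow> ennreal" where
  "lz_norm_dist p b A T = (INF g \<in> {g. represents g T}. lz_norm p b A g)"

section \<open>Homogeneous Besov-type spaces\<close>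

definition dyadic_resolution :: "(real ^ 'n \<Rightarrow> complex) \<Rightarrow> bool" where
  "dyadic_resolution \<phi> \<longleftrightarrow> \<phi> \<in> schwartz \<and>
     closure {\<xi>. \<phi> \<xi> \<noteq> 0} = {\<xi>. 1 / 2 \<le> norm \<xi> \<and> norm \<xi> \<le> 2} \<and>
     (\<forall>\<xi>. 1 / 2 < norm \<xi> \<and> norm \<xi> < 2 \<longrightarrow> \<phi> \<xi> \<in> \<real> \<and> 0 < Re (\<phi> \<xi>)) \<and>
     (\<forall>\<xi>. \<xi> \<noteq> 0 \<longrightarrow> ((\<lambda>k::int. \<phi> ((2 powi (- k)) *\<^sub>R \<xi>)) has_sum 1) UNIV)"

definition dyadic_block :: "(real ^ 'n \<Rightarrow> complex) \<Rightarrow> int \<Rightarrow>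
    ((real ^ 'n \<Rightarrow> complex) \<Rightarrow> complex) \<Rightarrow> (real ^ 'n \<Rightarrow> complex) \<Rightarrow> complex" where
  "dyadic_block \<phi> k T =
     inv_fourier_dist (mult_dist (\<lambda>\<xi>. \<phi> ((2 powi (- k)) *\<^sub>R \<xi>)) (fourier_dist T))"

definition besov_norm :: "(real ^ 'n \<Rightarrow> complex) \<Rightarrow> real \<Rightarrow> real \<times> real \<Rightarrow>
    ennreal \<Rightarrow> ennreal \<Rightarrow> real \<times> real \<Rightarrow> ennreal \<Rightarrow>
    ((real ^ 'n \<Rightarrow> complex) \<Rightarrow> complex) \<Rightarrow> ennreal" where
  "besov_norm \<phi> \<sigma> \<Gamma> p b A u f =
     (let s = (\<lambda>k::int. ennreal (2 powr (\<sigma> * of_int k) * broken_log \<Gamma> (2 powi k)) *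
                 lz_norm_dist p b A (dyadic_block \<phi> k f))
      in if u = \<infinity> then (SUP k. s k)
         else ennreal_powr (\<Sum>\<^sub>\<infinity>k. ennreal_powr (s k) (enn2real u)) (recip u))"

definition besov_space :: "(real ^ 'n \<Rightarrow> complex) \<Rightarrow> real \<Rightarrow> real \<times> real \<Rightarrow>
    ennreal \<Rightarrow> ennreal \<Rightarrow> real \<times> real \<Rightarrow> ennreal \<Rightarrow>
    ((real ^ 'n \<Rightarrow> complex) \<Rightarrow> complex) set" where
  "besov_space \<phi> \<sigma> \<Gamma> p b A u =
     {f \<in> tempered_distributions. besov_norm \<phi> \<sigma> \<Gamma> p b A u f < \<infinity>}"

definition continuously_embedded ::
  "'a set \<Rightarrow> ('a \<Rightarrow> ennreal) \<Rightarrow> 'a set \<Rightarrow> ('a \<Rightarrow> ennreal) \<Rightarrow> bool" where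
  "continuously_embedded X N\<^sub>X Y N\<^sub>Y \<longleftrightarrow>
     X \<subseteq> Y \<and> (\<exists>C::real. \<forall>f\<in>X. N\<^sub>Y f \<le> ennreal C * N\<^sub>X f)"

end

theory Submission
  imports Defs "HOL-Probability.Characteristic_Functions"
begin

text \<open>
  On each dyadic block the embedding reduces to an inequality between two Lorentz--Zygmund
  quasi-norms of one function \<open>g\<close> whose spectrum lies in an annulus of radius about \<open>2\<^sup>k\<close>. Put
  \<open>t\<^sub>0 = 2\<^sup>-\<^sup>k\<^sup>n\<close>. For \<open>t \<ge> t\<^sub>0\<close> the ratio of the two logarithmic weights is at most its value at \<open>t\<^sub>0\<close>, which is
  comparable with the weight of the smoothness index at \<open>2\<^sup>k\<close>. For \<open>t < t\<^sub>0\<close> one replaces the rearrangement of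
  \<open>g\<close> by the supremum of \<open>g\<close>, for which a Nikolskii inequality holds: \<open>g\<close> is, up to a constant, reproduced by
  convolution with a dilate of a fixed Schwartz kernel, and the mass of \<open>g\<close> on balls is controlled by its
  rearrangement. Fourier inversion is needed only up to an unspecified nonzero constant.
\<close>

section \<open>Schwartz functions\<close>

text \<open>For \<alpha>_0 > \<beta>_0 the quotient of the two weights blows up as t tends to 0, so
  for general functions the quasi-norms cannot be compared; frequency localization is what caps the
  rearrangement below t_0, the volume scale on which \<open>g\<close> hardly varies. Since 2^k is
  large exactly when t_0 is small, the two components of the pairs change places in the smoothness
  index. Recovering ball masses from the rearrangement requires integrability near 0. For q > 1 it
  comes from t^(-1/q), with a spare power of t swallowing the logarithms; for q = c = 1 with trivial
  weight the quasi-norm is itself the integral of the rearrangement. A block is known only through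
  its pairings with Schwartz functions, so its supremum is bounded by duality: up to the inversion
  constant, pairing with \<psi> is pairing with a smoothed \<psi>, this costs at most a constant
  times the L1 norm of \<psi>, and such a bound forces a pointwise bound almost everywhere. The
  inversion constant enters this argument only as a divisor, which is why it merely has to be
  nonzero.\<close>

lemma partial_eqI: "(f has_derivative f') (at x) \<Longrightarrow> partial i f x = f' (axis i 1)"
  unfolding partial_def using frechet_derivative_at by metis

lemma has_derivative_frechet:
  assumes "f differentiable_on (UNIV :: (real ^ 'n) set)"
  shows "(f has_derivative frechet_derivative f (at x)) (at x)"
  using assms by (simp add: differentiable_on_def frechet_derivative_works[symmetric])

text \<open>The decay part of the Schwartz condition for the function alone. A bound for each power
  is easier to combine than \<open>bounded (range _)\<close>, and derivatives are left to
  \<open>schwartz_coinduct\<close>.\<close>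

definition rapidly_decreasing :: "(real ^ 'n \<Rightarrow> complex) \<Rightarrow> bool" where
  "rapidly_decreasing f \<longleftrightarrow> (\<forall>m::nat. \<exists>C. \<forall>x. (1 + norm x) ^ m * norm (f x) \<le> C)"

lemma rapidly_decreasing_iff_bounded:
  "rapidly_decreasing f \<longleftrightarrow> (\<forall>m::nat. bounded (range (\<lambda>x. (1 + norm x) ^ m * norm (f x))))"
  unfolding rapidly_decreasing_def bounded_iff by (simp add: abs_mult)

lemma rapidly_decreasing_add:
  assumes "rapidly_decreasing f" "rapidly_decreasing g"
  shows "rapidly_decreasing (\<lambda>x. f x + g x)"
  unfolding rapidly_decreasing_def
proof
  fix m :: nat
  obtain C D where C: "\<And>x. (1 + norm x) ^ m * norm (f x) \<le> C"
    and D: "\<And>x. (1 + norm x) ^ m * norm (g x) \<le> D"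
    using assms unfolding rapidly_decreasing_def by meson
  have "(1 + norm x) ^ m * norm (f x + g x) \<le> C + D" for x
  proof -
    have "(1 + norm x) ^ m * norm (f x + g x) \<le> (1 + norm x) ^ m * (norm (f x) + norm (g x))"
      by (intro mult_left_mono norm_triangle_ineq) auto
    with C[of x] D[of x] show ?thesis by (simp add: distrib_left)
  qed
  then show "\<exists>C. \<forall>x. (1 + norm x) ^ m * norm (f x + g x) \<le> C" by blast
qed

lemma rapidly_decreasing_mult_poly_growth:
  assumes f: "rapidly_decreasing f" and g: "\<And>x. norm (g x) \<le> K * (1 + norm x) ^ l"
  shows "rapidly_decreasing (\<lambda>x. g x * f x)"
  unfolding rapidly_decreasing_def
proof
  fix m :: nat
  obtain C where C: "\<And>x. (1 + norm x) ^ (m + l) * norm (f x) \<le> C"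
    using f unfolding rapidly_decreasing_def by meson
  have K: "0 \<le> K" using order_trans[OF norm_ge_zero g[of 0]] by simp
  have "(1 + norm x) ^ m * norm (g x * f x) \<le> K * C" for x
  proof -
    have "(1 + norm x) ^ m * norm (g x * f x) \<le> (1 + norm x) ^ m * (K * (1 + norm x) ^ l * norm (f x))"
      unfolding norm_mult by (intro mult_left_mono mult_right_mono g) auto
    also have "\<dots> = K * ((1 + norm x) ^ (m + l) * norm (f x))"
      by (simp add: power_add mult_ac)
    also have "\<dots> \<le> K * C" by (intro mult_left_mono C K)
    finally show ?thesis .
  qed
  then show "\<exists>C. \<forall>x. (1 + norm x) ^ m * norm (g x * f x) \<le> C" by blast
qed

lemma rapidly_decreasing_mult_bounded:
  assumes f: "rapidly_decreasing f" and g: "\<And>x. norm (g x) \<le> K"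
  shows "rapidly_decreasing (\<lambda>x. g x * f x)"
  using rapidly_decreasing_mult_poly_growth[OF f, of g K 0] g by simp

lemma schwartzD_differentiable: "f \<in> schwartz \<Longrightarrow> f differentiable_on UNIV"
  unfolding schwartz_def mem_Collect_eq partials_def by (drule spec[of _ "[]"]) simp

lemma schwartzD_rapid: "f \<in> schwartz \<Longrightarrow> rapidly_decreasing f"
  unfolding schwartz_def mem_Collect_eq partials_def rapidly_decreasing_iff_bounded
  by (drule spec[of _ "[]"]) simp

lemma schwartzD_bounded:
  assumes "f \<in> schwartz" obtains C where "0 \<le> C" "\<And>x. norm (f x) \<le> C"
proof -
  obtain C where "\<And>x. (1 + norm x) ^ 0 * norm (f x) \<le> C"
    using schwartzD_rapid[OF assms] unfolding rapidly_decreasing_def by meson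
  then have C: "\<And>x. norm (f x) \<le> C" by simp
  show thesis by (rule that[OF _ C]) (use C[of 0] norm_ge_zero[of "f 0"] in linarith)
qed

lemma schwartz_partial: "f \<in> schwartz \<Longrightarrow> partial i f \<in> schwartz"
  unfolding schwartz_def mem_Collect_eq partials_def
proof
  fix "is"
  assume *: "\<forall>is. foldr partial is f differentiable_on UNIV \<and>
    (\<forall>m::nat. bounded (range (\<lambda>x. (1 + norm x) ^ m * norm (foldr partial is f x))))"
  show "foldr partial is (partial i f) differentiable_on UNIV \<and>
    (\<forall>m::nat. bounded (range (\<lambda>x. (1 + norm x) ^ m * norm (foldr partial is (partial i f) x))))"
    \<comment> \<open>\<open>foldr\<close> applies the last direction of the list first, so the
      extra derivative is appended at the end.\<close>
    using *[rule_format, of "is @ [i]"] by simp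
qed

text \<open>Iterated derivatives never leave a class that is closed under \<open>partial\<close>, so
  differentiability and decay only have to be checked on the class itself. This replaces Leibniz and
  chain rules of higher order: each closure property below amounts to finding a suitable
  class.\<close>

lemma schwartz_coinduct:
  assumes "f \<in> P"
    and diff: "\<And>f. f \<in> P \<Longrightarrow> f differentiable_on UNIV"
    and rapid: "\<And>f. f \<in> P \<Longrightarrow> rapidly_decreasing f"
    and partial: "\<And>f i. f \<in> P \<Longrightarrow> partial i f \<in> P"
  shows "f \<in> schwartz"
proof -
  have "foldr partial is f \<in> P" for "is"
    by (induction "is") (use assms in auto)
  then show ?thesis
    using diff rapid unfolding schwartz_def partials_def rapidly_decreasing_iff_bounded by blast
qed

section \<open>Differentiation rules and closure properties of the Schwartz class\<close>

lemma partial_add: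
  assumes "f differentiable_on UNIV" "g differentiable_on UNIV"
  shows "partial i (\<lambda>x. f x + g x) = (\<lambda>x. partial i f x + partial i g x)"
  by (rule ext, subst partial_eqI[OF has_derivative_add[OF assms[THEN has_derivative_frechet]]])
    (simp add: partial_def)

lemma partial_mult:
  assumes "f differentiable_on UNIV" "g differentiable_on UNIV"
  shows "partial i (\<lambda>x. f x * g x) = (\<lambda>x. f x * partial i g x + partial i f x * g x)"
  by (rule ext, subst partial_eqI[OF has_derivative_mult[OF assms[THEN has_derivative_frechet]]])
    (simp add: partial_def)

lemma differentiable_on_affine:
  assumes "f differentiable_on (UNIV :: (real ^ 'n) set)"
  shows "(\<lambda>x. f (a *\<^sub>R x + y)) differentiable_on UNIV"
proof -
  have "((\<lambda>x. f (a *\<^sub>R x + y)) has_derivative (\<lambda>h. frechet_derivative f (at (a *\<^sub>R x + y)) (a *\<^sub>R h))) (at x)" for x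
    by (rule has_derivative_compose[where f = "\<lambda>x. a *\<^sub>R x + y"], auto intro!: derivative_eq_intros)
      (rule has_derivative_frechet[OF assms])
  then show ?thesis unfolding differentiable_on_def differentiable_def by auto
qed

lemma partial_affine:
  assumes "f differentiable_on UNIV"
  shows "partial i (\<lambda>x. f (a *\<^sub>R x + y)) = (\<lambda>x. of_real a * partial i f (a *\<^sub>R x + y))"
proof
  fix x
  have "((\<lambda>x. f (a *\<^sub>R x + y)) has_derivative (\<lambda>h. frechet_derivative f (at (a *\<^sub>R x + y)) (a *\<^sub>R h))) (at x)"
    by (rule has_derivative_compose[where f = "\<lambda>x. a *\<^sub>R x + y"], auto intro!: derivative_eq_intros)
      (rule has_derivative_frechet[OF assms])
  from partial_eqI[OF this]
  have "partial i (\<lambda>x. f (a *\<^sub>R x + y)) x = frechet_derivative f (at (a *\<^sub>R x + y)) (a *\<^sub>R axis i 1)" .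
  also have "\<dots> = a *\<^sub>R frechet_derivative f (at (a *\<^sub>R x + y)) (axis i 1)"
    by (rule linear_scale[OF has_derivative_linear[OF has_derivative_frechet[OF assms]]])
  finally show "partial i (\<lambda>x. f (a *\<^sub>R x + y)) x = of_real a * partial i f (a *\<^sub>R x + y)"
    by (simp add: partial_def scaleR_conv_of_real)
qed

lemma partial_const: "partial i (\<lambda>x. c) = (\<lambda>x. 0)"
  by (rule ext, subst partial_eqI[OF has_derivative_const]) simp

lemma schwartz_add:
  assumes "f \<in> schwartz" "g \<in> schwartz" shows "(\<lambda>x. f x + g x) \<in> schwartz"
proof (rule schwartz_coinduct[where P = "{(\<lambda>x. f x + g x) |f g. f \<in> schwartz \<and> g \<in> schwartz}"])
  show "(\<lambda>x. f x + g x) \<in> {(\<lambda>x. f x + g x) |f g. f \<in> schwartz \<and> g \<in> schwartz}"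
    using assms by blast
qed (force simp: partial_add schwartzD_differentiable schwartzD_rapid schwartz_partial
      intro: rapidly_decreasing_add differentiable_on_add)+

text \<open>The product rule turns one product into a sum of two, so products alone are not stable
  under \<open>partial\<close>; finite sums of products are.\<close>

inductive_set schwartz_products :: "(real ^ 'n \<Rightarrow> complex) set" where
  mult: "f \<in> schwartz \<Longrightarrow> g \<in> schwartz \<Longrightarrow> (\<lambda>x. f x * g x) \<in> schwartz_products"
| add: "f \<in> schwartz_products \<Longrightarrow> g \<in> schwartz_products \<Longrightarrow> (\<lambda>x. f x + g x) \<in> schwartz_products"

lemma schwartz_mult:
  assumes "f \<in> schwartz" "g \<in> schwartz" shows "(\<lambda>x. f x * g x) \<in> schwartz"
proof (rule schwartz_coinduct[where P = schwartz_products])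
  show "(\<lambda>x. f x * g x) \<in> schwartz_products" using assms by (rule schwartz_products.mult)
next
  fix f :: "real ^ 'n \<Rightarrow> complex" assume "f \<in> schwartz_products"
  then show "f differentiable_on UNIV"
    by induction (auto intro: differentiable_on_mult differentiable_on_add schwartzD_differentiable)
next
  fix f :: "real ^ 'n \<Rightarrow> complex" assume "f \<in> schwartz_products"
  then show "rapidly_decreasing f"
  proof induction
    case (mult f g)
    obtain C where "\<And>x. norm (f x) \<le> C" using schwartzD_bounded[OF mult(1)] by blast
    then show ?case by (rule rapidly_decreasing_mult_bounded[OF schwartzD_rapid[OF mult(2)]])
  qed (auto intro: rapidly_decreasing_add)
next
  fix f :: "real ^ 'n \<Rightarrow> complex" and i assume "f \<in> schwartz_products"
  then have "f differentiable_on UNIV \<and> partial i f \<in> schwartz_products"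
  proof induction
    case (mult f g)
    then show ?case
      using schwartz_products.add[OF schwartz_products.mult[of f "partial i g"] schwartz_products.mult[of "partial i f" g]]
      by (auto simp: partial_mult schwartzD_differentiable schwartz_partial intro: differentiable_on_mult)
  next
    case (add f g)
    then show ?case
      using schwartz_products.add[of "partial i f" "partial i g"]
      by (auto simp: partial_add intro: differentiable_on_add)
  qed
  then show "partial i f \<in> schwartz_products" ..
qed

text \<open>The class keeps the inner map fixed and lets \<open>f\<close> and the factor
  \<open>c\<close> vary, because a derivative replaces \<open>f\<close> by a partial derivative and
  multiplies \<open>c\<close> by \<open>a\<close>.\<close>

lemma schwartz_affine:
  assumes f: "f \<in> schwartz" and a: "a \<noteq> 0"
  shows "(\<lambda>x. c * f (a *\<^sub>R x + y)) \<in> schwartz"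
proof (rule schwartz_coinduct[where P = "{(\<lambda>x. c * f (a *\<^sub>R x + y)) |f c. f \<in> schwartz}"])
  let ?P = "{(\<lambda>x. c * f (a *\<^sub>R x + y)) |f c. f \<in> schwartz}"
  show "(\<lambda>x. c * f (a *\<^sub>R x + y)) \<in> ?P"
    using f by blast
  fix g assume "g \<in> ?P"
  then obtain f c where g: "g = (\<lambda>x. c * f (a *\<^sub>R x + y))" and f: "f \<in> schwartz" by blast
  note d = differentiable_on_affine[OF schwartzD_differentiable[OF f], of a y]
  show "g differentiable_on UNIV"
    unfolding g by (intro differentiable_on_mult d) simp
  have "partial i g = (\<lambda>x. (c * of_real a) * partial i f (a *\<^sub>R x + y))" for i
    unfolding g by (subst partial_mult[OF _ d])
      (simp_all add: partial_const partial_affine[OF schwartzD_differentiable[OF f]] mult_ac)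
  then show "partial i g \<in> ?P" for i
    using schwartz_partial[OF f] by blast
  have "rapidly_decreasing (\<lambda>x. f (a *\<^sub>R x + y))"
    unfolding rapidly_decreasing_def
  proof
    fix m :: nat
    obtain C where C: "\<And>x. (1 + norm x) ^ m * norm (f x) \<le> C"
      using schwartzD_rapid[OF f] unfolding rapidly_decreasing_def by meson
    \<comment> \<open>From |a| |x| \<le> |a x + y| + |y|, the weight at \<open>x\<close> is at most
      \<open>L\<close> times the weight at the image point.\<close>
    define L where "L = (1 + 1 / \<bar>a\<bar>) * (1 + norm y)"
    have L: "1 + norm x \<le> L * (1 + norm (a *\<^sub>R x + y))" for x
    proof -
      have "\<bar>a\<bar> * norm x \<le> norm (a *\<^sub>R x + y) + norm y"
        using norm_triangle_ineq4[of "a *\<^sub>R x + y" y] by simp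
      then have "norm x \<le> (1 / \<bar>a\<bar>) * (norm (a *\<^sub>R x + y) + norm y)"
        using a by (simp add: field_simps)
      also have "\<dots> \<le> (1 / \<bar>a\<bar>) * ((1 + norm y) * (1 + norm (a *\<^sub>R x + y)))"
        by (intro mult_left_mono) (auto simp: algebra_simps)
      finally have "norm x \<le> (1 / \<bar>a\<bar>) * ((1 + norm y) * (1 + norm (a *\<^sub>R x + y)))" .
      moreover have "1 \<le> (1 + norm y) * (1 + norm (a *\<^sub>R x + y))"
        by (simp add: algebra_simps)
      ultimately show ?thesis
        unfolding L_def by (simp only: distrib_right mult_1_left mult.assoc)
    qed
    have "(1 + norm x) ^ m * norm (f (a *\<^sub>R x + y)) \<le> L ^ m * C" for x
    proof -
      have "(1 + norm x) ^ m * norm (f (a *\<^sub>R x + y)) \<le> (L * (1 + norm (a *\<^sub>R x + y))) ^ m * norm (f (a *\<^sub>R x + y))"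
        by (intro mult_right_mono power_mono L) auto
      also have "\<dots> = L ^ m * ((1 + norm (a *\<^sub>R x + y)) ^ m * norm (f (a *\<^sub>R x + y)))"
        by (simp add: power_mult_distrib mult_ac)
      also have "\<dots> \<le> L ^ m * C"
        by (intro mult_left_mono C) (simp add: L_def)
      finally show ?thesis .
    qed
    then show "\<exists>C. \<forall>x. (1 + norm x) ^ m * norm (f (a *\<^sub>R x + y)) \<le> C" by blast
  qed
  from rapidly_decreasing_mult_bounded[OF this, of "\<lambda>_. c" "norm c"]
  show "rapidly_decreasing g" unfolding g by simp
qed

lemma schwartz_cmult: "f \<in> schwartz \<Longrightarrow> (\<lambda>x. c * f x) \<in> schwartz"
  using schwartz_affine[of f 1 c 0] by simp

lemma has_derivative_coord: "((\<lambda>x. complex_of_real (x $ i)) has_derivative (\<lambda>h. complex_of_real (h $ i))) F"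
  by (intro has_derivative_of_real bounded_linear_imp_has_derivative bounded_linear_vec_nth)

text \<open>Differentiating x_i f produces, besides x_i times a derivative, a multiple of
  \<open>f\<close> itself; the summand \<open>g\<close> of the class absorbs it.\<close>

lemma schwartz_mult_coord:
  fixes f :: "real ^ 'n \<Rightarrow> complex"
  assumes f: "f \<in> schwartz"
  shows "(\<lambda>x. of_real (x $ i) * f x) \<in> schwartz"
proof (rule schwartz_coinduct[where P = "{(\<lambda>x. of_real (x $ i) * f x + g x) |f g. f \<in> schwartz \<and> g \<in> schwartz}"])
  let ?P = "{(\<lambda>x. of_real (x $ i) * f x + g x) |f g. f \<in> schwartz \<and> g \<in> schwartz}"
  have "(\<lambda>x::real ^ 'n. 0::complex) \<in> schwartz" using schwartz_cmult[OF f, of 0] by simp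
  with f show "(\<lambda>x. of_real (x $ i) * f x) \<in> ?P"
    by force
  fix h :: "real ^ 'n \<Rightarrow> complex" assume "h \<in> ?P"
  then obtain f g where h: "h = (\<lambda>x. of_real (x $ i) * f x + g x)" and f: "f \<in> schwartz" and g: "g \<in> schwartz" by blast
  have d: "(\<lambda>x::real ^ 'n. complex_of_real (x $ i)) differentiable_on UNIV"
    unfolding differentiable_on_def differentiable_def using has_derivative_coord by blast
  note d' = differentiable_on_mult[OF d schwartzD_differentiable[OF f]]
  show "h differentiable_on UNIV"
    unfolding h by (intro differentiable_on_add d' schwartzD_differentiable g)
  have "norm (complex_of_real (x $ i)) \<le> 1 * (1 + norm x) ^ 1" for x :: "real ^ 'n"
    using component_le_norm_cart[of x i] by simp
  then show "rapidly_decreasing h"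
    unfolding h by (intro rapidly_decreasing_add rapidly_decreasing_mult_poly_growth schwartzD_rapid f g)
  have "partial j h = (\<lambda>x. of_real (x $ i) * partial j f x + (of_real (axis j 1 $ i) * f x + partial j g x))" for j
    unfolding h by (subst partial_add[OF d' schwartzD_differentiable[OF g]],
      subst partial_mult[OF d schwartzD_differentiable[OF f]])
      (simp add: partial_eqI[OF has_derivative_coord] fun_eq_iff)
  then show "partial j h \<in> ?P" for j
    using schwartz_partial[OF f, of j]
      schwartz_add[OF schwartz_cmult[OF f, of "of_real (axis j 1 $ i)"] schwartz_partial[OF g, of j]]
    by (intro CollectI exI conjI)
qed

lemma schwartz_continuous: "f \<in> schwartz \<Longrightarrow> continuous_on UNIV f"
  using schwartzD_differentiable differentiable_imp_continuous_on by blast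

lemma schwartz_measurable [measurable_dest]: "f \<in> schwartz \<Longrightarrow> f \<in> borel_measurable borel"
  using schwartz_continuous borel_measurable_continuous_onI by blast

section \<open>Integration over Euclidean space\<close>

lemma nn_integral_affine_lborel:
  fixes f :: "'a::euclidean_space \<Rightarrow> ennreal"
  assumes [measurable]: "f \<in> borel_measurable borel" and a: "a \<noteq> 0"
  shows "(\<integral>\<^sup>+x. f x \<partial>lborel) = ennreal (\<bar>a\<bar> ^ DIM('a)) * (\<integral>\<^sup>+x. f (a *\<^sub>R x + y) \<partial>lborel)"
  by (subst lborel_affine[OF a, of y])
     (simp add: nn_integral_density nn_integral_distr nn_integral_cmult add.commute ennreal_power)

lemma integrable_affine_lborel:
  fixes f :: "'a::euclidean_space \<Rightarrow> 'b::{banach, second_countable_topology}"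
  assumes f: "integrable lborel f" and a: "a \<noteq> 0"
  shows "integrable lborel (\<lambda>x. f (a *\<^sub>R x + y))"
proof -
  have [measurable]: "f \<in> borel_measurable borel" using f by simp
  have "ennreal (\<bar>a\<bar> ^ DIM('a)) * (\<integral>\<^sup>+x. norm (f (a *\<^sub>R x + y)) \<partial>lborel) < \<infinity>"
    using f by (subst nn_integral_affine_lborel[OF _ a, symmetric]) (auto simp: integrable_iff_bounded)
  then show ?thesis
    using a by (auto simp: integrable_iff_bounded ennreal_mult_less_top)
qed

lemma integral_affine_lborel:
  fixes f :: "'a::euclidean_space \<Rightarrow> 'b::{banach, second_countable_topology}"
  assumes [measurable]: "f \<in> borel_measurable borel" and a: "a \<noteq> 0"
  shows "(\<integral>x. f x \<partial>lborel) = (\<bar>a\<bar> ^ DIM('a)) *\<^sub>R (\<integral>x. f (a *\<^sub>R x + y) \<partial>lborel)"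
proof -
  have "(\<integral>x. f x \<partial>lborel) = (\<integral>x. f x \<partial>(density (distr lborel borel (\<lambda>x. y + a *\<^sub>R x)) (\<lambda>_. \<bar>a\<bar> ^ DIM('a))))"
    using lborel_affine[OF a, of y] by simp
  also have "\<dots> = (\<integral>x. (\<bar>a\<bar> ^ DIM('a)) *\<^sub>R f x \<partial>(distr lborel borel (\<lambda>x. y + a *\<^sub>R x)))"
    by (subst integral_density[symmetric]) auto
  also have "\<dots> = (\<integral>x. (\<bar>a\<bar> ^ DIM('a)) *\<^sub>R f (y + a *\<^sub>R x) \<partial>lborel)"
    by (subst integral_distr) auto
  finally show ?thesis by (simp add: add.commute)
qed

text \<open>Decomposition into shells: where r \<le> a |x - y| < r + 1 the decaying factor is at
  most (1 + r)^(-M), and this shell lies in the ball of radius (1 + r) / a.\<close>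

lemma nn_integral_decay_le_balls:
  fixes w :: "'a::euclidean_space \<Rightarrow> ennreal"
  assumes [measurable]: "w \<in> borel_measurable borel" and a: "0 < a"
  shows "(\<integral>\<^sup>+x. w x * ennreal (1 / (1 + a * norm (x - y)) ^ M) \<partial>lborel) \<le>
    (\<Sum>r. ennreal (1 / (1 + real r) ^ M) * (\<integral>\<^sup>+x\<in>ball y ((1 + real r) / a). w x \<partial>lborel))"
proof -
  have [measurable]: "ball y R \<in> sets borel" for R by simp
  have "w x * ennreal (1 / (1 + a * norm (x - y)) ^ M) \<le>
    (\<Sum>r. ennreal (1 / (1 + real r) ^ M) * (w x * indicator (ball y ((1 + real r) / a)) x))" for x
  proof -
    define r where "r = nat \<lfloor>a * norm (x - y)\<rfloor>"
    have "0 \<le> a * norm (x - y)" using a by simp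
    then have r: "real r \<le> a * norm (x - y)" "a * norm (x - y) < 1 + real r"
      unfolding r_def by linarith+
    have "x \<in> ball y ((1 + real r) / a)"
      using r(2) a by (simp add: dist_norm norm_minus_commute field_simps)
    moreover have "1 / (1 + a * norm (x - y)) ^ M \<le> 1 / (1 + real r) ^ M"
      using r(1) by (intro divide_left_mono power_mono mult_pos_pos zero_less_power) auto
    ultimately have "w x * ennreal (1 / (1 + a * norm (x - y)) ^ M) \<le>
      ennreal (1 / (1 + real r) ^ M) * (w x * indicator (ball y ((1 + real r) / a)) x)"
      by (simp add: mult.commute mult_left_mono ennreal_leI)
    also have "\<dots> \<le> (\<Sum>r. ennreal (1 / (1 + real r) ^ M) * (w x * indicator (ball y ((1 + real r) / a)) x))"
      using sum_le_suminf[of "\<lambda>r. ennreal (1 / (1 + real r) ^ M) * (w x * indicator (ball y ((1 + real r) / a)) x)" "{r}"]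
      by simp
    finally show ?thesis .
  qed
  then have "(\<integral>\<^sup>+x. w x * ennreal (1 / (1 + a * norm (x - y)) ^ M) \<partial>lborel) \<le>
    (\<integral>\<^sup>+x. (\<Sum>r. ennreal (1 / (1 + real r) ^ M) * (w x * indicator (ball y ((1 + real r) / a)) x)) \<partial>lborel)"
    by (rule nn_integral_mono)
  also have "\<dots> = (\<Sum>r. ennreal (1 / (1 + real r) ^ M) * (\<integral>\<^sup>+x\<in>ball y ((1 + real r) / a). w x \<partial>lborel))"
    by (subst nn_integral_suminf) (auto simp: nn_integral_cmult)
  finally show ?thesis .
qed

lemma summable_inverse_squares_shift: "summable (\<lambda>r. 1 / (1 + real r)\<^sup>2)"
  using summable_ignore_initial_segment[OF inverse_power_summable[of 2, where 'a = real], of 1]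
  by (simp add: field_simps)

text \<open>Ball volumes grow like (1 + r)^n in dimension n, and the two extra powers of decay leave
  a convergent series.\<close>

lemma integrable_decay:
  "integrable lborel (\<lambda>x::'a::euclidean_space. 1 / (1 + norm x) ^ (DIM('a) + 2))"
proof (rule integrableI_bounded)
  have "(\<integral>\<^sup>+x. ennreal (1 / (1 + norm (x::'a)) ^ (DIM('a) + 2)) \<partial>lborel) \<le>
    (\<Sum>r. ennreal (1 / (1 + real r) ^ (DIM('a) + 2)) * emeasure lborel (ball (0::'a) (1 + real r)))"
    using nn_integral_decay_le_balls[of "\<lambda>_. 1" 1 "0::'a" "DIM('a) + 2"] by simp
  also have "\<dots> = (\<Sum>r. ennreal (unit_ball_vol (real DIM('a)) * (1 / (1 + real r)\<^sup>2)))"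
    by (intro suminf_cong) (simp add: emeasure_ball ennreal_mult'[symmetric] power_add power2_eq_square)
  also have "\<dots> < \<infinity>"
    using summable_mult[OF summable_inverse_squares_shift, of "unit_ball_vol (real DIM('a))"]
    by (subst suminf_ennreal2) auto
  finally show "(\<integral>\<^sup>+x. ennreal (norm (1 / (1 + norm (x::'a)) ^ (DIM('a) + 2))) \<partial>lborel) < \<infinity>"
    by simp
qed simp

lemma rapidly_decreasingE:
  assumes "rapidly_decreasing f"
  obtains C where "0 \<le> C" "\<And>x. norm (f x) \<le> C * (1 / (1 + norm x) ^ m)"
proof -
  obtain C where C: "\<And>x. (1 + norm x) ^ m * norm (f x) \<le> C"
    using assms unfolding rapidly_decreasing_def by meson
  have pos: "(1 + norm x) ^ m > 0" for x :: "real ^ 'n" by (simp add: add_pos_nonneg)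
  have "norm (f x) \<le> C * (1 / (1 + norm x) ^ m)" for x
    using C[of x] pos[of x] by (simp add: field_simps)
  moreover have "0 \<le> C" using order_trans[OF _ C[of 0], of 0] by simp
  ultimately show thesis using that by blast
qed

lemma rapidly_decreasing_integrable:
  assumes f: "rapidly_decreasing (f :: real ^ 'n \<Rightarrow> complex)" and [measurable]: "f \<in> borel_measurable borel"
  shows "integrable lborel f"
proof -
  obtain C where "0 \<le> C" and C: "\<And>x. norm (f x) \<le> C * (1 / (1 + norm x) ^ (DIM(real ^ 'n) + 2))"
    using rapidly_decreasingE[OF f] by blast
  show ?thesis
    by (rule Bochner_Integration.integrable_bound[OF integrable_mult_right[OF integrable_decay, of C]])
      (use C \<open>0 \<le> C\<close> in \<open>auto simp: abs_mult\<close>)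
qed

lemma schwartz_integrable: "f \<in> schwartz \<Longrightarrow> integrable lborel f"
  using rapidly_decreasing_integrable schwartzD_rapid schwartz_measurable by blast

section \<open>The Fourier transform on Schwartz functions\<close>

abbreviation wave :: "real ^ 'n \<Rightarrow> real ^ 'n \<Rightarrow> complex" where
  "wave \<xi> x \<equiv> cis (- (2 * pi * (x \<bullet> \<xi>)))"

lemma fourier_cis: "fourier f \<xi> = (\<integral>x. wave \<xi> x * f x \<partial>lborel)"
  unfolding fourier_def cis_conv_exp by (simp add: mult_ac)

lemma inv_fourier_eq: "inv_fourier f x = fourier f (- x)"
  unfolding inv_fourier_def fourier_cis cis_conv_exp by (simp add: mult_ac inner_commute)

lemma cis_measurable [measurable]: "cis \<in> borel_measurable borel"
  by (intro borel_measurable_continuous_onI continuous_on_cis continuous_on_id)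

lemma integrable_cis_mult:
  assumes "integrable lborel f"
  shows "integrable lborel (\<lambda>x. wave \<xi> x * f x)"
  by (rule Bochner_Integration.integrable_bound[OF assms])
    (use borel_measurable_integrable[OF assms] in \<open>auto simp: norm_mult\<close>)

lemma norm_fourier_le: "norm (fourier f \<xi>) \<le> (\<integral>x. norm (f x) \<partial>lborel)"
  unfolding fourier_cis by (rule order_trans[OF integral_norm_bound]) (simp add: norm_mult)

lemma fourier_cmult: "fourier (\<lambda>x. a * f x) \<xi> = a * fourier f \<xi>"
  unfolding fourier_cis by (simp add: mult.left_commute[of _ a])

section \<open>Smoothness and decay of the Fourier transform\<close>

lemma norm_cis_approx: "norm (cis t - 1 - \<i> * of_real t) \<le> t\<^sup>2"
proof -
  have "norm (cis t - 1 - \<i> * of_real t) \<le> t\<^sup>2 / 2"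
    using iexp_approx1[of t 1] by (simp add: cis_conv_exp algebra_simps numeral_2_eq_2)
  also have "\<dots> \<le> t\<^sup>2" by simp
  finally show ?thesis .
qed

text \<open>Differentiation under the integral sign: the first-order Taylor error of the character
  is at most (2 pi |x| |h|)^2, and |x|^2 |f| is integrable, so the remainder is quadratic in
  \<open>h\<close>.\<close>

lemma fourier_has_derivative:
  fixes f :: "real ^ 'n \<Rightarrow> complex"
  assumes f: "f \<in> schwartz"
  shows "(fourier f has_derivative
    (\<lambda>h. \<Sum>i\<in>UNIV. of_real (h $ i) * fourier (\<lambda>x. - (2 * pi * \<i>) * (of_real (x $ i) * f x)) \<xi>)) (at \<xi>)"
    (is "(_ has_derivative ?D) _")
proof (rule has_derivativeI_sandwich[where e = 1])
  have fi: "integrable lborel f" by (rule schwartz_integrable[OF f])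
  have [measurable]: "f \<in> borel_measurable borel" by (rule schwartz_measurable[OF f])
  have xi: "integrable lborel (\<lambda>x. of_real (x $ i) * f x)" for i
    by (rule schwartz_integrable[OF schwartz_mult_coord[OF f]])
  show "bounded_linear ?D"
    by (intro bounded_linear_sum bounded_linear_compose[OF bounded_linear_mult_left]
      bounded_linear_compose[OF bounded_linear_of_real] bounded_linear_vec_nth)
  have "norm ((norm x)\<^sup>2 :: complex) \<le> 1 * (1 + norm x) ^ 2" for x :: "real ^ 'n"
    by (simp add: norm_power power_mono)
  from rapidly_decreasing_mult_poly_growth[OF schwartzD_rapid[OF f] this]
  have sq: "integrable lborel (\<lambda>x. of_real ((norm x)\<^sup>2) * f x)"
    by (intro rapidly_decreasing_integrable) simp_all
  define I where "I = (\<integral>x. (norm x)\<^sup>2 * norm (f x) \<partial>lborel)"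
  have I: "integrable lborel (\<lambda>x. (norm x)\<^sup>2 * norm (f x))"
    using integrable_norm[OF sq] by (simp add: norm_mult norm_power)
  show "norm (fourier f y - fourier f \<xi> - ?D (y - \<xi>)) / norm (y - \<xi>) \<le> (2 * pi)\<^sup>2 * I * norm (y - \<xi>)"
    if "y \<noteq> \<xi>" for y
  proof -
    define h where "h = y - \<xi>"
    have y: "y = \<xi> + h" by (simp add: h_def)
    let ?R = "\<lambda>x. - (2 * pi * \<i> * of_real (x \<bullet> h)) * f x"
    let ?G = "\<lambda>x. wave y x * f x - wave \<xi> x * f x - wave \<xi> x * ?R x"
    let ?S = "\<lambda>x. (2 * pi)\<^sup>2 * (norm h)\<^sup>2 * ((norm x)\<^sup>2 * norm (f x))"
    have "?D h = (\<Sum>i\<in>UNIV. of_real (h $ i) * (\<integral>x. wave \<xi> x * (- (2 * pi * \<i>) * (of_real (x $ i) * f x)) \<partial>lborel))"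
      by (simp add: fourier_cis)
    also have "\<dots> = (\<integral>x. (\<Sum>i\<in>UNIV. of_real (h $ i) * (wave \<xi> x * (- (2 * pi * \<i>) * (of_real (x $ i) * f x)))) \<partial>lborel)"
      by (subst Bochner_Integration.integral_sum)
        (auto intro!: integrable_mult_right integrable_cis_mult xi simp del: of_real_mult)
    also have "\<dots> = (\<integral>x. wave \<xi> x * ?R x \<partial>lborel)"
      by (intro Bochner_Integration.integral_cong refl)
        (simp add: inner_vec_def sum_distrib_left sum_distrib_right mult_ac sum_negf)
    finally have D: "?D h = (\<integral>x. wave \<xi> x * ?R x \<partial>lborel)" .
    have hx: "integrable lborel ?R"
    proof -
      have "?R = (\<lambda>x. \<Sum>i\<in>UNIV. - (2 * pi * \<i> * of_real (h $ i)) * (of_real (x $ i) * f x))"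
        by (simp add: inner_vec_def sum_distrib_left sum_distrib_right mult_ac sum_negf)
      then show ?thesis by (simp only:) (intro Bochner_Integration.integrable_sum integrable_mult_right xi)
    qed
    have eq: "fourier f y - fourier f \<xi> - ?D h =
      (\<integral>x. ?G x \<partial>lborel)"
      unfolding D unfolding fourier_cis
      by (subst Bochner_Integration.integral_diff[OF Bochner_Integration.integrable_diff[OF
            integrable_cis_mult[OF fi] integrable_cis_mult[OF fi]] integrable_cis_mult[OF hx]],
          subst Bochner_Integration.integral_diff[OF integrable_cis_mult[OF fi] integrable_cis_mult[OF fi]],
          rule refl)
    have "norm (fourier f y - fourier f \<xi> - ?D h) \<le> (\<integral>x. ?S x \<partial>lborel)"
      unfolding eq
    proof (rule Bochner_Integration.integral_norm_bound_integral)
      show "integrable lborel ?G"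
        by (intro Bochner_Integration.integrable_diff integrable_cis_mult fi hx)
      show "integrable lborel ?S"
        by (intro integrable_mult_right I)
      fix x :: "real ^ 'n"
      define t where "t = - (2 * pi * (x \<bullet> h))"
      have "- (2 * pi * (x \<bullet> y)) = - (2 * pi * (x \<bullet> \<xi>)) + t"
        unfolding t_def y by (simp add: algebra_simps inner_add_right)
      then have "wave y x = wave \<xi> x * cis t"
        by (simp only: cis_mult)
      then have "?G x
        = wave \<xi> x * ((cis t - 1 - \<i> * of_real t) * f x)"
        by (simp add: t_def algebra_simps)
      then have "norm (?G x)
        \<le> t\<^sup>2 * norm (f x)"
        by (simp add: norm_mult norm_cis_approx mult_right_mono)
      also have "t\<^sup>2 \<le> (2 * pi)\<^sup>2 * ((norm x)\<^sup>2 * (norm h)\<^sup>2)"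
      proof -
        have "(x \<bullet> h)\<^sup>2 \<le> (norm x * norm h)\<^sup>2"
          using power_mono[OF Cauchy_Schwarz_ineq2[of x h], of 2] by simp
        then show ?thesis unfolding t_def by (simp add: power_mult_distrib)
      qed
      finally show "norm (?G x)
        \<le> ?S x"
        by (simp add: mult_right_mono mult_ac)
    qed
    also have "\<dots> = (2 * pi)\<^sup>2 * (norm h)\<^sup>2 * I"
      unfolding I_def by (rule integral_mult_right_zero)
    finally have "norm (fourier f y - fourier f \<xi> - ?D h) \<le> (2 * pi)\<^sup>2 * I * norm h * norm h"
      by (simp only: power2_eq_square mult.assoc mult.commute mult.left_commute)
    moreover have "0 < norm h" using that by (simp add: h_def)
    ultimately show ?thesis
      unfolding h_def[symmetric] by (simp only: pos_divide_le_eq)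
  qed
  have "((\<lambda>y. (2 * pi)\<^sup>2 * I * norm (y - \<xi>)) \<longlongrightarrow> (2 * pi)\<^sup>2 * I * norm (\<xi> - \<xi>)) (at \<xi>)"
    by (intro tendsto_intros)
  then show "((\<lambda>y. (2 * pi)\<^sup>2 * I * norm (y - \<xi>)) \<longlongrightarrow> 0) (at \<xi>)" by simp
qed simp

lemma fourier_differentiable: "f \<in> schwartz \<Longrightarrow> fourier f differentiable_on UNIV"
  using fourier_has_derivative unfolding differentiable_on_def differentiable_def by blast

lemma partial_fourier:
  assumes "f \<in> schwartz"
  shows "partial i (fourier f) = fourier (\<lambda>x. - (2 * pi * \<i>) * (of_real (x $ i) * f x))"
proof
  fix \<xi>
  have "of_real (axis i (1::real) $ j) * z = (if j = i then z else 0)" for j and z :: complex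
    by (simp add: axis_def)
  then show "partial i (fourier f) \<xi> = fourier (\<lambda>x. - (2 * pi * \<i>) * (of_real (x $ i) * f x)) \<xi>"
    by (simp add: partial_eqI[OF fourier_has_derivative[OF assms]] del: of_real_mult mult_minus_left)
qed

lemma partial_has_vector_derivative:
  fixes f :: "real ^ 'n \<Rightarrow> complex"
  assumes "f differentiable_on UNIV"
  shows "((\<lambda>t. f (x + t *\<^sub>R axis i 1)) has_vector_derivative partial i f (x + t *\<^sub>R axis i 1)) (at t within S)"
proof -
  have 1: "((\<lambda>t. x + t *\<^sub>R axis i 1) has_derivative (\<lambda>h. h *\<^sub>R axis i 1)) (at t within S)"
    by (auto intro!: derivative_eq_intros)
  have "((\<lambda>t. f (x + t *\<^sub>R axis i 1)) has_derivative
      (\<lambda>h. frechet_derivative f (at (x + t *\<^sub>R axis i 1)) (h *\<^sub>R axis i 1))) (at t within S)"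
    by (rule has_derivative_compose[OF 1 has_derivative_frechet[OF assms]])
  then show ?thesis
    unfolding has_vector_derivative_def partial_def
    by (simp add: linear_scale[OF has_derivative_linear[OF has_derivative_frechet[OF assms]]])
qed

text \<open>Every difference quotient of \<open>h\<close> has integral 0 by translation invariance,
  and the quotients converge to the partial derivative under a dominating function supplied by the
  mean value inequality.\<close>

lemma integral_partial_eq_0:
  fixes h :: "real ^ 'n \<Rightarrow> complex"
  assumes diff: "h differentiable_on UNIV" and h: "rapidly_decreasing h"
    and h': "rapidly_decreasing (partial i h)" and [measurable]: "partial i h \<in> borel_measurable borel"
  shows "(\<integral>x. partial i h x \<partial>lborel) = 0"
proof -
  define m where "m = DIM(real ^ 'n) + 2"
  obtain C where "0 \<le> C" and C: "\<And>x. norm (partial i h x) \<le> C * (1 / (1 + norm x) ^ m)"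
    using rapidly_decreasingE[OF h', of m] by blast
  have hm [measurable]: "h \<in> borel_measurable borel"
    by (intro borel_measurable_continuous_onI differentiable_imp_continuous_on diff)
  have hi: "integrable lborel h" by (intro rapidly_decreasing_integrable h hm)
  define e :: "nat \<Rightarrow> real" where "e j = inverse (real (Suc j))" for j
  have e: "0 < e j" "e j \<le> 1" for j unfolding e_def by (auto intro: inverse_le_1_iff[THEN iffD2])
  define v :: "real ^ 'n" where "v = axis i 1"
  have v: "norm v = 1" by (simp add: v_def)
  define s where "s j x = (h (x + e j *\<^sub>R v) - h x) /\<^sub>R e j" for j x
  have bound: "norm (s j x) \<le> C * 2 ^ m * (1 / (1 + norm x) ^ m)" for j x
  proof -
    have "norm (h (x + e j *\<^sub>R v) - h (x + 0 *\<^sub>R v)) \<le> C * 2 ^ m * (1 / (1 + norm x) ^ m) * norm (e j - 0)"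
    proof (rule differentiable_bound[where S = "{0..1}"])
      fix t :: real assume t: "t \<in> {0..1}"
      show "((\<lambda>t. h (x + t *\<^sub>R v)) has_derivative (\<lambda>r. r *\<^sub>R partial i h (x + t *\<^sub>R v))) (at t within {0..1})"
        using partial_has_vector_derivative[OF diff] unfolding has_vector_derivative_def v_def .
      \<comment> \<open>A shift of length at most 1 changes the weight by at most a factor 2; this
        is the source of \<open>2 ^ m\<close> in the dominating function.\<close>
      have "1 + norm x \<le> 2 * (1 + norm (x + t *\<^sub>R v))"
      proof -
        have "norm x \<le> norm (x + t *\<^sub>R v) + norm (t *\<^sub>R v)"
          using norm_triangle_ineq4[of "x + t *\<^sub>R v" "t *\<^sub>R v"] by simp
        moreover have "norm (t *\<^sub>R v) \<le> 1" using t v by simp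
        ultimately show ?thesis using norm_ge_zero[of "x + t *\<^sub>R v"] by (simp del: norm_ge_zero norm_scaleR)
      qed
      from power_mono[OF this, of m]
      have le: "(1 + norm x) ^ m \<le> 2 ^ m * (1 + norm (x + t *\<^sub>R v)) ^ m"
        by (simp only: power_mult_distrib) simp
      have "1 / (1 + norm (x + t *\<^sub>R v)) ^ m \<le> 2 ^ m * (1 / (1 + norm x) ^ m)"
      proof -
        have div: "1 / b' \<le> c' * (1 / a')" if "a' \<le> c' * b'" "0 < a'" "0 < b'" for a' b' c' :: real
          using that by (simp add: field_simps)
        show ?thesis by (rule div[OF le]) (simp_all add: add_pos_nonneg)
      qed
      then have "norm (partial i h (x + t *\<^sub>R v)) \<le> C * (2 ^ m * (1 / (1 + norm x) ^ m))"
        using C[of "x + t *\<^sub>R v"] \<open>0 \<le> C\<close> by (meson mult_left_mono order_trans)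
      then have le': "norm (partial i h (x + t *\<^sub>R v)) \<le> C * 2 ^ m * (1 / (1 + norm x) ^ m)"
        by (simp only: mult.assoc)
      show "onorm (\<lambda>r. r *\<^sub>R partial i h (x + t *\<^sub>R v)) \<le> C * 2 ^ m * (1 / (1 + norm x) ^ m)"
        by (rule onorm_le) (use mult_right_mono[OF le' abs_ge_zero] in \<open>simp only: norm_scaleR real_norm_def mult.commute\<close>)
    qed (use e[of j] in auto)
    then have *: "norm (h (x + e j *\<^sub>R v) - h x) \<le> C * 2 ^ m * (1 / (1 + norm x) ^ m) * e j"
      using e(1)[of j] by simp
    have "norm (s j x) = norm (h (x + e j *\<^sub>R v) - h x) / e j"
      using e(1)[of j] by (simp add: s_def divide_inverse mult.commute)
    also have "\<dots> \<le> C * 2 ^ m * (1 / (1 + norm x) ^ m)"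
      using * e(1)[of j] by (simp only: pos_divide_le_eq)
    finally show ?thesis .
  qed
  have lim: "(\<lambda>j. s j x) \<longlonglongrightarrow> partial i h x" for x
  proof -
    have "((\<lambda>t. h (x + t *\<^sub>R v)) has_vector_derivative partial i h x) (at 0)"
      using partial_has_vector_derivative[OF diff, of x i 0 UNIV] by (simp add: v_def)
    then have "((\<lambda>y. (h (x + y *\<^sub>R v) - h x) /\<^sub>R y) \<longlongrightarrow> partial i h x) (at 0)"
    proof -
      assume "((\<lambda>t. h (x + t *\<^sub>R v)) has_vector_derivative partial i h x) (at 0)"
      then have "((\<lambda>y. norm (h (x + y *\<^sub>R v) - h x - y *\<^sub>R partial i h x) / norm y) \<longlongrightarrow> 0) (at 0)"
        by (simp add: has_vector_derivative_def has_derivative_iff_norm)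
      moreover have "norm (h (x + y *\<^sub>R v) - h x - y *\<^sub>R partial i h x) / norm y =
          norm ((h (x + y *\<^sub>R v) - h x) /\<^sub>R y - partial i h x)" if "y \<noteq> 0" for y
      proof -
        have "(h (x + y *\<^sub>R v) - h x) /\<^sub>R y - partial i h x = (h (x + y *\<^sub>R v) - h x - y *\<^sub>R partial i h x) /\<^sub>R y"
          using that by (simp add: scaleR_diff_right)
        then show ?thesis by (simp add: divide_inverse mult.commute)
      qed
      then have "\<forall>\<^sub>F y in at 0. norm (h (x + y *\<^sub>R v) - h x - y *\<^sub>R partial i h x) / norm y =
          norm ((h (x + y *\<^sub>R v) - h x) /\<^sub>R y - partial i h x)"
        by (auto simp: eventually_at_filter)
      ultimately have "((\<lambda>y. norm ((h (x + y *\<^sub>R v) - h x) /\<^sub>R y - partial i h x)) \<longlongrightarrow> 0) (at 0)"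
        by (rule Lim_transform_eventually)
      then show ?thesis by (simp only: tendsto_norm_zero_iff LIM_zero_iff)
    qed
    moreover have "filterlim e (at 0) sequentially"
    proof -
      have "e \<longlonglongrightarrow> 0" unfolding e_def by (rule LIMSEQ_inverse_real_of_nat)
      moreover have "e j \<noteq> 0" for j using e(1)[of j] by simp
      ultimately show ?thesis unfolding filterlim_at by simp
    qed
    ultimately show ?thesis
      unfolding s_def by (rule filterlim_compose)
  qed
  have "(\<lambda>j. \<integral>x. s j x \<partial>lborel) \<longlonglongrightarrow> (\<integral>x. partial i h x \<partial>lborel)"
  proof (rule integral_dominated_convergence)
    show "integrable lborel (\<lambda>x::real ^ 'n. C * 2 ^ m * (1 / (1 + norm x) ^ m))"
      unfolding m_def by (intro integrable_mult_right integrable_decay)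
    show "(\<lambda>x. s j x) \<in> borel_measurable lborel" for j unfolding s_def by measurable
    show "AE x in lborel. norm (s j x) \<le> C * 2 ^ m * (1 / (1 + norm x) ^ m)" for j
      by (intro AE_I2 bound)
  qed (simp_all add: lim)
  moreover have "(\<integral>x. s j x \<partial>lborel) = 0" for j
  proof -
    have i1: "integrable lborel (\<lambda>x. h (x + e j *\<^sub>R v))"
      using integrable_affine_lborel[OF hi, of 1 "e j *\<^sub>R v"] by simp
    have "(\<integral>x. h (x + e j *\<^sub>R v) \<partial>lborel) = (\<integral>x. h x \<partial>lborel)"
      using integral_affine_lborel[OF hm, of 1 "e j *\<^sub>R v"] by simp
    then show ?thesis
      unfolding s_def using i1 hi by simp
  qed
  ultimately show ?thesis
    by (simp add: LIMSEQ_const_iff)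
qed

text \<open>Integration by parts: the partial derivative of the product of \<open>f\<close> with the
  character has integral 0, and differentiating the character produces the factor.\<close>

lemma fourier_partial:
  fixes f :: "real ^ 'n \<Rightarrow> complex"
  assumes f: "f \<in> schwartz"
  shows "fourier (partial i f) \<xi> = 2 * pi * \<i> * of_real (\<xi> $ i) * fourier f \<xi>"
proof -
  define E :: "real ^ 'n \<Rightarrow> complex" where "E x = wave \<xi> x" for x
  have dE: "(E has_derivative (\<lambda>h. - (2 * pi * \<i> * of_real (h \<bullet> \<xi>)) * E x)) (at x)" for x
  proof -
    define c :: complex where "c = - (2 * pi * \<i>)"
    have Ec: "E = (\<lambda>x. exp (c * of_real (x \<bullet> \<xi>)))"
      by (simp add: E_def cis_conv_exp c_def fun_eq_iff mult_ac)
    have "((\<lambda>x. c * of_real (x \<bullet> \<xi>)) has_derivative (\<lambda>h. c * of_real (h \<bullet> \<xi>))) (at x)"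
      by (intro bounded_linear_imp_has_derivative bounded_linear_compose[OF bounded_linear_mult_right]
        bounded_linear_compose[OF bounded_linear_of_real] bounded_linear_inner_left)
    from has_derivative_compose[OF this, of exp] DERIV_exp[of "c * of_real (x \<bullet> \<xi>)"]
    have "(E has_derivative (\<lambda>h. E x * (c * of_real (h \<bullet> \<xi>)))) (at x)"
      unfolding Ec has_field_derivative_def by blast
    then show ?thesis by (simp add: c_def mult_ac)
  qed
  then have E: "E differentiable_on UNIV"
    unfolding differentiable_on_def differentiable_def by auto
  have pE: "partial i E x = - (2 * pi * \<i> * of_real (\<xi> $ i)) * E x" for x
    by (simp add: partial_eqI[OF dE] inner_axis inner_commute)
  note fd = schwartzD_differentiable[OF f]
  have ph: "partial i (\<lambda>x. E x * f x) = (\<lambda>x. E x * partial i f x + - (2 * pi * \<i> * of_real (\<xi> $ i)) * (E x * f x))"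
    by (simp add: partial_mult[OF E fd] pE fun_eq_iff)
  have nE: "norm (E x) \<le> 1" for x by (simp add: E_def)
  have r1: "rapidly_decreasing (\<lambda>x. E x * f x)"
    by (rule rapidly_decreasing_mult_bounded[OF schwartzD_rapid[OF f] nE])
  have r2: "rapidly_decreasing (\<lambda>x. E x * partial i f x)"
    by (rule rapidly_decreasing_mult_bounded[OF schwartzD_rapid[OF schwartz_partial[OF f]] nE])
  have r3: "rapidly_decreasing (\<lambda>x. - (2 * pi * \<i> * of_real (\<xi> $ i)) * (E x * f x))"
    by (rule rapidly_decreasing_mult_bounded[OF r1 order_refl])
  have [measurable]: "E \<in> borel_measurable borel" "f \<in> borel_measurable borel" "partial i f \<in> borel_measurable borel"
    using schwartz_measurable[OF f] schwartz_measurable[OF schwartz_partial[OF f]]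
    unfolding E_def by simp_all
  have "(\<integral>x. partial i (\<lambda>x. E x * f x) x \<partial>lborel) = 0"
  proof (rule integral_partial_eq_0)
    show "(\<lambda>x. E x * f x) differentiable_on UNIV" by (rule differentiable_on_mult[OF E fd])
    show "rapidly_decreasing (partial i (\<lambda>x. E x * f x))"
      unfolding ph by (rule rapidly_decreasing_add[OF r2 r3])
    show "partial i (\<lambda>x. E x * f x) \<in> borel_measurable borel" unfolding ph by measurable
  qed (rule r1)
  moreover have i2: "integrable lborel (\<lambda>x. E x * partial i f x)"
    by (rule rapidly_decreasing_integrable[OF r2]) measurable
  moreover have i3: "integrable lborel (\<lambda>x. - (2 * pi * \<i> * of_real (\<xi> $ i)) * (E x * f x))"
    by (rule rapidly_decreasing_integrable[OF r3]) measurable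
  ultimately have "(\<integral>x. E x * partial i f x \<partial>lborel) + (\<integral>x. - (2 * pi * \<i> * of_real (\<xi> $ i)) * (E x * f x) \<partial>lborel) = 0"
    unfolding ph by (simp only: Bochner_Integration.integral_add)
  then have "(\<integral>x. E x * partial i f x \<partial>lborel) = 2 * pi * \<i> * of_real (\<xi> $ i) * (\<integral>x. E x * f x \<partial>lborel)"
    unfolding integral_mult_right_zero by (simp add: add_eq_0_iff)
  then show ?thesis
    unfolding fourier_cis E_def[symmetric] .
qed

text \<open>Induction on the power of the weight. One more factor 1 + |\<xi>| is at most 1 plus the
  sum of the |\<xi>_i|, and each |\<xi>_i| is traded for a partial derivative of \<open>f\<close> by
  \<open>fourier_partial\<close>, where 2 pi \<ge> 1.\<close>

lemma fourier_rapidly_decreasing: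
  fixes f :: "real ^ 'n \<Rightarrow> complex"
  assumes "f \<in> schwartz"
  shows "rapidly_decreasing (fourier f)"
  unfolding rapidly_decreasing_def
proof
  fix m :: nat
  show "\<exists>C. \<forall>\<xi>. (1 + norm \<xi>) ^ m * norm (fourier f \<xi>) \<le> C"
    using assms
  proof (induction m arbitrary: f)
    case 0
    then show ?case using norm_fourier_le[of f] by (intro exI[of _ "\<integral>x. norm (f x) \<partial>lborel"]) simp
  next
    case (Suc m)
    obtain C where C: "\<And>\<xi>. (1 + norm \<xi>) ^ m * norm (fourier f \<xi>) \<le> C"
      using Suc.IH[OF Suc.prems] by blast
    have "\<forall>i. \<exists>D. \<forall>\<xi>. (1 + norm \<xi>) ^ m * norm (fourier (partial i f) \<xi>) \<le> D"
      using Suc.IH[OF schwartz_partial[OF Suc.prems]] by blast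
    then obtain D where D: "\<And>i \<xi>. (1 + norm \<xi>) ^ m * norm (fourier (partial i f) \<xi>) \<le> D i"
      by metis
    have "(1 + norm \<xi>) ^ Suc m * norm (fourier f \<xi>) \<le> C + (\<Sum>i\<in>UNIV. D i)" for \<xi>
    proof -
      have le: "\<bar>\<xi> $ i\<bar> * norm (fourier f \<xi>) \<le> norm (fourier (partial i f) \<xi>)" for i
      proof -
        have "1 * (\<bar>\<xi> $ i\<bar> * norm (fourier f \<xi>)) \<le> (2 * pi) * (\<bar>\<xi> $ i\<bar> * norm (fourier f \<xi>))"
          using pi_gt3 by (intro mult_right_mono) auto
        then show ?thesis by (simp add: fourier_partial[OF Suc.prems] norm_mult)
      qed
      have "(1 + norm \<xi>) * norm (fourier f \<xi>) \<le> norm (fourier f \<xi>) + (\<Sum>i\<in>UNIV. \<bar>\<xi> $ i\<bar>) * norm (fourier f \<xi>)"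
        using mult_right_mono[OF norm_le_l1_cart[of \<xi>], of "norm (fourier f \<xi>)"] by (simp add: algebra_simps)
      also have "\<dots> \<le> norm (fourier f \<xi>) + (\<Sum>i\<in>UNIV. norm (fourier (partial i f) \<xi>))"
        by (auto simp: sum_distrib_right intro!: sum_mono le)
      finally have "(1 + norm \<xi>) ^ m * ((1 + norm \<xi>) * norm (fourier f \<xi>)) \<le>
        (1 + norm \<xi>) ^ m * (norm (fourier f \<xi>) + (\<Sum>i\<in>UNIV. norm (fourier (partial i f) \<xi>)))"
        by (intro mult_left_mono) auto
      also have "\<dots> = (1 + norm \<xi>) ^ m * norm (fourier f \<xi>) + (\<Sum>i\<in>UNIV. (1 + norm \<xi>) ^ m * norm (fourier (partial i f) \<xi>))"
        by (simp add: distrib_left sum_distrib_left)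
      also have "\<dots> \<le> C + (\<Sum>i\<in>UNIV. D i)"
        by (intro add_mono sum_mono C D)
      finally show ?thesis by (simp add: mult_ac)
    qed
    then show ?case by blast
  qed
qed

lemma schwartz_fourier:
  fixes f :: "real ^ 'n \<Rightarrow> complex"
  assumes f: "f \<in> schwartz" shows "fourier f \<in> schwartz"
proof (rule schwartz_coinduct[where P = "fourier ` schwartz"])
  show "partial i g \<in> fourier ` schwartz" if "g \<in> fourier ` schwartz" for g i
  proof -
    from that obtain f where f: "f \<in> schwartz" and g: "g = fourier f" by blast
    show ?thesis
      unfolding g partial_fourier[OF f] by (intro imageI schwartz_cmult schwartz_mult_coord f)
  qed
qed (use f in \<open>auto intro: fourier_differentiable fourier_rapidly_decreasing\<close>)

lemma schwartz_inv_fourier: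
  fixes f :: "real ^ 'n \<Rightarrow> complex"
  assumes f: "f \<in> schwartz" shows "inv_fourier f \<in> schwartz"
  using schwartz_affine[OF schwartz_fourier[OF f], of "- 1" 1 0] by (simp add: inv_fourier_eq[abs_def])

section \<open>Multiplication formula, convolution, dilation and translation\<close>

lemma integral_fourier_mult:
  fixes f g :: "real ^ 'n \<Rightarrow> complex"
  assumes f: "integrable lborel f" and g: "integrable lborel g"
  shows "(\<integral>\<xi>. fourier f \<xi> * g \<xi> \<partial>lborel) = (\<integral>x. f x * fourier g x \<partial>lborel)"
proof -
  have [measurable]: "f \<in> borel_measurable borel" "g \<in> borel_measurable borel" using f g by simp_all
  define H where "H x \<xi> = wave \<xi> x * f x * g \<xi>" for x \<xi>
  have "integrable (lborel \<Otimes>\<^sub>M lborel) (case_prod H)"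
  proof (rule lborel_pair.Fubini_integrable)
    show "case_prod H \<in> borel_measurable (lborel \<Otimes>\<^sub>M lborel)" unfolding H_def by measurable
    have "integrable lborel (\<lambda>x. norm (f x) * (\<integral>y. norm (g y) \<partial>lborel))"
      using f by (intro integrable_mult_left integrable_norm)
    then show "integrable lborel (\<lambda>x. (\<integral>y. norm (case (x, y) of (x, \<xi>) \<Rightarrow> H x \<xi>) \<partial>lborel))"
      by (simp add: H_def norm_mult)
    show "AE x in lborel. integrable lborel (\<lambda>y. case (x, y) of (x, \<xi>) \<Rightarrow> H x \<xi>)"
    proof (intro AE_I2)
      fix x
      have "integrable lborel (\<lambda>\<xi>. f x * (wave x \<xi> * g \<xi>))"
        by (intro integrable_mult_right integrable_cis_mult g)
      then show "integrable lborel (\<lambda>y. case (x, y) of (x, \<xi>) \<Rightarrow> H x \<xi>)"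
        by (simp add: H_def mult_ac inner_commute)
    qed
  qed
  from lborel_pair.Fubini_integral[OF this]
  have "(\<integral>\<xi>. (\<integral>x. H x \<xi> \<partial>lborel) \<partial>lborel) = (\<integral>x. (\<integral>\<xi>. H x \<xi> \<partial>lborel) \<partial>lborel)" .
  moreover have "(\<integral>x. H x \<xi> \<partial>lborel) = fourier f \<xi> * g \<xi>" for \<xi>
    unfolding H_def fourier_cis by simp
  moreover have "(\<integral>\<xi>. H x \<xi> \<partial>lborel) = f x * fourier g x" for x
    unfolding H_def fourier_cis
    by (subst integral_mult_right_zero[symmetric])
      (intro Bochner_Integration.integral_cong refl, simp add: mult_ac inner_commute)
  ultimately show ?thesis by simp
qed

text \<open>The multiplier \<eta> acts as convolution with its transform. The proof writes
  \<open>inv_fourier \<psi>\<close> as the transform of the reflected \<psi> and moves this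
  transform over by the multiplication formula; the character that then multiplies \<eta> becomes a
  translation.\<close>

lemma fourier_mult_inv_fourier:
  fixes \<eta> \<psi> :: "real ^ 'n \<Rightarrow> complex"
  assumes \<eta>: "integrable lborel \<eta>" and \<psi>: "integrable lborel \<psi>"
  shows "fourier (\<lambda>\<xi>. \<eta> \<xi> * inv_fourier \<psi> \<xi>) x = (\<integral>y. \<psi> y * fourier \<eta> (x - y) \<partial>lborel)"
proof -
  have [measurable]: "\<eta> \<in> borel_measurable borel" "\<psi> \<in> borel_measurable borel" using \<eta> \<psi> by simp_all
  define \<psi>' where "\<psi>' y = \<psi> (- y)" for y
  have \<psi>': "integrable lborel \<psi>'"
    using integrable_affine_lborel[OF \<psi>, of "- 1" 0] by (simp add: \<psi>'_def[abs_def])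
  have inv: "inv_fourier \<psi> \<xi> = fourier \<psi>' \<xi>" for \<xi>
  proof -
    have "fourier \<psi>' \<xi> = (\<integral>y. wave (- \<xi>) (- y) * \<psi> (- y) \<partial>lborel)"
      by (simp add: fourier_cis \<psi>'_def)
    also have "\<dots> = fourier \<psi> (- \<xi>)"
      using integral_affine_lborel[of "\<lambda>y. wave (- \<xi>) y * \<psi> y" "- 1" 0]
      by (simp add: fourier_cis)
    finally show ?thesis by (simp add: inv_fourier_eq)
  qed
  have "fourier (\<lambda>\<xi>. \<eta> \<xi> * inv_fourier \<psi> \<xi>) x = (\<integral>\<xi>. fourier \<psi>' \<xi> * (wave x \<xi> * \<eta> \<xi>) \<partial>lborel)"
    unfolding inv fourier_cis[of _ x] by (simp add: mult_ac)
  also have "\<dots> = (\<integral>y. \<psi>' y * fourier (\<lambda>\<xi>. wave x \<xi> * \<eta> \<xi>) y \<partial>lborel)"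
    by (rule integral_fourier_mult[OF \<psi>' integrable_cis_mult[OF \<eta>]])
  also have "\<dots> = (\<integral>y. \<psi>' y * fourier \<eta> (x + y) \<partial>lborel)"
  proof -
    have "cis a * (cis b * z) = cis (a + b) * z" for a b z by (simp add: mult.assoc[symmetric] cis_mult)
    moreover have "- (2 * pi * (\<xi> \<bullet> y)) + - (2 * pi * (\<xi> \<bullet> x)) = - (2 * pi * (\<xi> \<bullet> (x + y)))" for \<xi> y
      by (simp add: inner_add_right algebra_simps)
    ultimately show ?thesis unfolding fourier_cis by (simp only:)
  qed
  also have "\<dots> = (\<integral>y. \<psi> (-y) * fourier \<eta> (x - (- y)) \<partial>lborel)"
    by (simp add: \<psi>'_def)
  also have "\<dots> = (\<integral>y. \<psi> y * fourier \<eta> (x - y) \<partial>lborel)"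
  proof -
    have "fourier \<eta> \<in> borel_measurable borel"
      unfolding fourier_cis[abs_def] by measurable
    then show ?thesis
      using integral_affine_lborel[of "\<lambda>y. \<psi> y * fourier \<eta> (x - y)" "- 1" 0] by simp
  qed
  finally show ?thesis .
qed

lemma fourier_dilate:
  fixes f :: "real ^ 'n \<Rightarrow> complex"
  assumes [measurable]: "f \<in> borel_measurable borel" and a: "0 < a"
  shows "fourier (\<lambda>x. f (a *\<^sub>R x)) \<xi> = (1 / a ^ CARD('n)) *\<^sub>R fourier f (\<xi> /\<^sub>R a)"
proof -
  have "fourier f (\<xi> /\<^sub>R a) = (a ^ CARD('n)) *\<^sub>R (\<integral>x. wave (\<xi> /\<^sub>R a) (a *\<^sub>R x) * f (a *\<^sub>R x) \<partial>lborel)"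
    using integral_affine_lborel[of "\<lambda>x. wave (\<xi> /\<^sub>R a) x * f x" a 0] a
    by (simp add: fourier_cis)
  also have "(\<integral>x. wave (\<xi> /\<^sub>R a) (a *\<^sub>R x) * f (a *\<^sub>R x) \<partial>lborel) = fourier (\<lambda>x. f (a *\<^sub>R x)) \<xi>"
  proof -
    have "(a *\<^sub>R x) \<bullet> (\<xi> /\<^sub>R a) = x \<bullet> \<xi>" for x
      using a by (simp add: mult.assoc[symmetric])
    then show ?thesis by (simp only: fourier_cis)
  qed
  finally show ?thesis using a by simp
qed

lemma fourier_translate:
  fixes f :: "real ^ 'n \<Rightarrow> complex"
  assumes [measurable]: "f \<in> borel_measurable borel"
  shows "fourier (\<lambda>x. f (x + v)) \<xi> = cis (2 * pi * (v \<bullet> \<xi>)) * fourier f \<xi>"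
proof -
  have "fourier f \<xi> = (\<integral>x. wave \<xi> (x + v) * f (x + v) \<partial>lborel)"
    using integral_affine_lborel[of "\<lambda>x. wave \<xi> x * f x" 1 v]
    by (simp add: fourier_cis)
  then have "cis (2 * pi * (v \<bullet> \<xi>)) * fourier f \<xi> =
      (\<integral>x. cis (2 * pi * (v \<bullet> \<xi>)) * (wave \<xi> (x + v) * f (x + v)) \<partial>lborel)"
    by simp
  also have "\<dots> = (\<integral>x. wave \<xi> x * f (x + v) \<partial>lborel)"
    by (intro Bochner_Integration.integral_cong refl)
      (simp add: mult.assoc[symmetric] cis_mult inner_add_left distrib_left)
  finally show ?thesis by (simp add: fourier_cis)
qed

section \<open>Fourier inversion up to a constant\<close>

text \<open>Testing \<open>fourier f\<close> against the dilates \<open>W (\<epsilon> \<xi>)\<close> and letting \<open>\<epsilon> \<rightarrow> 0\<close> gives Fourier inversion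
  up to a constant that does not depend on \<open>f\<close>.\<close>

lemma integral_fourier_proportional:
  fixes f W :: "real ^ 'n \<Rightarrow> complex"
  assumes f: "f \<in> schwartz" and W: "W \<in> schwartz"
  shows "(\<integral>\<xi>. fourier f \<xi> \<partial>lborel) * W 0 = f 0 * (\<integral>\<xi>. fourier W \<xi> \<partial>lborel)"
proof -
  define e :: "nat \<Rightarrow> real" where "e j = inverse (real (Suc j))" for j
  have e: "0 < e j" for j by (simp add: e_def)
  have e0: "e \<longlonglongrightarrow> 0" unfolding e_def by (rule LIMSEQ_inverse_real_of_nat)
  have lim: "(\<lambda>j. h (e j *\<^sub>R x)) \<longlonglongrightarrow> h 0" if "h \<in> schwartz" for h :: "real ^ 'n \<Rightarrow> complex" and x
  proof -
    have "isCont h 0" using schwartz_continuous[OF that] by (simp add: continuous_on_eq_continuous_at)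
    moreover have "(\<lambda>j. e j *\<^sub>R x) \<longlonglongrightarrow> 0" using tendsto_scaleR[OF e0 tendsto_const[of x]] by simp
    ultimately show ?thesis by (rule isCont_tendsto_compose)
  qed
  have [measurable]: "f \<in> borel_measurable borel" "W \<in> borel_measurable borel"
    "fourier f \<in> borel_measurable borel" "fourier W \<in> borel_measurable borel"
    using schwartz_measurable f W schwartz_fourier by blast+
  have conv: "(\<lambda>j. \<integral>x. h (e j *\<^sub>R x) * w x \<partial>lborel) \<longlonglongrightarrow> (\<integral>x. h 0 * w x \<partial>lborel)"
    if h: "h \<in> schwartz" and w: "w \<in> schwartz" for h w :: "real ^ 'n \<Rightarrow> complex"
  proof -
    obtain B where B: "0 \<le> B" "\<And>x. norm (h x) \<le> B" using schwartzD_bounded[OF h] by blast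
    have [measurable]: "h \<in> borel_measurable borel" "w \<in> borel_measurable borel"
      using schwartz_measurable h w by blast+
    show ?thesis
    proof (rule integral_dominated_convergence[where w = "\<lambda>x. B * norm (w x)"])
      show "integrable lborel (\<lambda>x. B * norm (w x))"
        by (intro integrable_mult_right integrable_norm schwartz_integrable w)
      show "AE x in lborel. (\<lambda>j. h (e j *\<^sub>R x) * w x) \<longlonglongrightarrow> h 0 * w x"
        by (intro AE_I2 tendsto_mult lim h tendsto_const)
      show "AE x in lborel. norm (h (e j *\<^sub>R x) * w x) \<le> B * norm (w x)" for j
        by (intro AE_I2) (simp add: norm_mult mult_right_mono B)
    qed simp_all
  qed
  \<comment> \<open>By the multiplication formula the dilation moves from \<open>W\<close> to
    \<open>f\<close>; the Jacobian cancels the factor from \<open>fourier_dilate\<close>.\<close>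
  have eq: "(\<integral>\<xi>. W (e j *\<^sub>R \<xi>) * fourier f \<xi> \<partial>lborel) = (\<integral>x. f (e j *\<^sub>R x) * fourier W x \<partial>lborel)" for j
  proof -
    have "integrable lborel (\<lambda>x. W (e j *\<^sub>R x))"
      using integrable_affine_lborel[OF schwartz_integrable[OF W], of "e j" 0] e[of j] by simp
    from integral_fourier_mult[OF schwartz_integrable[OF f] this]
    have "(\<integral>\<xi>. W (e j *\<^sub>R \<xi>) * fourier f \<xi> \<partial>lborel) = (\<integral>x. f x * fourier (\<lambda>x. W (e j *\<^sub>R x)) x \<partial>lborel)"
      by (simp add: mult.commute)
    also have "\<dots> = (\<integral>x. f x * ((1 / e j ^ CARD('n)) *\<^sub>R fourier W (x /\<^sub>R e j)) \<partial>lborel)"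
      by (simp only: fourier_dilate[OF \<open>W \<in> borel_measurable borel\<close> e])
    also have "\<dots> = (\<bar>e j\<bar> ^ DIM(real ^ 'n)) *\<^sub>R (\<integral>x. f (e j *\<^sub>R x) * ((1 / e j ^ CARD('n)) *\<^sub>R fourier W x) \<partial>lborel)"
      using integral_affine_lborel[of "\<lambda>x. f x * ((1 / e j ^ CARD('n)) *\<^sub>R fourier W (x /\<^sub>R e j))" "e j" 0] e[of j]
      by simp
    also have "\<dots> = (\<integral>x. f (e j *\<^sub>R x) * fourier W x \<partial>lborel)"
      using e[of j] by simp
    finally show ?thesis .
  qed
  have "(\<integral>\<xi>. W 0 * fourier f \<xi> \<partial>lborel) = (\<integral>x. f 0 * fourier W x \<partial>lborel)"
    using LIMSEQ_unique[OF conv[OF W schwartz_fourier[OF f], unfolded eq] conv[OF f schwartz_fourier[OF W]]] .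
  then show ?thesis by (simp add: mult.commute)
qed

lemma integral_pos_of_continuous:
  fixes f :: "real ^ 'n \<Rightarrow> real"
  assumes cont: "continuous_on UNIV f" and nonneg: "\<And>x. 0 \<le> f x" and pos: "0 < f x0" and int: "integrable lborel f"
  shows "0 < (\<integral>x. f x \<partial>lborel)"
proof (rule ccontr)
  assume "\<not> 0 < (\<integral>x. f x \<partial>lborel)"
  moreover have "0 \<le> (\<integral>x. f x \<partial>lborel)" by (intro Bochner_Integration.integral_nonneg nonneg)
  ultimately have "(\<integral>x. f x \<partial>lborel) = 0" by linarith
  then have "AE x in lborel. f x = 0"
    using integral_nonneg_eq_0_iff_AE[OF int] nonneg by auto
  then have "AE x in lborel. x \<notin> {x. 0 < f x}" by eventually_elim simp
  moreover have op: "open {x. 0 < f x}"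
    using open_Collect_less[OF continuous_on_const cont] by simp
  ultimately have null: "{x. 0 < f x} \<in> null_sets lborel"
    by (subst (asm) AE_iff_null_sets[symmetric]) auto
  obtain r where r: "0 < r" "ball x0 r \<subseteq> {x. 0 < f x}"
    using op pos unfolding open_contains_ball by blast
  from null_sets_subset[OF null _ r(2)] have "emeasure lborel (ball x0 r) = 0" by auto
  then show False
    using r(1) unit_ball_vol_pos[of "real CARD('n)"] by (simp add: emeasure_ball)
qed

text \<open>The constant is read off from a translate \<open>W\<close> of \<rho> with
  \<open>W 0\<close> nonzero. It cannot vanish: otherwise the transform of
  \<open>inv_fourier \<rho>\<close> would be 0, the multiplication formula would make the L2 norm of
  the transform of \<rho> vanish, and the value of that transform at 0, which is the integral of
  \<rho>, would be 0.\<close>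

lemma fourier_inversion_constant:
  fixes \<rho> :: "real ^ 'n \<Rightarrow> real"
  assumes \<rho>: "(\<lambda>x. complex_of_real (\<rho> x)) \<in> schwartz" and nonneg: "\<And>x. 0 \<le> \<rho> x" and pos: "0 < \<rho> x0"
  obtains c :: complex where "c \<noteq> 0" "\<And>(f :: real ^ 'n \<Rightarrow> complex) x. f \<in> schwartz \<Longrightarrow> inv_fourier (fourier f) x = c * f x"
proof -
  let ?\<rho> = "\<lambda>x. complex_of_real (\<rho> x)"
  define W where "W x = ?\<rho> (x + x0)" for x
  have W: "W \<in> schwartz" using schwartz_affine[OF \<rho>, of 1 1 x0] by (simp add: W_def[abs_def])
  have W0: "W 0 \<noteq> 0" using pos by (simp add: W_def)
  define c where "c = (\<integral>\<xi>. fourier W \<xi> \<partial>lborel) / W 0"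
  have inv: "inv_fourier (fourier f) x = c * f x" if f: "f \<in> schwartz" for f :: "real ^ 'n \<Rightarrow> complex" and x
  proof -
    have fx: "(\<lambda>y. f (y + x)) \<in> schwartz" using schwartz_affine[OF f, of 1 1 x] by simp
    have "inv_fourier (fourier f) x = (\<integral>\<xi>. fourier (\<lambda>y. f (y + x)) \<xi> \<partial>lborel)"
      unfolding fourier_translate[OF schwartz_measurable[OF f]] inv_fourier_def cis_conv_exp
      by (simp add: mult_ac)
    also have "\<dots> = c * f x"
      using integral_fourier_proportional[OF fx W] W0 by (simp add: c_def field_simps)
    finally show ?thesis .
  qed
  moreover have "c \<noteq> 0"
  proof
    assume c0: "c = 0"
    note F = schwartz_fourier[OF \<rho>]
    have [measurable]: "fourier ?\<rho> \<in> borel_measurable borel" by (rule schwartz_measurable[OF F])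
    \<comment> \<open>\<rho> is real-valued; this turns the pairing below into the integral of a
      squared modulus.\<close>
    have conj: "inv_fourier ?\<rho> \<xi> = cnj (fourier ?\<rho> \<xi>)" for \<xi>
    proof -
      have "cnj (fourier ?\<rho> \<xi>) = (\<integral>x. cnj (wave \<xi> x * ?\<rho> x) \<partial>lborel)"
        unfolding fourier_cis by (rule Bochner_Integration.integral_cnj[symmetric])
      then show ?thesis
        by (simp only: complex_cnj_mult cis_cnj complex_cnj_complex_of_real inv_fourier_eq fourier_cis
          inner_minus_right mult_minus_right minus_minus)
    qed
    have "fourier (inv_fourier ?\<rho>) x = 0" for x
    proof -
      have "fourier (inv_fourier ?\<rho>) x = (\<integral>\<xi>. wave (- x) (- \<xi>) * fourier ?\<rho> (- \<xi>) \<partial>lborel)"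
        by (simp add: fourier_cis[of _ x] inv_fourier_eq)
      also have "\<dots> = fourier (fourier ?\<rho>) (- x)"
        using integral_affine_lborel[of "\<lambda>\<xi>. wave (- x) \<xi> * fourier ?\<rho> \<xi>" "- 1" 0]
        by (simp add: fourier_cis[of _ "- x"])
      also have "\<dots> = 0" using inv[OF \<rho>, of x] c0 by (simp add: inv_fourier_eq)
      finally show ?thesis .
    qed
    then have "(\<integral>\<xi>. fourier ?\<rho> \<xi> * inv_fourier ?\<rho> \<xi> \<partial>lborel) = 0"
      by (simp add: integral_fourier_mult[OF schwartz_integrable[OF \<rho>] schwartz_integrable[OF schwartz_inv_fourier[OF \<rho>]]])
    then have "(\<integral>\<xi>. complex_of_real ((norm (fourier ?\<rho> \<xi>))\<^sup>2) \<partial>lborel) = 0"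
      by (simp only: conj complex_norm_square)
    then have int0: "(\<integral>\<xi>. (norm (fourier ?\<rho> \<xi>))\<^sup>2 \<partial>lborel) = 0"
      by (simp only: integral_complex_of_real of_real_eq_0_iff)
    have "integrable lborel (\<lambda>\<xi>. norm (fourier ?\<rho> \<xi> * fourier ?\<rho> \<xi>))"
      by (intro integrable_norm schwartz_integrable schwartz_mult F)
    then have intg: "integrable lborel (\<lambda>\<xi>. (norm (fourier ?\<rho> \<xi>))\<^sup>2)"
      by (simp add: norm_mult power2_eq_square)
    have "continuous_on UNIV (\<lambda>\<xi>. (norm (fourier ?\<rho> \<xi>))\<^sup>2)"
      by (intro continuous_intros schwartz_continuous F)
    from integral_pos_of_continuous[OF this _ _ intg, of 0] int0
    have "fourier ?\<rho> 0 = 0" by auto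
    then have "(\<integral>x. ?\<rho> x \<partial>lborel) = 0" by (simp add: fourier_cis)
    moreover have "integrable lborel (\<lambda>x. Re (?\<rho> x))"
      by (intro integrable_Re schwartz_integrable \<rho>)
    moreover have "continuous_on UNIV (\<lambda>x. Re (?\<rho> x))"
      by (intro continuous_intros schwartz_continuous \<rho>)
    ultimately show False
      using integral_pos_of_continuous[of \<rho> x0] nonneg pos by simp
  qed
  ultimately show thesis using that by blast
qed

section \<open>Pointwise bounds from testing against bump functions\<close>

text \<open>Fubini moves the mollification from \<open>G\<close> to \<open>u\<close>: integrating
  \<open>moll\<close> against the nonnegative weight u y shows that \<open>G\<close> has a
  nonpositive integral against the mollified \<open>u\<close>, which tends to a positive multiple of
  \<open>u\<close>.\<close>

lemma integral_continuous_nonpos_of_mollified: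
  fixes G \<rho> u :: "real ^ 'n \<Rightarrow> real"
  assumes [measurable]: "G \<in> borel_measurable borel"
    and loc: "\<And>R. integrable lborel (\<lambda>x. indicator (ball 0 R) x * G x)"
    and \<rho>: "continuous_on UNIV \<rho>" "\<And>x. 0 \<le> \<rho> x" "\<And>x. \<rho> x \<le> Q" "\<And>x. 2 < norm x \<Longrightarrow> \<rho> x = 0"
      "integrable lborel \<rho>" "0 < (\<integral>x. \<rho> x \<partial>lborel)"
    and moll: "\<And>e y. 0 < e \<Longrightarrow> (\<integral>x. G x * \<rho> ((x - y) /\<^sub>R e) \<partial>lborel) \<le> 0"
    and u: "continuous_on UNIV u" "\<And>x. 0 \<le> u x" "\<And>x. u x \<le> 1" "\<And>x. R \<le> norm x \<Longrightarrow> u x = 0"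
  shows "(\<integral>x. G x * u x \<partial>lborel) \<le> 0"
proof -
  define e :: "nat \<Rightarrow> real" where "e j = inverse (real (Suc j))" for j
  have e: "0 < e j" "e j \<le> 1" for j unfolding e_def by (auto intro: inverse_le_1_iff[THEN iffD2])
  have e0: "e \<longlonglongrightarrow> 0" unfolding e_def by (rule LIMSEQ_inverse_real_of_nat)
  have [measurable]: "\<rho> \<in> borel_measurable borel" "u \<in> borel_measurable borel"
    using \<rho>(1) u(1) borel_measurable_continuous_onI by blast+
  define I where "I = (\<integral>x. \<rho> x \<partial>lborel)"
  have I: "0 < I" using \<rho>(6) by (simp add: I_def)
  define u' where "u' j x = (\<integral>z. u (x - e j *\<^sub>R z) * \<rho> z \<partial>lborel)" for j x
  have u'm [measurable]: "u' j \<in> borel_measurable borel" for j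
    unfolding u'_def[abs_def] by measurable
  have u'_lim: "(\<lambda>j. u' j x) \<longlonglongrightarrow> I * u x" for x
  proof -
    have "(\<lambda>j. u' j x) \<longlonglongrightarrow> (\<integral>z. u x * \<rho> z \<partial>lborel)"
      unfolding u'_def
    proof (rule integral_dominated_convergence[where w = \<rho>])
      have ez: "(\<lambda>j. x - e j *\<^sub>R z) \<longlonglongrightarrow> x - 0 *\<^sub>R z" for z by (intro tendsto_intros e0)
      have "(\<lambda>j. u (x - e j *\<^sub>R z)) \<longlonglongrightarrow> u x" for z
        using isCont_tendsto_compose[of x u, OF _ ez[of z, simplified]] u(1) by (simp add: continuous_on_eq_continuous_at)
      then show "AE z in lborel. (\<lambda>j. u (x - e j *\<^sub>R z) * \<rho> z) \<longlonglongrightarrow> u x * \<rho> z"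
        by (intro AE_I2 tendsto_mult tendsto_const)
      show "AE z in lborel. norm (u (x - e j *\<^sub>R z) * \<rho> z) \<le> \<rho> z" for j
        by (intro AE_I2) (simp add: abs_mult \<rho>(2) u(2,3) mult_left_le_one_le)
    qed (simp_all add: \<rho>(5))
    then show ?thesis by (simp add: I_def mult.commute)
  qed
  \<comment> \<open>All mollified functions live in one ball: \<open>u\<close> vanishes from radius
    \<open>R\<close> on, and the shift \<open>e j *\<^sub>R z\<close> has length at most 2 wherever
    \<rho> is nonzero.\<close>
  have u'_bound: "\<bar>u' j x\<bar> \<le> I * indicator (ball 0 (R + 3)) x" for j x
  proof (cases "x \<in> ball 0 (R + 3)")
    case True
    have "norm (u' j x) \<le> (\<integral>z. \<rho> z \<partial>lborel)"
      unfolding u'_def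
      by (rule order_trans[OF integral_norm_bound], rule integral_mono'[OF \<rho>(5)])
        (simp_all add: abs_mult \<rho>(2) u(2,3) mult_left_le_one_le)
    with True show ?thesis by (simp add: I_def)
  next
    case False
    have "u (x - e j *\<^sub>R z) * \<rho> z = 0" for z
    proof (cases "2 < norm z")
      case nz: False
      have "norm (e j *\<^sub>R z) \<le> 2" using e[of j] nz mult_mono[of "e j" 1 "norm z" 2] by simp
      then have "R \<le> norm (x - e j *\<^sub>R z)" using False norm_triangle_ineq2[of x "e j *\<^sub>R z"] by simp
      then show ?thesis by (simp add: u(4))
    qed (simp add: \<rho>(4))
    then have "u' j x = 0" unfolding u'_def by (simp only: integral_zero)
    with I show ?thesis by simp
  qed
  have "(\<lambda>j. \<integral>x. G x * u' j x \<partial>lborel) \<longlonglongrightarrow> (\<integral>x. G x * (I * u x) \<partial>lborel)"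
  proof (rule integral_dominated_convergence[where w = "\<lambda>x. I * norm (indicator (ball 0 (R + 3)) x * G x)"])
    show "integrable lborel (\<lambda>x. I * norm (indicator (ball 0 (R + 3)) x * G x))"
      by (intro integrable_mult_right integrable_norm loc)
    show "AE x in lborel. (\<lambda>j. G x * u' j x) \<longlonglongrightarrow> G x * (I * u x)"
      by (intro AE_I2 tendsto_mult tendsto_const u'_lim)
    show "AE x in lborel. norm (G x * u' j x) \<le> I * norm (indicator (ball 0 (R + 3)) x * G x)" for j
    proof (rule AE_I2)
      fix x
      have "\<bar>G x\<bar> * \<bar>u' j x\<bar> \<le> \<bar>G x\<bar> * (I * indicator (ball 0 (R + 3)) x)"
        by (intro mult_left_mono u'_bound) simp
      then show "norm (G x * u' j x) \<le> I * norm (indicator (ball 0 (R + 3)) x * G x)"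
        by (simp add: abs_mult mult_ac)
    qed
  qed simp_all
  moreover have "(\<integral>x. G x * u' j x \<partial>lborel) \<le> 0" for j
  proof -
    let ?n = "DIM(real ^ 'n)"
    let ?q = "\<lambda>x. Q * \<bar>indicator (ball 0 (R + 3)) x * G x\<bar>"
    let ?m = "\<lambda>y. \<integral>x. G x * \<rho> ((x - y) /\<^sub>R e j) \<partial>lborel"
    \<comment> \<open>Substitution y = x - e z, with Jacobian e^n.\<close>
    have u'_conv: "(\<integral>y. u y * \<rho> ((x - y) /\<^sub>R e j) \<partial>lborel) = (e j ^ ?n) * u' j x" for x
    proof -
      have "x - ((- e j) *\<^sub>R z + x) = e j *\<^sub>R z" for z by simp
      then show ?thesis
        using integral_affine_lborel[of "\<lambda>y. u y * \<rho> ((x - y) /\<^sub>R e j)" "- e j" x] e(1)[of j]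
        by (simp add: u'_def)
    qed
    define H where "H x y = G x * (u y * \<rho> ((x - y) /\<^sub>R e j))" for x y
    have ui: "integrable lborel u"
    proof (rule Bochner_Integration.integrable_bound[of _ "indicator (ball 0 (R + 1)) :: _ \<Rightarrow> real"])
      show "integrable lborel (indicator (ball 0 (R + 1)) :: real ^ 'n \<Rightarrow> real)"
        by (intro integrable_real_indicator emeasure_bounded_finite bounded_ball) simp
      show "AE x in lborel. norm (u x) \<le> norm (indicator (ball 0 (R + 1)) x :: real)"
        using u(2-4) by (intro AE_I2) (auto simp: indicator_def)
    qed simp
    have H_bound: "\<bar>H x y\<bar> \<le> ?q x * u y" for x y
    proof (cases "x \<in> ball 0 (R + 3)")
      case True
      have "\<bar>H x y\<bar> = \<bar>G x\<bar> * u y * \<rho> ((x - y) /\<^sub>R e j)"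
        by (simp add: H_def abs_mult \<rho>(2) u(2))
      also have "\<dots> \<le> \<bar>G x\<bar> * u y * Q"
        by (intro mult_left_mono \<rho>(3) mult_nonneg_nonneg u(2)) simp
      finally show ?thesis using True by (simp add: mult_ac)
    next
      case False
      have "u y * \<rho> ((x - y) /\<^sub>R e j) = 0"
      proof (cases "R \<le> norm y")
        case ny: False
        have "norm (x - y) > 2" using False ny norm_triangle_ineq2[of x y] by simp
        moreover have "norm (x - y) \<le> norm ((x - y) /\<^sub>R e j)"
        proof -
          have "1 * norm (x - y) \<le> inverse (e j) * norm (x - y)"
            using e[of j] by (intro mult_right_mono) (auto simp: one_le_inverse)
          then show ?thesis using e[of j] by simp
        qed
        ultimately show ?thesis by (simp add: \<rho>(4))
      qed (simp add: u(4))
      then show ?thesis using False by (simp add: H_def)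
    qed
    have [measurable]: "case_prod H \<in> borel_measurable (lborel \<Otimes>\<^sub>M lborel)"
      unfolding H_def by measurable
    have "integrable (lborel \<Otimes>\<^sub>M lborel) (case_prod H)"
    proof (rule Bochner_Integration.integrable_bound[where f = "\<lambda>(x, y). ?q x * u y"])
      have [measurable]: "ball (0::real ^ 'n) (R + 3) \<in> sets borel" by simp
      show "integrable (lborel \<Otimes>\<^sub>M lborel) (\<lambda>(x, y). ?q x * u y)"
      proof (rule lborel_pair.Fubini_integrable)
        have "integrable lborel (\<lambda>x. ?q x)"
          using integrable_norm[OF loc] by (intro integrable_mult_right) simp
        from integrable_abs[OF this]
        show "integrable lborel (\<lambda>x. (\<integral>y. norm (case (x, y) of (x, y) \<Rightarrow> ?q x * u y) \<partial>lborel))"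
          by (simp add: abs_mult)
        show "AE x in lborel. integrable lborel (\<lambda>y. case (x, y) of (x, y) \<Rightarrow> ?q x * u y)"
          by (intro AE_I2) (simp add: ui)
      qed measurable
      show "AE z in lborel \<Otimes>\<^sub>M lborel. norm (case_prod H z) \<le> norm (case z of (x, y) \<Rightarrow> ?q x * u y)"
        by (intro AE_I2) (auto simp del: abs_mult intro: order_trans[OF H_bound abs_ge_self])
    qed measurable
    from lborel_pair.Fubini_integral[OF this]
    have "(\<integral>x. (\<integral>y. H x y \<partial>lborel) \<partial>lborel) = (\<integral>y. (\<integral>x. H x y \<partial>lborel) \<partial>lborel)" by simp
    also have "\<dots> = (\<integral>y. u y * ?m y \<partial>lborel)"
    proof -
      have "H x y = u y * (G x * \<rho> ((x - y) /\<^sub>R e j))" for x y by (simp add: H_def)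
      then show ?thesis by (simp only: integral_mult_right_zero)
    qed
    also have "\<dots> \<le> 0"
    proof -
      have "u y * ?m y \<le> 0" for y
        by (intro mult_nonneg_nonpos moll e u(2))
      then have "0 \<le> (\<integral>y. - (u y * ?m y) \<partial>lborel)"
        by (intro Bochner_Integration.integral_nonneg) simp
      then show ?thesis by (simp only: Bochner_Integration.integral_minus neg_0_le_iff_le)
    qed
    finally have "(\<integral>x. G x * ((e j ^ ?n) * u' j x) \<partial>lborel) \<le> 0"
      unfolding H_def by (simp only: integral_mult_right_zero u'_conv)
    then have "(e j ^ ?n) * (\<integral>x. G x * u' j x \<partial>lborel) \<le> 0"
      by (simp only: mult.left_commute[of _ "e j ^ ?n"] integral_mult_right_zero)
    then show ?thesis using zero_less_power[OF e(1)[of j], of ?n] by (auto simp: mult_le_0_iff)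
  qed
  ultimately have "(\<integral>x. G x * (I * u x) \<partial>lborel) \<le> 0"
    by (intro LIMSEQ_le_const2) auto
  then have "I * (\<integral>x. G x * u x \<partial>lborel) \<le> 0"
    by (simp only: mult.left_commute[of _ I] integral_mult_right_zero)
  then show ?thesis using I by (simp add: mult_le_0_iff)
qed

text \<open>Continuous cut-offs give the sign of the integral of \<open>G\<close> over every
  nonempty compact set. If \<open>G\<close> were positive on a set of positive measure, that set
  would contain a compact set of positive measure, over which the integral is positive.\<close>

lemma AE_nonpos_of_mollified:
  fixes G \<rho> :: "real ^ 'n \<Rightarrow> real"
  assumes Gm [measurable]: "G \<in> borel_measurable borel"
    and loc: "\<And>R. integrable lborel (\<lambda>x. indicator (ball 0 R) x * G x)"
    and \<rho>: "continuous_on UNIV \<rho>" "\<And>x. 0 \<le> \<rho> x" "\<And>x. \<rho> x \<le> Q" "\<And>x. 2 < norm x \<Longrightarrow> \<rho> x = 0"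
      "integrable lborel \<rho>" "0 < (\<integral>x. \<rho> x \<partial>lborel)"
    and moll: "\<And>e y. 0 < e \<Longrightarrow> (\<integral>x. G x * \<rho> ((x - y) /\<^sub>R e) \<partial>lborel) \<le> 0"
  shows "AE x in lborel. G x \<le> 0"
proof -
  have compact: "(\<integral>x. G x * indicator K x \<partial>lborel) \<le> 0" if K: "compact K" "K \<noteq> {}" for K :: "(real ^ 'n) set"
  proof -
    obtain R where R: "\<And>x. x \<in> K \<Longrightarrow> norm x \<le> R"
      using compact_imp_bounded[OF K(1)] unfolding bounded_iff by blast
    \<comment> \<open>Continuous functions that decrease to the indicator of \<open>K\<close> and
      vanish at distance 1 or more from it.\<close>
    define u where "u j x = max 0 (1 - real (Suc j) * infdist x K)" for j :: nat and x
    have uc: "continuous_on UNIV (u j)" for j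
      unfolding u_def by (intro continuous_intros)
    then have [measurable]: "u j \<in> borel_measurable borel" for j
      by (rule borel_measurable_continuous_onI)
    have u0: "u j x = 0" if "R + 1 \<le> norm x" for j x
    proof -
      have "1 \<le> dist x a" if "a \<in> K" for a
        using R[OF that] \<open>R + 1 \<le> norm x\<close> norm_triangle_ineq2[of x a] by (simp add: dist_norm)
      then have "1 \<le> infdist x K" using K(2) by (simp add: infdist_notempty cINF_greatest)
      then have "1 \<le> real (Suc j) * infdist x K"
        using mult_mono[of 1 "real (Suc j)" 1 "infdist x K"] by simp
      then show ?thesis by (simp add: u_def)
    qed
    have ub: "0 \<le> u j x" "u j x \<le> 1" for j x
      using infdist_nonneg[of x K] by (auto simp: u_def)
    have ulim: "(\<lambda>j. u j x) \<longlonglongrightarrow> indicator K x" for x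
    proof (cases "x \<in> K")
      case True then show ?thesis by (simp add: u_def)
    next
      case False
      have pos: "0 < infdist x K"
        using False K compact_imp_closed infdist_pos_not_in_closed by blast
      then obtain N where N: "1 < real N * infdist x K"
        using reals_Archimedean3 by blast
      have "u j x = 0" if "N \<le> j" for j
      proof -
        have "real N * infdist x K \<le> real (Suc j) * infdist x K"
          using that pos by (intro mult_right_mono) auto
        with N show ?thesis by (simp add: u_def)
      qed
      then have "eventually (\<lambda>j. u j x = 0) sequentially" by (auto simp: eventually_sequentially)
      then show ?thesis using False by (simp add: tendsto_eventually)
    qed
    have [measurable]: "K \<in> sets borel" "ball (0 :: real ^ 'n) (R + 1) \<in> sets borel" using K(1) by (simp_all add: borel_compact)
    have "(\<lambda>j. \<integral>x. G x * u j x \<partial>lborel) \<longlonglongrightarrow> (\<integral>x. G x * indicator K x \<partial>lborel)"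
    proof (rule integral_dominated_convergence[where w = "\<lambda>x. norm (indicator (ball 0 (R + 1)) x * G x)"])
      show "integrable lborel (\<lambda>x. norm (indicator (ball 0 (R + 1)) x * G x))"
        by (intro integrable_norm loc)
      show "AE x in lborel. (\<lambda>j. G x * u j x) \<longlonglongrightarrow> G x * indicator K x"
        by (intro AE_I2 tendsto_mult tendsto_const ulim)
      show "AE x in lborel. norm (G x * u j x) \<le> norm (indicator (ball 0 (R + 1)) x * G x)" for j
      proof (rule AE_I2)
        fix x
        show "norm (G x * u j x) \<le> norm (indicator (ball 0 (R + 1)) x * G x)"
          using ub[of j x] u0[of x j]
          by (cases "norm x < R + 1") (auto simp: abs_mult mult_left_le)
      qed
    qed measurable
    moreover have "(\<integral>x. G x * u j x \<partial>lborel) \<le> 0" for j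
      by (rule integral_continuous_nonpos_of_mollified[OF Gm loc \<rho> moll uc ub u0])
    ultimately show ?thesis by (intro LIMSEQ_le_const2) auto
  qed
  have "{x. 0 < G x} \<inter> ball 0 R \<in> null_sets lborel" for R
  proof (rule ccontr)
    assume nonnull: "{x. 0 < G x} \<inter> ball 0 R \<notin> null_sets lborel"
    define E where "E = {x. 0 < G x} \<inter> ball 0 R"
    have [measurable]: "ball (0 :: real ^ 'n) R \<in> sets borel" by simp
    have Em: "E \<in> sets borel"
      unfolding E_def by measurable
    have fin: "emeasure lborel E < \<infinity>"
      by (rule emeasure_bounded_finite) (auto simp: E_def intro: bounded_subset[OF bounded_ball])
    have pos: "0 < measure lborel E"
      using nonnull Em fin unfolding E_def[symmetric]
      by (auto simp: null_sets_def measure_def enn2real_positive_iff zero_less_iff_neq_zero)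
    have "E \<in> sets lebesgue" using Em by auto
    \<comment> \<open>The measure of \<open>E\<close> itself serves as the error bound: losing less
      than all of it keeps \<open>T\<close> from being null.\<close>
    from sets_lebesgue_inner_closed[OF this pos]
    obtain T where T: "closed T" "T \<subseteq> E" "E - T \<in> lmeasurable" "emeasure lebesgue (E - T) < ennreal (measure lborel E)"
      by blast
    have Tm [measurable]: "T \<in> sets borel" using T(1) by simp
    have "T \<notin> null_sets lborel"
    proof
      assume "T \<in> null_sets lborel"
      then have "emeasure lborel (E - T) = emeasure lborel E"
        using Em by (intro emeasure_Diff_null_set) auto
      moreover have "emeasure lebesgue (E - T) = emeasure lborel (E - T)"
        using Em Tm by simp
      moreover have "emeasure lborel E = ennreal (measure lborel E)"
        using fin by (intro emeasure_eq_ennreal_measure) auto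
      ultimately show False using T(4) by simp
    qed
    then have "T \<noteq> {}" by auto
    have "bounded T" using T(2) by (auto simp: E_def intro: bounded_subset[OF bounded_ball])
    then have "compact T" using T(1) by (simp add: compact_eq_bounded_closed)
    from compact[OF this \<open>T \<noteq> {}\<close>] have le: "(\<integral>x. G x * indicator T x \<partial>lborel) \<le> 0" .
    have nn: "0 \<le> G x * indicator T x" for x
      using T(2) by (auto simp: E_def indicator_def)
    have int: "integrable lborel (\<lambda>x. G x * indicator T x)"
    proof (rule Bochner_Integration.integrable_bound[OF loc[of R]])
      show "AE x in lborel. norm (G x * indicator T x) \<le> norm (indicator (ball 0 R) x * G x)"
        using T(2) by (intro AE_I2) (auto simp: E_def indicator_def)
    qed measurable
    have "(\<integral>x. G x * indicator T x \<partial>lborel) = 0"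
      using le Bochner_Integration.integral_nonneg[of lborel "\<lambda>x. G x * indicator T x"] nn by (simp add: antisym)
    then have "AE x in lborel. G x * indicator T x = 0"
      using integral_nonneg_eq_0_iff_AE[OF int] nn by simp
    then have "AE x in lborel. x \<notin> T"
    proof eventually_elim
      case (elim x)
      then show ?case using T(2) by (auto simp: E_def indicator_def split: if_splits)
    qed
    with \<open>T \<notin> null_sets lborel\<close> show False
      by (simp add: AE_iff_null_sets[symmetric])
  qed
  then have "(\<Union>j::nat. {x. 0 < G x} \<inter> ball 0 (real j)) \<in> null_sets lborel"
    by (intro null_sets_UN) auto
  moreover have "(\<Union>j::nat. {x. 0 < G x} \<inter> ball 0 (real j)) = {x. 0 < G x}"
    using reals_Archimedean2 by auto
  ultimately have "{x. 0 < G x} \<in> null_sets lborel" by simp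
  then show ?thesis
    by (rule AE_I'[THEN eventually_mono]) (auto simp: not_le)
qed

section \<open>Uniform bounds for the dyadic blocks\<close>

text \<open>The closure in the definition leaves the two boundary spheres undecided; there \<phi>
  vanishes by continuity, as a limit of its values at dilates outside the annulus. The strict bounds
  are what leaves only three terms in \<open>dyadic_resolution_reproducing\<close>.\<close>

lemma dyadic_resolution_support:
  assumes "dyadic_resolution \<phi>"
  shows "\<phi> \<xi> \<noteq> 0 \<Longrightarrow> 1 / 2 < norm \<xi> \<and> norm \<xi> < 2"
proof -
  have cont: "continuous_on UNIV \<phi>"
    using assms schwartz_continuous by (auto simp: dyadic_resolution_def)
  have out: "\<phi> \<xi> = 0" if "norm \<xi> < 1 / 2 \<or> 2 < norm \<xi>" for \<xi>
    using assms closure_subset[of "{\<xi>. \<phi> \<xi> \<noteq> 0}"] that by (fastforce simp: dyadic_resolution_def)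
  have lim0: "\<phi> \<xi> = 0" if s: "s \<longlonglongrightarrow> (1::real)" and z: "\<And>j::nat. \<phi> (s j *\<^sub>R \<xi>) = 0" for s \<xi>
  proof -
    have "(\<lambda>j. s j *\<^sub>R \<xi>) \<longlonglongrightarrow> 1 *\<^sub>R \<xi>" by (intro tendsto_intros s)
    then have "(\<lambda>j. \<phi> (s j *\<^sub>R \<xi>)) \<longlonglongrightarrow> \<phi> \<xi>"
      using isCont_tendsto_compose[of \<xi> \<phi>] cont by (auto simp: continuous_on_eq_continuous_at)
    then show ?thesis by (simp add: z LIMSEQ_const_iff)
  qed
  \<comment> \<open>The sequence starts at 1 / 2, so that 1 minus its terms stays strictly between 0
    and 1.\<close>
  have e: "(\<lambda>j. inverse (real (Suc (Suc j)))) \<longlonglongrightarrow> 0"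
    using LIMSEQ_Suc[OF LIMSEQ_inverse_real_of_nat] .
  have 1: "\<phi> \<xi> = 0" if "norm \<xi> = 1 / 2" for \<xi>
  proof (rule lim0)
    show "(\<lambda>j. 1 - inverse (real (Suc (Suc j)))) \<longlonglongrightarrow> 1" using tendsto_diff[OF tendsto_const[of 1] e] by simp
    have "0 < inverse (real (Suc (Suc j)))" "inverse (real (Suc (Suc j))) < 1" for j
      by (auto simp: inverse_eq_divide)
    then have "norm ((1 - inverse (real (Suc (Suc j)))) *\<^sub>R \<xi>) < 1 / 2" for j
      unfolding norm_scaleR that by (simp add: abs_of_pos)
    then show "\<phi> ((1 - inverse (real (Suc (Suc j)))) *\<^sub>R \<xi>) = 0" for j
      by (intro out disjI1)
  qed
  have 2: "\<phi> \<xi> = 0" if "norm \<xi> = 2" for \<xi>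
  proof (rule lim0)
    show "(\<lambda>j. 1 + inverse (real (Suc (Suc j)))) \<longlonglongrightarrow> 1" using tendsto_add[OF tendsto_const[of 1] e] by simp
    have "0 < inverse (real (Suc (Suc j)))" for j by simp
    then show "\<phi> ((1 + inverse (real (Suc (Suc j)))) *\<^sub>R \<xi>) = 0" for j
      using that by (intro out) (simp add: abs_of_pos add_pos_pos)
  qed
  show "\<phi> \<xi> \<noteq> 0 \<Longrightarrow> 1 / 2 < norm \<xi> \<and> norm \<xi> < 2"
    using out[of \<xi>] 1[of \<xi>] 2[of \<xi>] by linarith
qed

text \<open>Makes \<phi> itself available as the nonnegative bump, both for Fourier inversion and
  for testing.\<close>

lemma dyadic_resolution_real:
  assumes "dyadic_resolution \<phi>"
  shows "\<phi> = (\<lambda>\<xi>. complex_of_real (Re (\<phi> \<xi>)))" "0 \<le> Re (\<phi> \<xi>)"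
proof -
  have "\<phi> \<xi> \<in> \<real> \<and> 0 \<le> Re (\<phi> \<xi>)" for \<xi>
    using assms dyadic_resolution_support[OF assms, of \<xi>]
    by (cases "\<phi> \<xi> = 0") (auto simp: dyadic_resolution_def less_imp_le)
  then show "\<phi> = (\<lambda>\<xi>. complex_of_real (Re (\<phi> \<xi>)))" "0 \<le> Re (\<phi> \<xi>)" by (auto simp: fun_eq_iff)
qed

text \<open>For 1/2 < |\<xi>| < 2 only the dilates with k = -1, 0, 1 can be nonzero, so these three
  already sum to 1. The dilation by 2 is the term k = -1.\<close>

lemma dyadic_resolution_reproducing:
  assumes "dyadic_resolution \<phi>"
  shows "\<phi> \<xi> * (\<phi> (2 *\<^sub>R \<xi>) + \<phi> \<xi> + \<phi> ((1 / 2) *\<^sub>R \<xi>)) = \<phi> \<xi>"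
proof (cases "\<phi> \<xi> = 0")
  case False
  note supp = dyadic_resolution_support[OF assms]
  have n: "1 / 2 < norm \<xi>" "norm \<xi> < 2" using supp[OF False] by auto
  then have "\<xi> \<noteq> 0" by auto
  then have "((\<lambda>k::int. \<phi> ((2 powi (- k)) *\<^sub>R \<xi>)) has_sum 1) UNIV"
    using assms by (simp add: dyadic_resolution_def)
  moreover have "\<phi> ((2 powi (- k)) *\<^sub>R \<xi>) = 0" if k: "k \<notin> {- 1, 0, 1}" for k :: int
  proof (rule ccontr)
    assume "\<phi> ((2 powi (- k)) *\<^sub>R \<xi>) \<noteq> 0"
    from supp[OF this] have s: "1 / 2 < 2 powi (- k) * norm \<xi>" "2 powi (- k) * norm \<xi> < 2" by simp_all
    consider "k \<le> - 2" | "2 \<le> k" using k by force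
    then show False
    proof cases
      case 1
      then have "(2::real) powi 2 \<le> 2 powi (- k)" by (intro power_int_increasing) auto
      then have "4 * norm \<xi> \<le> 2 powi (- k) * norm \<xi>" by (intro mult_right_mono) simp_all
      with s n show False by simp
    next
      case 2
      then have "(2::real) powi (- k) \<le> 2 powi (- 2)" by (intro power_int_increasing) auto
      then have "2 powi (- k) * norm \<xi> \<le> (1 / 4) * norm \<xi>"
        by (intro mult_right_mono) (simp_all add: power_int_minus[of _ 2])
      with s n show False by simp
    qed
  qed
  ultimately have "((\<lambda>k::int. \<phi> ((2 powi (- k)) *\<^sub>R \<xi>)) has_sum 1) {- 1, 0, 1}"
    by (subst has_sum_cong_neutral[where T = UNIV]) auto
  then have "(\<Sum>k\<in>{- 1, 0, 1::int}. \<phi> ((2 powi (- k)) *\<^sub>R \<xi>)) = 1"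
    using has_sum_finite[of "{- 1, 0, 1::int}"] has_sum_unique by blast
  then show ?thesis by (simp add: power_int_minus add.assoc)
qed simp

text \<open>Any test function may be smoothed by the kernel of \<eta>: inversion returns \<eta>
  times \<open>inv_fourier \<psi>\<close> up to the factor \<open>c\<close>, and the multiplier
  \<phi> inside the block absorbs \<eta>.\<close>

lemma dyadic_block_reproducing:
  fixes \<phi> \<eta> :: "real ^ 'n \<Rightarrow> complex"
  assumes \<phi>: "\<phi> \<in> schwartz" and \<eta>: "\<eta> \<in> schwartz" and rep: "\<And>\<xi>. \<phi> \<xi> * \<eta> \<xi> = \<phi> \<xi>"
    and inv: "\<And>(f :: real ^ 'n \<Rightarrow> complex) x. f \<in> schwartz \<Longrightarrow> inv_fourier (fourier f) x = c * f x"
    and T: "T \<in> tempered_distributions" and \<psi>: "\<psi> \<in> schwartz"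
  shows "dyadic_block \<phi> k T (fourier (\<lambda>\<xi>. \<eta> ((2 powi (- k)) *\<^sub>R \<xi>) * inv_fourier \<psi> \<xi>)) = c * dyadic_block \<phi> k T \<psi>"
proof -
  define a :: real where "a = 2 powi (- k)"
  have a: "a \<noteq> 0" by (simp add: a_def)
  have scale: "(\<lambda>x. f (a *\<^sub>R x)) \<in> schwartz" if "f \<in> schwartz" for f :: "real ^ 'n \<Rightarrow> complex"
    using schwartz_affine[OF that a, of 1 0] by simp
  let ?h = "\<lambda>\<xi>. \<eta> (a *\<^sub>R \<xi>) * inv_fourier \<psi> \<xi>"
  have h: "?h \<in> schwartz"
    by (intro schwartz_mult scale schwartz_inv_fourier \<eta> \<psi>)
  have g: "fourier (\<lambda>\<xi>. \<phi> (a *\<^sub>R \<xi>) * inv_fourier \<psi> \<xi>) \<in> schwartz"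
    by (intro schwartz_fourier schwartz_mult scale schwartz_inv_fourier \<phi> \<psi>)
  have "(\<lambda>\<xi>. \<phi> (a *\<^sub>R \<xi>) * inv_fourier (fourier ?h) \<xi>) = (\<lambda>\<xi>. c * (\<phi> (a *\<^sub>R \<xi>) * inv_fourier \<psi> \<xi>))"
  proof
    fix \<xi>
    have "\<phi> (a *\<^sub>R \<xi>) * (c * ?h \<xi>) = c * ((\<phi> (a *\<^sub>R \<xi>) * \<eta> (a *\<^sub>R \<xi>)) * inv_fourier \<psi> \<xi>)" by (simp only: mult_ac)
    then show "\<phi> (a *\<^sub>R \<xi>) * inv_fourier (fourier ?h) \<xi> = c * (\<phi> (a *\<^sub>R \<xi>) * inv_fourier \<psi> \<xi>)"
      by (simp only: inv[OF h] rep)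
  qed
  then have "fourier (\<lambda>\<xi>. \<phi> (a *\<^sub>R \<xi>) * inv_fourier (fourier ?h) \<xi>) = (\<lambda>x. c * fourier (\<lambda>\<xi>. \<phi> (a *\<^sub>R \<xi>) * inv_fourier \<psi> \<xi>) x)"
    by (simp only: fourier_cmult fun_eq_iff) simp
  moreover have "T (\<lambda>x. c * fourier (\<lambda>\<xi>. \<phi> (a *\<^sub>R \<xi>) * inv_fourier \<psi> \<xi>) x) = c * T (fourier (\<lambda>\<xi>. \<phi> (a *\<^sub>R \<xi>) * inv_fourier \<psi> \<xi>))"
    using T g by (simp add: tempered_distributions_def)
  ultimately show ?thesis
    unfolding dyadic_block_def inv_fourier_dist_def mult_dist_def fourier_dist_def a_def[symmetric] by simp
qed

text \<open>The Fubini arguments run over products of \<open>lborel\<close>; a Borel version of the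
  representing function makes the integrands jointly measurable.\<close>

lemma lebesgue_borel_version:
  fixes g :: "real ^ 'n \<Rightarrow> complex"
  assumes "g \<in> borel_measurable lebesgue"
  obtains g' where "g' \<in> borel_measurable borel" "AE x in lborel. g x = g' x"
proof -
  have "(\<lambda>x. Re (g x)) \<in> borel_measurable lebesgue" "(\<lambda>x. Im (g x)) \<in> borel_measurable lebesgue"
    using assms by measurable
  from this[THEN completion_ex_borel_measurable_real]
  obtain u v where uv: "u \<in> borel_measurable borel" "v \<in> borel_measurable borel"
    and u: "AE x in lborel. Re (g x) = u x" and v: "AE x in lborel. Im (g x) = v x" by auto
  have "(\<lambda>x. Complex (u x) (v x)) \<in> borel_measurable borel"
    using uv by (simp add: borel_measurable_complex_iff)
  moreover have "AE x in lborel. g x = Complex (u x) (v x)"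
    using u v by eventually_elim (simp add: complex_eq_iff)
  ultimately show thesis using that by blast
qed

text \<open>The test function is the convolution of \<psi> with the kernel of \<eta>. After Tonelli
  the modulus of \<psi> stands outside, and the inner integral of |g| against a translated kernel is
  at most \<open>N\<close>.\<close>

lemma norm_integral_le_of_kernel:
  fixes g \<eta> \<psi> :: "real ^ 'n \<Rightarrow> complex"
  assumes [measurable]: "g \<in> borel_measurable borel" and \<eta>: "\<eta> \<in> schwartz" and \<psi>: "\<psi> \<in> schwartz"
    and int: "integrable lborel (\<lambda>x. g x * fourier (\<lambda>\<xi>. \<eta> \<xi> * inv_fourier \<psi> \<xi>) x)"
    and N: "\<And>y. (\<integral>\<^sup>+x. ennreal (norm (g x)) * ennreal (norm (fourier \<eta> (x - y))) \<partial>lborel) \<le> ennreal N" "0 \<le> N"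
  shows "norm (\<integral>x. g x * fourier (\<lambda>\<xi>. \<eta> \<xi> * inv_fourier \<psi> \<xi>) x \<partial>lborel) \<le> N * (\<integral>x. norm (\<psi> x) \<partial>lborel)"
proof -
  let ?\<Psi> = "fourier (\<lambda>\<xi>. \<eta> \<xi> * inv_fourier \<psi> \<xi>)"
  let ?H = "\<lambda>x y. ennreal (norm (g x)) * (ennreal (norm (\<psi> y)) * ennreal (norm (fourier \<eta> (x - y))))"
  have [measurable]: "fourier \<eta> \<in> borel_measurable borel" "\<psi> \<in> borel_measurable borel"
    using schwartz_measurable[OF schwartz_fourier[OF \<eta>]] schwartz_measurable[OF \<psi>] by auto
  have "ennreal (norm (\<integral>x. g x * ?\<Psi> x \<partial>lborel)) \<le>
      (\<integral>\<^sup>+x. ennreal (norm (g x * ?\<Psi> x)) \<partial>lborel)"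
    by (rule integral_norm_bound_ennreal[OF int])
  also have "\<dots> \<le> (\<integral>\<^sup>+x. (\<integral>\<^sup>+y. ?H x y \<partial>lborel) \<partial>lborel)"
  proof (rule nn_integral_mono)
    fix x
    obtain B where B: "0 \<le> B" "\<And>x. norm (fourier \<eta> x) \<le> B" using schwartzD_bounded[OF schwartz_fourier[OF \<eta>]] by blast
    have "integrable lborel (\<lambda>y. \<psi> y * fourier \<eta> (x - y))"
    proof (rule Bochner_Integration.integrable_bound)
      show "integrable lborel (\<lambda>y. B * norm (\<psi> y))"
        by (intro integrable_mult_right integrable_norm schwartz_integrable \<psi>)
      show "AE y in lborel. norm (\<psi> y * fourier \<eta> (x - y)) \<le> norm (B * norm (\<psi> y))"
        using B by (intro AE_I2) (simp add: norm_mult mult.commute[of B] mult_left_mono)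
    qed measurable
    then have "ennreal (norm (?\<Psi> x)) \<le> (\<integral>\<^sup>+y. ennreal (norm (\<psi> y * fourier \<eta> (x - y))) \<partial>lborel)"
      unfolding fourier_mult_inv_fourier[OF schwartz_integrable[OF \<eta>] schwartz_integrable[OF \<psi>]]
      by (rule integral_norm_bound_ennreal)
    then have "ennreal (norm (g x)) * ennreal (norm (?\<Psi> x)) \<le>
        ennreal (norm (g x)) * (\<integral>\<^sup>+y. ennreal (norm (\<psi> y * fourier \<eta> (x - y))) \<partial>lborel)"
      by (rule mult_left_mono) simp
    then show "ennreal (norm (g x * ?\<Psi> x)) \<le>
       (\<integral>\<^sup>+y. ?H x y \<partial>lborel)"
      by (simp add: nn_integral_cmult norm_mult ennreal_mult)
  qed
  also have "\<dots> = (\<integral>\<^sup>+y. (\<integral>\<^sup>+x. ?H x y \<partial>lborel) \<partial>lborel)"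
    by (rule lborel_pair.Fubini'[symmetric]) measurable
  also have "\<dots> = (\<integral>\<^sup>+y. ennreal (norm (\<psi> y)) * (\<integral>\<^sup>+x. ennreal (norm (g x)) * ennreal (norm (fourier \<eta> (x - y))) \<partial>lborel) \<partial>lborel)"
    by (subst nn_integral_cmult[symmetric]) (simp_all add: mult_ac)
  also have "\<dots> \<le> (\<integral>\<^sup>+y. ennreal (norm (\<psi> y)) * ennreal N \<partial>lborel)"
    by (intro nn_integral_mono mult_left_mono N) simp
  also have "\<dots> = ennreal (\<integral>x. norm (\<psi> x) \<partial>lborel) * ennreal N"
    by (subst nn_integral_multc) (simp_all add: nn_integral_eq_integral[OF integrable_norm[OF schwartz_integrable[OF \<psi>]]])
  also have "\<dots> = ennreal (N * (\<integral>x. norm (\<psi> x) \<partial>lborel))"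
    using N(2) by (simp add: ennreal_mult'' mult.commute)
  finally show ?thesis
    using N(2) by (subst (asm) ennreal_le_iff) (auto intro!: mult_nonneg_nonneg Bochner_Integration.integral_nonneg)
qed

text \<open>The modulus is the supremum of Re (\<omega> z) over |\<omega>| < 1, and since the
  condition on \<omega> is open, a dense set of them suffices. For a countable dense set the
  exceptional null sets of the individual \<omega> can be united.\<close>

lemma norm_le_of_countable_dense:
  fixes D :: "complex set"
  assumes dense: "\<And>X. open X \<Longrightarrow> X \<noteq> {} \<Longrightarrow> \<exists>d\<in>D. d \<in> X"
    and le: "\<And>\<omega>. \<omega> \<in> D \<Longrightarrow> norm \<omega> < 1 \<Longrightarrow> Re (\<omega> * z) \<le> N" and N: "0 \<le> N"
  shows "norm z \<le> N"
proof (rule ccontr)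
  assume "\<not> norm z \<le> N"
  then have z: "N < norm z" by simp
  have nz: "0 < norm z" using N z by linarith
  define X where "X = {\<omega>. norm \<omega> < 1 \<and> N < Re (\<omega> * z)}"
  have "open X"
    unfolding X_def by (intro open_Collect_conj open_Collect_less continuous_intros)
  moreover have "X \<noteq> {}"
  proof -
    \<comment> \<open>\<open>r\<close> puts r |z| halfway between \<open>N\<close> and |z|; \<omega>
      is then r times the phase conjugate to that of \<open>z\<close>.\<close>
    define r where "r = (N + norm z) / (2 * norm z)"
    have r: "0 \<le> r" "r < 1" "N < r * norm z"
      using N z nz by (auto simp: r_def field_simps)
    define \<omega> where "\<omega> = of_real (r / norm z) * cnj z"
    have "norm \<omega> < 1" using nz r by (simp add: \<omega>_def norm_mult norm_divide)
    moreover have "Re (\<omega> * z) = r * norm z"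
    proof -
      have "\<omega> * z = of_real (r / norm z) * of_real ((norm z)\<^sup>2)"
        unfolding \<omega>_def complex_norm_square by (simp only: mult_ac)
      then have "Re (\<omega> * z) = r / norm z * (norm z)\<^sup>2"
        by (simp only: of_real_mult[symmetric] Re_complex_of_real)
      then show ?thesis using nz by (simp add: power2_eq_square)
    qed
    ultimately show ?thesis using r by (auto simp: X_def)
  qed
  ultimately obtain \<omega> where "\<omega> \<in> D" "\<omega> \<in> X" using dense by blast
  then show False using le[of \<omega>] by (auto simp: X_def)
qed

text \<open>Duality of L1 and the supremum norm with Schwartz test functions only. For |\<omega>| <
  1, Re (\<omega> g) - N has a nonpositive integral against every translated and dilated bump, since
  a nonnegative \<psi> equals its own modulus. Hence Re (\<omega> g) \<le> N almost everywhere, for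
  countably many \<omega> at once.\<close>

lemma AE_norm_le_of_testing:
  fixes g :: "real ^ 'n \<Rightarrow> complex" and \<rho> :: "real ^ 'n \<Rightarrow> real"
  assumes gm [measurable]: "g \<in> borel_measurable borel"
    and loc: "\<And>R. integrable lborel (\<lambda>x. indicator (ball 0 R) x *\<^sub>R g x)"
    and \<rho>: "(\<lambda>x. complex_of_real (\<rho> x)) \<in> schwartz" "\<And>x. 0 \<le> \<rho> x" "0 < \<rho> x0" "\<And>x. 2 < norm x \<Longrightarrow> \<rho> x = 0"
    and test: "\<And>\<psi>. \<psi> \<in> schwartz \<Longrightarrow> integrable lborel (\<lambda>x. g x * \<psi> x) \<and>
      norm (\<integral>x. g x * \<psi> x \<partial>lborel) \<le> N * (\<integral>x. norm (\<psi> x) \<partial>lborel)"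
    and N: "0 \<le> N"
  shows "AE x in lborel. norm (g x) \<le> N"
proof -
  have \<rho>c: "continuous_on UNIV \<rho>"
    using continuous_on_Re[OF schwartz_continuous[OF \<rho>(1)]] by simp
  have \<rho>i: "integrable lborel \<rho>"
    using integrable_Re[OF schwartz_integrable[OF \<rho>(1)]] by simp
  obtain Q where Q: "\<And>x. norm (complex_of_real (\<rho> x)) \<le> Q" using schwartzD_bounded[OF \<rho>(1)] by blast
  have Q': "\<rho> x \<le> Q" for x using Q[of x] \<rho>(2)[of x] by simp
  have \<rho>pos: "0 < (\<integral>x. \<rho> x \<partial>lborel)" by (rule integral_pos_of_continuous[OF \<rho>c \<rho>(2,3) \<rho>i])
  have main: "AE x in lborel. Re (\<omega> * g x) \<le> N" if \<omega>: "norm \<omega> < 1" for \<omega>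
  proof -
    have "AE x in lborel. Re (\<omega> * g x) - N \<le> 0"
    proof (rule AE_nonpos_of_mollified[OF _ _ \<rho>c \<rho>(2) Q' \<rho>(4) \<rho>i \<rho>pos])
      show "(\<lambda>x. Re (\<omega> * g x) - N) \<in> borel_measurable borel" by measurable
      show "integrable lborel (\<lambda>x. indicator (ball 0 R) x * (Re (\<omega> * g x) - N))" for R
      proof -
        have "integrable lborel (\<lambda>x. Re (\<omega> * (indicator (ball 0 R) x *\<^sub>R g x)) - indicator (ball 0 R) x * N)"
          by (intro Bochner_Integration.integrable_diff integrable_Re integrable_mult_right loc
            integrable_mult_left integrable_real_indicator emeasure_bounded_finite bounded_ball) simp
        then show ?thesis by (simp add: algebra_simps scaleR_conv_of_real)
      qed
      fix e :: real and y :: "real ^ 'n" assume e: "0 < e"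
      define \<psi> where "\<psi> x = complex_of_real (\<rho> ((x - y) /\<^sub>R e))" for x
      have \<psi>: "\<psi> \<in> schwartz"
        using schwartz_affine[OF \<rho>(1), of "inverse e" 1 "- (y /\<^sub>R e)"] e
        by (simp add: \<psi>_def[abs_def] scaleR_diff_right)
      have n\<psi>: "norm (\<psi> x) = \<rho> ((x - y) /\<^sub>R e)" for x by (simp add: \<psi>_def \<rho>(2))
      have i1: "integrable lborel (\<lambda>x. Re (\<omega> * (g x * \<psi> x)))"
        using test[OF \<psi>] by (intro integrable_Re integrable_mult_right) simp
      have i2: "integrable lborel (\<lambda>x. N * norm (\<psi> x))"
        by (intro integrable_mult_right integrable_norm schwartz_integrable \<psi>)
      have "(\<integral>x. (Re (\<omega> * g x) - N) * \<rho> ((x - y) /\<^sub>R e) \<partial>lborel) = (\<integral>x. Re (\<omega> * (g x * \<psi> x)) - N * norm (\<psi> x) \<partial>lborel)"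
        unfolding n\<psi> by (simp add: \<psi>_def algebra_simps)
      also have "\<dots> = (\<integral>x. Re (\<omega> * (g x * \<psi> x)) \<partial>lborel) - (\<integral>x. N * norm (\<psi> x) \<partial>lborel)"
        by (rule Bochner_Integration.integral_diff[OF i1 i2])
      also have "(\<integral>x. Re (\<omega> * (g x * \<psi> x)) \<partial>lborel) = Re (\<omega> * (\<integral>x. g x * \<psi> x \<partial>lborel))"
        using test[OF \<psi>] by (subst integral_Re) (auto intro: integrable_mult_right)
      also have "\<dots> \<le> norm (\<omega> * (\<integral>x. g x * \<psi> x \<partial>lborel))" by (rule complex_Re_le_cmod)
      also have "\<dots> \<le> 1 * (N * (\<integral>x. norm (\<psi> x) \<partial>lborel))"
        unfolding norm_mult using test[OF \<psi>] \<omega> by (intro mult_mono) auto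
      finally show "(\<integral>x. (Re (\<omega> * g x) - N) * \<rho> ((x - y) /\<^sub>R e) \<partial>lborel) \<le> 0" by simp
    qed
    then show ?thesis by simp
  qed
  obtain D :: "complex set" where D: "countable D" "\<And>X. open X \<Longrightarrow> X \<noteq> {} \<Longrightarrow> \<exists>d\<in>D. d \<in> X"
    using countable_dense_setE by blast
  have "AE x in lborel. \<forall>\<omega>\<in>D. norm \<omega> < 1 \<longrightarrow> Re (\<omega> * g x) \<le> N"
    using main by (subst AE_ball_countable[OF D(1)]) auto
  then show ?thesis
  proof eventually_elim
    case (elim x)
    then show ?case using norm_le_of_countable_dense[OF D(2) _ N] by blast
  qed
qed

text \<open>The dilated kernel is a^(-n) times a function decaying in |x| / a. In the sum over
  shells of width \<open>a\<close>, the growth of order 2n allowed by \<open>balls\<close> cancels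
  against the decay of order 2n + 2, and the series of inverse squares remains.\<close>

lemma kernel_nn_integral_le:
  fixes g \<eta> :: "real ^ 'n \<Rightarrow> complex"
  assumes [measurable]: "g \<in> borel_measurable borel" and \<eta>: "\<eta> \<in> borel_measurable borel"
    and decay: "\<And>x. norm (fourier \<eta> x) \<le> K * (1 / (1 + norm x) ^ (2 * CARD('n) + 2))" and K: "0 \<le> K" and a: "0 < a" and L: "0 \<le> L"
    and balls: "\<And>y R. 1 \<le> R \<Longrightarrow>
      (\<integral>\<^sup>+x\<in>ball y (R * a). ennreal (norm (g x)) \<partial>lborel) \<le> ennreal (L * R ^ (2 * CARD('n)))"
  shows "(\<integral>\<^sup>+x. ennreal (norm (g x)) * ennreal (norm (fourier (\<lambda>\<xi>. \<eta> (a *\<^sub>R \<xi>)) (x - y))) \<partial>lborel)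
    \<le> ennreal (K * (\<Sum>r. 1 / (1 + real r)\<^sup>2) * (1 / a) ^ CARD('n) * L)"
proof -
  let ?n = "CARD('n)" and ?M = "2 * CARD('n) + 2"
  let ?\<eta> = "\<lambda>\<xi>. \<eta> (a *\<^sub>R \<xi>)"
  let ?k = "(1 / a) ^ ?n * K"
  let ?w = "\<lambda>x. 1 / (1 + (1 / a) * norm x) ^ ?M"
  let ?I = "\<lambda>r. ennreal (1 / (1 + real r) ^ ?M) * (\<integral>\<^sup>+x\<in>ball y ((1 + real r) / (1 / a)). ennreal (norm (g x)) \<partial>lborel)"
  have "norm (fourier ?\<eta> x) \<le> ?k * ?w x" for x
  proof -
    have "norm (fourier ?\<eta> x) = (1 / a) ^ ?n * norm (fourier \<eta> (x /\<^sub>R a))"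
      using a by (simp add: fourier_dilate[OF \<eta> a] power_one_over)
    also have "\<dots> \<le> (1 / a) ^ ?n * (K * (1 / (1 + norm (x /\<^sub>R a)) ^ ?M))"
      using a by (intro mult_left_mono decay) simp
    also have "norm (x /\<^sub>R a) = (1 / a) * norm x" using a by (simp add: divide_inverse)
    finally show ?thesis by (simp only: mult.assoc)
  qed
  then have "(\<integral>\<^sup>+x. ennreal (norm (g x)) * ennreal (norm (fourier ?\<eta> (x - y))) \<partial>lborel) \<le>
    (\<integral>\<^sup>+x. ennreal (norm (g x)) * ennreal (?k * (?w (x - y))) \<partial>lborel)"
    by (intro nn_integral_mono mult_left_mono ennreal_leI) auto
  also have "\<dots> = (\<integral>\<^sup>+x. ennreal ?k * (ennreal (norm (g x)) * ennreal (?w (x - y))) \<partial>lborel)"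
  proof (rule nn_integral_cong)
    fix x
    have "ennreal (?k * (?w (x - y))) =
      ennreal ?k * ennreal (?w (x - y))"
      using a K by (intro ennreal_mult) auto
    then show "ennreal (norm (g x)) * ennreal (?k * (?w (x - y))) =
      ennreal ?k * (ennreal (norm (g x)) * ennreal (?w (x - y)))"
      by (simp only: mult.left_commute)
  qed
  also have "\<dots> = ennreal ?k * (\<integral>\<^sup>+x. ennreal (norm (g x)) * ennreal (?w (x - y)) \<partial>lborel)"
    by (rule nn_integral_cmult) measurable
  also have "\<dots> \<le> ennreal ?k *
    (\<Sum>r. ?I r)"
    using a by (intro mult_left_mono nn_integral_decay_le_balls) auto
  also have "\<dots> \<le> ennreal ?k * (\<Sum>r. ennreal (L * (1 / (1 + real r)\<^sup>2)))"
  proof (intro mult_left_mono suminf_le)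
    fix r
    have "?I r
      \<le> ennreal (1 / (1 + real r) ^ ?M) * ennreal (L * (1 + real r) ^ (2 * ?n))"
      using balls[of "1 + real r" y] by (intro mult_left_mono) auto
    also have "\<dots> = ennreal ((1 / (1 + real r) ^ ?M) * (L * (1 + real r) ^ (2 * ?n)))"
      using L by (intro ennreal_mult[symmetric]) auto
    also have "(1 / (1 + real r) ^ ?M) * (L * (1 + real r) ^ (2 * ?n)) = L * (1 / (1 + real r)\<^sup>2)"
      by (simp add: power_add power2_eq_square)
    finally show "?I r
      \<le> ennreal (L * (1 / (1 + real r)\<^sup>2))" .
  qed auto
  also have "(\<Sum>r. ennreal (L * (1 / (1 + real r)\<^sup>2))) = ennreal (L * (\<Sum>r. 1 / (1 + real r)\<^sup>2))"
    unfolding suminf_mult[OF summable_inverse_squares_shift, symmetric]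
    using L by (intro suminf_ennreal2 summable_mult summable_inverse_squares_shift) auto
  also have "ennreal ?k * \<dots> = ennreal (?k * (L * (\<Sum>r. 1 / (1 + real r)\<^sup>2)))"
    using a K L by (intro ennreal_mult[symmetric]) (auto intro!: mult_nonneg_nonneg suminf_nonneg summable_inverse_squares_shift)
  finally show ?thesis by (simp add: mult_ac)
qed

text \<open>Nikolskii inequality in which the size of \<open>g\<close> is measured by its mass on
  balls of radius at least 2^(-k). The growth R^(2n) is the square of a volume ratio, as
  \<open>nn_integral_rearrangement_le\<close> will deliver it.\<close>

lemma dyadic_block_sup_bound:
  fixes \<phi> :: "real ^ 'n \<Rightarrow> complex"
  assumes res: "dyadic_resolution \<phi>"
  obtains C where "0 \<le> C"
    "\<And>k T g L. T \<in> tempered_distributions \<Longrightarrow> represents g (dyadic_block \<phi> k T) \<Longrightarrow> 0 \<le> L \<Longrightarrow>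
      (\<And>y R. 1 \<le> R \<Longrightarrow> (\<integral>\<^sup>+x\<in>ball y (R * 2 powi (- k)). ennreal (norm (g x)) \<partial>lebesgue)
          \<le> ennreal (L * R ^ (2 * CARD('n)))) \<Longrightarrow>
      AE x in lebesgue. norm (g x) \<le> C * (2 powi k) ^ CARD('n) * L"
proof -
  have \<phi>: "\<phi> \<in> schwartz" using res by (simp add: dyadic_resolution_def)
  define \<rho> where "\<rho> x = Re (\<phi> x)" for x
  have \<rho>: "(\<lambda>x. complex_of_real (\<rho> x)) \<in> schwartz"
    using dyadic_resolution_real(1)[OF res] \<phi> by (simp add: \<rho>_def)
  have \<rho>0: "0 \<le> \<rho> x" for x using dyadic_resolution_real(2)[OF res] by (simp add: \<rho>_def)
  \<comment> \<open>Any coordinate direction will do: unit vectors lie in the open annulus where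
    \<phi> is positive.\<close>
  define x0 :: "real ^ 'n" where "x0 = axis undefined 1"
  have "norm x0 = 1" by (simp add: x0_def)
  then have \<rho>pos: "0 < \<rho> x0" using res by (simp add: dyadic_resolution_def \<rho>_def)
  have \<rho>supp: "\<rho> x = 0" if "2 < norm x" for x
    using dyadic_resolution_support[OF res, of x] that by (force simp: \<rho>_def)
  define \<eta> where "\<eta> \<xi> = \<phi> (2 *\<^sub>R \<xi>) + \<phi> \<xi> + \<phi> ((1 / 2) *\<^sub>R \<xi>)" for \<xi>
  have \<eta>: "\<eta> \<in> schwartz"
    unfolding \<eta>_def[abs_def]
    using schwartz_affine[OF \<phi>, of 2 1 0] schwartz_affine[OF \<phi>, of "1 / 2" 1 0]
    by (intro schwartz_add \<phi>) simp_all
  obtain c :: complex where c: "c \<noteq> 0"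
    "\<And>(f :: real ^ 'n \<Rightarrow> complex) x. f \<in> schwartz \<Longrightarrow> inv_fourier (fourier f) x = c * f x"
    using fourier_inversion_constant[OF \<rho> \<rho>0 \<rho>pos] by blast
  obtain K where K: "0 \<le> K" "\<And>x. norm (fourier \<eta> x) \<le> K * (1 / (1 + norm x) ^ (2 * CARD('n) + 2))"
    using rapidly_decreasingE[OF fourier_rapidly_decreasing[OF \<eta>]] by blast
  \<comment> \<open>The division by |c| undoes the inversion constant in
    \<open>dyadic_block_reproducing\<close>.\<close>
  define C where "C = K * (\<Sum>r. 1 / (1 + real r)\<^sup>2) / norm c"
  have S0: "0 \<le> (\<Sum>r. 1 / (1 + real r)\<^sup>2)" by (intro suminf_nonneg summable_inverse_squares_shift) simp
  have C0: "0 \<le> C" unfolding C_def using K(1) S0 by (intro divide_nonneg_nonneg mult_nonneg_nonneg) auto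
  show thesis
  proof (rule that[OF C0], goal_cases)
    case (1 k T g L)
    note T = 1(1) and rep = 1(2) and L = 1(3) and balls = 1(4)
    define a :: real where "a = 2 powi (- k)"
    have a: "0 < a" by (simp add: a_def)
    have a': "1 / a = 2 powi k" by (simp add: a_def power_int_minus divide_inverse)
    obtain g' where g' [measurable]: "g' \<in> borel_measurable borel" and gg': "AE x in lborel. g x = g' x"
      using rep lebesgue_borel_version by (auto simp: represents_def)
    have balls': "(\<integral>\<^sup>+x\<in>ball y (R * a). ennreal (norm (g' x)) \<partial>lborel) \<le> ennreal (L * R ^ (2 * CARD('n)))"
      if "1 \<le> R" for y R
    proof -
      have "(\<integral>\<^sup>+x\<in>ball y (R * a). ennreal (norm (g' x)) \<partial>lborel) = (\<integral>\<^sup>+x\<in>ball y (R * a). ennreal (norm (g x)) \<partial>lborel)"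
        by (rule nn_integral_cong_AE) (use gg' in eventually_elim, simp)
      then show ?thesis using balls[OF that, of y] by (simp add: a_def nn_integral_completion)
    qed
    define N where "N = K * (\<Sum>r. 1 / (1 + real r)\<^sup>2) * (1 / a) ^ CARD('n) * L"
    have N0: "0 \<le> N" unfolding N_def using K(1) S0 L a by (intro mult_nonneg_nonneg) auto
    have N: "(\<integral>\<^sup>+x. ennreal (norm (g' x)) * ennreal (norm (fourier (\<lambda>\<xi>. \<eta> (a *\<^sub>R \<xi>)) (x - y))) \<partial>lborel) \<le> ennreal N" for y
      unfolding N_def by (rule kernel_nn_integral_le[OF g' schwartz_measurable[OF \<eta>] K(2,1) a L balls'])
    have repr: "integrable lborel (\<lambda>x. g' x * \<psi> x) \<and> dyadic_block \<phi> k T \<psi> = (\<integral>x. g' x * \<psi> x \<partial>lborel)"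
      if \<psi>: "\<psi> \<in> schwartz" for \<psi>
    proof -
      have [measurable]: "\<psi> \<in> borel_measurable borel" by (rule schwartz_measurable[OF \<psi>])
      have 1: "integrable lebesgue (\<lambda>x. g x * \<psi> x)" "dyadic_block \<phi> k T \<psi> = (\<integral>x. g x * \<psi> x \<partial>lebesgue)"
        using rep \<psi> by (auto simp: represents_def)
      have ae: "AE x in lebesgue. g x * \<psi> x = g' x * \<psi> x"
        by (rule AE_completion) (use gg' in eventually_elim, simp)
      have m: "(\<lambda>x. g' x * \<psi> x) \<in> borel_measurable lborel" by measurable
      then have m': "(\<lambda>x. g' x * \<psi> x) \<in> borel_measurable lebesgue" by (rule measurable_completion)
      have "integrable lebesgue (\<lambda>x. g' x * \<psi> x)"
        by (subst integrable_cong_AE[OF m' _ AE_symmetric[OF ae]]) (use 1(1) in auto)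
      moreover have "dyadic_block \<phi> k T \<psi> = (\<integral>x. g' x * \<psi> x \<partial>lebesgue)"
        unfolding 1(2) by (rule integral_cong_AE[OF _ m' ae]) (use 1(1) in auto)
      ultimately show ?thesis using integrable_completion[OF m] integral_completion[OF m] by simp
    qed
    have "AE x in lborel. norm (g' x) \<le> N / norm c"
    proof (rule AE_norm_le_of_testing[OF g' _ \<rho> \<rho>0 \<rho>pos \<rho>supp])
      show "0 \<le> N / norm c" using N0 by simp
      show "integrable lborel (\<lambda>x. indicator (ball 0 R) x *\<^sub>R g' x)" for R
      proof (rule integrableI_bounded)
        \<comment> \<open>The mass bound is available only for balls of radius at least
          \<open>a\<close>, so smaller balls are enlarged.\<close>
        define R' where "R' = max 1 (R / a)"
        have "R \<le> R' * a" using a by (simp add: R'_def max_def field_simps)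
        then have "(\<integral>\<^sup>+x. ennreal (norm (indicator (ball 0 R) x *\<^sub>R g' x)) \<partial>lborel) \<le>
            (\<integral>\<^sup>+x\<in>ball 0 (R' * a). ennreal (norm (g' x)) \<partial>lborel)"
          by (intro nn_integral_mono) (auto simp: indicator_def)
        also have "\<dots> < \<infinity>"
          by (rule le_less_trans[OF balls']) (auto simp: R'_def)
        finally show "(\<integral>\<^sup>+x. ennreal (norm (indicator (ball 0 R) x *\<^sub>R g' x)) \<partial>lborel) < \<infinity>" .
        have [measurable]: "ball (0 :: real ^ 'n) R \<in> sets borel" by simp
        show "(\<lambda>x. indicator (ball 0 R) x *\<^sub>R g' x) \<in> borel_measurable lborel" by measurable
      qed
      fix \<psi> :: "real ^ 'n \<Rightarrow> complex" assume \<psi>: "\<psi> \<in> schwartz"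
      have \<eta>a: "(\<lambda>\<xi>. \<eta> (a *\<^sub>R \<xi>)) \<in> schwartz" using schwartz_affine[OF \<eta>, of a 1 0] a by simp
      let ?\<Psi> = "fourier (\<lambda>\<xi>. \<eta> (a *\<^sub>R \<xi>) * inv_fourier \<psi> \<xi>)"
      have \<Psi>: "?\<Psi> \<in> schwartz"
        by (intro schwartz_fourier schwartz_mult \<eta>a schwartz_inv_fourier \<psi>)
      have "dyadic_block \<phi> k T ?\<Psi> = c * dyadic_block \<phi> k T \<psi>"
        unfolding a_def
        by (rule dyadic_block_reproducing[OF \<phi> \<eta> _ c(2) T \<psi>])
          (simp_all add: \<eta>_def dyadic_resolution_reproducing[OF res])
      then have "c * (\<integral>x. g' x * \<psi> x \<partial>lborel) = (\<integral>x. g' x * ?\<Psi> x \<partial>lborel)"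
        using repr[OF \<psi>] repr[OF \<Psi>] by simp
      then have "norm c * norm (\<integral>x. g' x * \<psi> x \<partial>lborel) = norm (\<integral>x. g' x * ?\<Psi> x \<partial>lborel)"
        by (simp only: norm_mult[symmetric])
      also have "\<dots> \<le> N * (\<integral>x. norm (\<psi> x) \<partial>lborel)"
        using repr[OF \<Psi>] by (intro norm_integral_le_of_kernel[OF g' \<eta>a \<psi> _ N N0]) simp
      finally have "norm (\<integral>x. g' x * \<psi> x \<partial>lborel) \<le> N / norm c * (\<integral>x. norm (\<psi> x) \<partial>lborel)"
        using c(1) by (simp add: field_simps)
      then show "integrable lborel (\<lambda>x. g' x * \<psi> x) \<and>
          norm (\<integral>x. g' x * \<psi> x \<partial>lborel) \<le> N / norm c * (\<integral>x. norm (\<psi> x) \<partial>lborel)"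
        using repr[OF \<psi>] by simp
    qed
    with gg' have "AE x in lborel. norm (g x) \<le> N / norm c" by eventually_elim simp
    then have "AE x in lebesgue. norm (g x) \<le> N / norm c" by (rule AE_completion)
    moreover have "N / norm c = C * (2 powi k) ^ CARD('n) * L"
      by (simp add: N_def C_def a')
    ultimately show ?case by simp
  qed
qed

section \<open>Broken logarithms\<close>

lemma broken_log_pos [simp]: "0 < broken_log A t"
proof -
  have "0 < (1 + \<bar>ln t\<bar>) powr x" for x
    by (rule iffD2[OF powr_gt_zero]) linarith
  then show ?thesis unfolding broken_log_def by presburger
qed

lemma broken_log_nonneg [simp]: "0 \<le> broken_log A t"
  by (rule less_imp_le) simp

lemma broken_log_neq_0 [simp]: "broken_log A t \<noteq> 0"
  by (rule less_imp_neq[symmetric]) (rule broken_log_pos)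

lemma broken_log_measurable [measurable]: "broken_log A \<in> borel_measurable borel"
  unfolding broken_log_def[abs_def] by measurable

text \<open>For \<alpha> \<ge> 0 the bound on \<open>x\<close> is raised to the power, for \<alpha>
  < 0 the bound on \<open>y\<close>.\<close>

lemma powr_abs_exponent_le:
  fixes x y z :: real
  assumes "1 \<le> x" "1 \<le> y" "1 \<le> z" "x \<le> y * z" "y \<le> x * z"
  shows "x powr \<alpha> \<le> y powr \<alpha> * z powr \<bar>\<alpha>\<bar>"
proof (cases "0 \<le> \<alpha>")
  case True
  then have "x powr \<alpha> \<le> (y * z) powr \<alpha>" using assms by (intro powr_mono2) auto
  then show ?thesis using assms True by (simp add: powr_mult)
next
  case False
  have "x powr \<alpha> * z powr \<alpha> = (x * z) powr \<alpha>" using assms by (simp add: powr_mult)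
  also have "\<dots> \<le> y powr \<alpha>" using assms False by (intro powr_mono2') auto
  finally have "x powr \<alpha> * z powr \<alpha> * z powr (- \<alpha>) \<le> y powr \<alpha> * z powr (- \<alpha>)"
    by (rule mult_right_mono) simp
  moreover have "z powr \<alpha> * z powr (- \<alpha>) = 1" using assms by (simp add: powr_add[symmetric])
  ultimately show ?thesis using False by (simp add: mult.assoc)
qed

text \<open>1 + |ln t| and 1 + |ln s| differ by at most the factor z = 1 + |ln (t / s)|. If
  \<open>s\<close> and \<open>t\<close> lie on different sides of 1, the two exponents differ as
  well, but then both logarithms are at most |ln (t / s)| in modulus and \<open>z\<close> absorbs
  both powers; hence the sum of the absolute exponents.\<close>

lemma broken_log_slowly_varying:
  assumes s: "0 < s" and t: "0 < t"
  shows "broken_log A t \<le> broken_log A s * (1 + \<bar>ln (t / s)\<bar>) powr (\<bar>fst A\<bar> + \<bar>snd A\<bar>)"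
proof -
  define x where "x = 1 + \<bar>ln t\<bar>"
  define y where "y = 1 + \<bar>ln s\<bar>"
  define z where "z = 1 + \<bar>ln (t / s)\<bar>"
  define m where "m = \<bar>fst A\<bar> + \<bar>snd A\<bar>"
  have ge: "1 \<le> x" "1 \<le> y" "1 \<le> z" by (simp_all add: x_def y_def z_def)
  have ln: "ln (t / s) = ln t - ln s" using s t by (simp add: ln_div)
  have "x \<le> y + z - 1" "y \<le> x + z - 1" unfolding x_def y_def z_def ln by linarith+
  moreover have "0 \<le> (y - 1) * (z - 1)" "0 \<le> (x - 1) * (z - 1)" using ge by auto
  ultimately have le: "x \<le> y * z" "y \<le> x * z" by (auto simp: algebra_simps)
  have same: "x powr \<alpha> \<le> y powr \<alpha> * z powr m" if "\<bar>\<alpha>\<bar> \<le> m" for \<alpha>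
  proof -
    have "x powr \<alpha> \<le> y powr \<alpha> * z powr \<bar>\<alpha>\<bar>" by (rule powr_abs_exponent_le[OF ge le])
    also have "\<dots> \<le> y powr \<alpha> * z powr m" using ge that by (intro mult_left_mono powr_mono) auto
    finally show ?thesis .
  qed
  have opp: "x powr \<alpha> \<le> y powr \<beta> * z powr m" if "x \<le> z" "y \<le> z" "\<bar>\<alpha>\<bar> + \<bar>\<beta>\<bar> = m" for \<alpha> \<beta>
  proof -
    have "x powr \<alpha> \<le> 1 powr \<alpha> * z powr \<bar>\<alpha>\<bar>"
      using ge that mult_mono[OF ge(1) ge(3)] by (intro powr_abs_exponent_le) auto
    moreover have "1 powr \<beta> \<le> y powr \<beta> * z powr \<bar>\<beta>\<bar>"
      using ge that mult_mono[OF ge(2) ge(3)] by (intro powr_abs_exponent_le) auto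
    ultimately have "x powr \<alpha> * 1 \<le> z powr \<bar>\<alpha>\<bar> * (y powr \<beta> * z powr \<bar>\<beta>\<bar>)"
      by (intro mult_mono) auto
    also have "\<dots> = y powr \<beta> * z powr m" using ge that(3)[symmetric] by (simp add: powr_add mult_ac)
    finally show ?thesis by simp
  qed
  consider "t \<le> 1" "s \<le> 1" | "1 < t" "1 < s" | "t \<le> 1" "1 < s" | "1 < t" "s \<le> 1" by linarith
  then have "(if t \<le> 1 then x powr fst A else x powr snd A) \<le>
      (if s \<le> 1 then y powr fst A else y powr snd A) * z powr m"
  proof cases
    case 1 then show ?thesis using same[of "fst A"] by (simp add: m_def)
  next
    case 2 then show ?thesis using same[of "snd A"] by (simp add: m_def)
  next
    case 3
    then have "ln t \<le> 0" "0 \<le> ln s" using t by (simp_all add: ln_le_zero_iff)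
    then have "x \<le> z" "y \<le> z" unfolding x_def y_def z_def ln by linarith+
    then show ?thesis using opp[of "fst A" "snd A"] 3 by (simp add: m_def)
  next
    case 4
    then have "ln s \<le> 0" "0 \<le> ln t" using s by (simp_all add: ln_le_zero_iff)
    then have "x \<le> z" "y \<le> z" unfolding x_def y_def z_def ln by linarith+
    then show ?thesis using opp[of "snd A" "fst A"] 4 by (simp add: m_def)
  qed
  then show ?thesis unfolding broken_log_def x_def y_def z_def m_def .
qed

lemma log_powr_le_powr:
  fixes m e :: real
  assumes m: "0 \<le> m" and e: "0 < e"
  obtains C where "1 \<le> C" "\<And>r. 1 \<le> r \<Longrightarrow> (1 + ln r) powr m \<le> C * r powr e"
proof -
  \<comment> \<open>Dividing by m + 1 rather than by \<open>m\<close> covers m = 0.\<close>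
  define \<delta> where "\<delta> = e / (m + 1)"
  have \<delta>: "0 < \<delta>" "\<delta> * m \<le> e" using m e by (auto simp: \<delta>_def field_simps)
  define C where "C = (1 + 1 / \<delta>) powr m"
  have "1 \<le> C" unfolding C_def using m \<delta> by (intro ge_one_powr_ge_zero) auto
  moreover have "(1 + ln r) powr m \<le> C * r powr e" if r: "1 \<le> r" for r
  proof -
    have "1 \<le> r powr \<delta>" using r \<delta> by (intro ge_one_powr_ge_zero) auto
    then have "1 + ln r \<le> (1 + 1 / \<delta>) * r powr \<delta>"
      using ln_powr_bound[OF r \<delta>(1)] by (simp add: distrib_right)
    then have "(1 + ln r) powr m \<le> ((1 + 1 / \<delta>) * r powr \<delta>) powr m"
      using m r by (intro powr_mono2) auto
    also have "\<dots> = C * r powr (\<delta> * m)"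
      using \<delta> by (simp add: C_def powr_mult powr_powr)
    also have "\<dots> \<le> C * r powr e"
      using r \<delta> by (intro mult_left_mono powr_mono) (auto simp: C_def)
    finally show ?thesis .
  qed
  ultimately show thesis using that by blast
qed

text \<open>Slow variation in the form used below: an arbitrarily small power of s / t pays for a
  change of the argument in either direction.\<close>

lemma broken_log_powr_bound:
  assumes e: "0 < e"
  obtains C where "1 \<le> C"
    "\<And>s t. 0 < t \<Longrightarrow> t \<le> s \<Longrightarrow> broken_log A t \<le> C * (s / t) powr e * broken_log A s"
    "\<And>s t. 0 < t \<Longrightarrow> t \<le> s \<Longrightarrow> broken_log A s \<le> C * (s / t) powr e * broken_log A t"
proof -
  define m where "m = \<bar>fst A\<bar> + \<bar>snd A\<bar>"
  obtain C where C: "1 \<le> C" "\<And>r. 1 \<le> r \<Longrightarrow> (1 + ln r) powr m \<le> C * r powr e"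
    using log_powr_le_powr[of m e] e by (auto simp: m_def)
  have est: "broken_log A x \<le> C * (s / t) powr e * broken_log A y"
    if "0 < t" "t \<le> s" "(x = t \<and> y = s) \<or> (x = s \<and> y = t)" for s t x y
  proof -
    have r: "1 \<le> s / t" using that by simp
    then have "0 \<le> ln (s / t)" by simp
    moreover have "ln (t / s) = - ln (s / t)" using that by (simp add: ln_div)
    ultimately have ln: "\<bar>ln (x / y)\<bar> = ln (s / t)" using that(3) by auto
    have "broken_log A x \<le> broken_log A y * (1 + ln (s / t)) powr m"
      using broken_log_slowly_varying[of y x A] that unfolding ln m_def by auto
    also have "\<dots> \<le> broken_log A y * (C * (s / t) powr e)"
      by (intro mult_left_mono C r) simp
    finally show ?thesis by (simp add: mult_ac)
  qed
  show thesis by (rule that[OF C(1)]) (use est in blast)+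
qed

text \<open>The quotient is again a broken logarithm. Its exponent is nonnegative on (0, 1], where
  |ln| decreases, and nonpositive beyond 1, where |ln| increases; the value 1 separates the two
  branches. This is where the sign conditions on the weights enter.\<close>

lemma broken_log_ratio_antimono:
  assumes "0 < s" "s \<le> t" "snd A \<le> snd B" "fst B \<le> fst A"
  shows "broken_log A t / broken_log B t \<le> broken_log A s / broken_log B s"
proof -
  have ratio: "broken_log A r / broken_log B r =
      (if r \<le> 1 then (1 + \<bar>ln r\<bar>) powr (fst A - fst B) else (1 + \<bar>ln r\<bar>) powr (snd A - snd B))" for r
    by (simp add: broken_log_def powr_diff)
  have ln: "ln s \<le> ln t" using assms by simp
  consider "t \<le> 1" | "1 < s" | "s \<le> 1" "1 < t" using assms by linarith
  then show ?thesis
  proof cases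
    case 1
    then have "ln t \<le> 0" using assms by simp
    with ln have "1 + \<bar>ln t\<bar> \<le> 1 + \<bar>ln s\<bar>" by linarith
    then have "(1 + \<bar>ln t\<bar>) powr (fst A - fst B) \<le> (1 + \<bar>ln s\<bar>) powr (fst A - fst B)"
      using assms by (intro powr_mono2) auto
    then show ?thesis using 1 assms by (simp only: ratio) simp
  next
    case 2
    then have "0 \<le> ln s" by simp
    with ln have "1 + \<bar>ln s\<bar> \<le> 1 + \<bar>ln t\<bar>" by linarith
    then have "(1 + \<bar>ln t\<bar>) powr (snd A - snd B) \<le> (1 + \<bar>ln s\<bar>) powr (snd A - snd B)"
      using assms by (intro powr_mono2') auto
    then show ?thesis using 2 assms by (simp only: ratio) simp
  next
    case 3
    have "(1 + \<bar>ln t\<bar>) powr (snd A - snd B) \<le> (1 + \<bar>ln t\<bar>) powr 0" using assms by (intro powr_mono) auto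
    also have "\<dots> \<le> 1" by simp
    also have "1 \<le> (1 + \<bar>ln s\<bar>) powr (fst A - fst B)" using assms by (intro ge_one_powr_ge_zero) auto
    finally show ?thesis using 3 by (simp add: ratio)
  qed
qed

section \<open>Non-increasing rearrangement\<close>

lemma rearrangement_antimono: "s \<le> t \<Longrightarrow> rearrangement g t \<le> rearrangement g s"
  unfolding rearrangement_def
  by (intro Inf_superset_mono) (auto intro: order_trans ennreal_leI)

text \<open>Superlevel sets of a monotone function are intervals.\<close>

lemma rearrangement_measurable [measurable]: "rearrangement g \<in> borel_measurable borel"
proof (rule borel_measurableI_greater)
  fix y
  have "is_interval {t. y < rearrangement g t}"
    unfolding is_interval_1 using rearrangement_antimono[of _ _ g] less_le_trans by blast
  then show "{t \<in> space borel. y < rearrangement g t} \<in> sets borel"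
    by (simp add: real_interval_borel_measurable)
qed

lemma rearrangement_ge:
  fixes g :: "real ^ 'n \<Rightarrow> complex"
  assumes [measurable]: "g \<in> borel_measurable lebesgue"
    and t: "ennreal t < emeasure lebesgue {x. s < ennreal (norm (g x))}"
  shows "s \<le> rearrangement g t"
  unfolding rearrangement_def
proof (rule Inf_greatest)
  fix s' assume s': "s' \<in> {s. emeasure lebesgue {x. s < ennreal (norm (g x))} \<le> ennreal t}"
  show "s \<le> s'"
  proof (rule ccontr)
    assume "\<not> s \<le> s'"
    then have "{x. s < ennreal (norm (g x))} \<subseteq> {x. s' < ennreal (norm (g x))}" by auto
    moreover have "{x \<in> space lebesgue. s' < ennreal (norm (g x))} \<in> sets lebesgue" by measurable
    ultimately have "emeasure lebesgue {x. s < ennreal (norm (g x))} \<le> emeasure lebesgue {x. s' < ennreal (norm (g x))}"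
      by (intro emeasure_mono) auto
    then show False using s' t by auto
  qed
qed

lemma rearrangement_cong_AE:
  fixes g h :: "real ^ 'n \<Rightarrow> complex"
  assumes [measurable]: "g \<in> borel_measurable lebesgue" "h \<in> borel_measurable lebesgue"
    and ae: "AE x in lebesgue. g x = h x"
  shows "rearrangement g = rearrangement h"
proof -
  have "emeasure lebesgue {x. s < ennreal (norm (g x))} = emeasure lebesgue {x. s < ennreal (norm (h x))}" for s
  proof (rule emeasure_eq_AE)
    show "AE x in lebesgue. (x \<in> {x. s < ennreal (norm (g x))}) = (x \<in> {x. s < ennreal (norm (h x))})"
      using ae by eventually_elim simp
    have "{x \<in> space lebesgue. s < ennreal (norm (g x))} \<in> sets lebesgue"
      "{x \<in> space lebesgue. s < ennreal (norm (h x))} \<in> sets lebesgue" by measurable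
    then show "{x. s < ennreal (norm (g x))} \<in> sets lebesgue" "{x. s < ennreal (norm (h x))} \<in> sets lebesgue" by simp_all
  qed
  then show ?thesis by (simp add: rearrangement_def fun_eq_iff)
qed

lemma rearrangement_le:
  fixes g :: "real ^ 'n \<Rightarrow> complex"
  assumes ae: "AE x in lebesgue. norm (g x) \<le> N"
  shows "rearrangement g t \<le> ennreal N"
proof -
  have "AE x in lebesgue. x \<notin> {x. ennreal N < ennreal (norm (g x))}"
    using ae by eventually_elim (simp add: ennreal_leI not_less)
  then have "{x. ennreal N < ennreal (norm (g x))} \<in> null_sets lebesgue"
    by (auto simp: eventually_ae_filter intro: null_sets_completion_subset)
  then show ?thesis unfolding rearrangement_def by (intro Inf_lower) auto
qed

lemma emeasure_lborel_atLeast: "emeasure lborel {a::real..} = \<infinity>"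
proof (rule ccontr)
  assume "emeasure lborel {a..} \<noteq> \<infinity>"
  then obtain r where r: "emeasure lborel {a..} = ennreal r" "0 \<le> r"
    by (cases "emeasure lborel {a..}" rule: ennreal_cases) auto
  have "emeasure lborel {a..a + (r + 1)} \<le> emeasure lborel {a..}" by (intro emeasure_mono) auto
  with r show False by (simp add: ennreal_le_iff)
qed

text \<open>Layer-cake formula on both sides. The part of \<open>E\<close> where |g| > s has some
  measure r \<le> T, and the rearrangement is at least \<open>s\<close> on (0, r); integrating over
  s \<ge> 0 compares the two integrals.\<close>

lemma nn_integral_le_rearrangement_borel:
  fixes g :: "real ^ 'n \<Rightarrow> complex"
  assumes [measurable]: "g \<in> borel_measurable borel" and E [measurable]: "E \<in> sets borel"
    and T: "emeasure lborel E \<le> ennreal T"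
  shows "(\<integral>\<^sup>+x\<in>E. ennreal (norm (g x)) \<partial>lborel) \<le>
    (\<integral>\<^sup>+t\<in>{0<..<T}. rearrangement g t \<partial>lborel)"
proof -
  let ?U = "\<lambda>s. {x \<in> E. ennreal s < ennreal (norm (g x))}"
  \<comment> \<open>The comparison is non-strict because \<open>rearrangement_ge\<close> yields no
    more; the integral over \<open>s\<close> is the same.\<close>
  let ?V = "\<lambda>s. {t \<in> {0<..<T}. ennreal s \<le> rearrangement g t}"
  let ?W = "\<lambda>t. {s. 0 \<le> s \<and> ennreal s \<le> rearrangement g t}"
  have gl: "g \<in> borel_measurable lebesgue" by (rule measurable_completion) simp
  have dist: "emeasure lborel (?U s) \<le>
      emeasure lborel (?V s)" for s
  proof -
    let ?\<mu> = "emeasure lborel (?U s)"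
    define r where "r = enn2real ?\<mu>"
    let ?X = "{x. ennreal s < ennreal (norm (g x))}"
    have m [measurable]: "(?U s) \<in> sets borel" by measurable
    have \<mu>T: "?\<mu> \<le> ennreal T" by (rule order_trans[OF emeasure_mono T]) auto
    have fin: "?\<mu> < \<infinity>" using \<mu>T by (rule le_less_trans) simp
    then have \<mu>r: "?\<mu> = ennreal r" by (simp add: r_def)
    have m2: "?X \<in> sets borel"
    proof -
      have "{x \<in> space borel. ennreal s < ennreal (norm (g x))} \<in> sets borel" by measurable
      then show ?thesis by simp
    qed
    have sub: "{0<..<r} \<subseteq> (?V s)"
    proof
      fix t assume t: "t \<in> {0<..<r}"
      have "ennreal t < ennreal r" using t by (simp add: ennreal_less_iff)
      also have "\<dots> \<le> emeasure lborel ?X"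
        unfolding \<mu>r[symmetric] using m2 by (intro emeasure_mono) auto
      also have "\<dots> = emeasure lebesgue ?X"
        using m2 by simp
      finally have "ennreal s \<le> rearrangement g t" by (rule rearrangement_ge[OF gl])
      moreover have "r \<le> T" using \<mu>T t unfolding \<mu>r by (auto simp: ennreal_le_iff2)
      ultimately show "t \<in> (?V s)" using t by simp
    qed
    have "{t \<in> space borel. t \<in> {0<..<T} \<and> ennreal s \<le> rearrangement g t} \<in> sets borel" by measurable
    then have "emeasure lborel {0<..<r} \<le> emeasure lborel (?V s)"
      by (intro emeasure_mono[OF sub]) simp
    moreover have "0 \<le> r" by (simp add: r_def)
    ultimately show ?thesis unfolding \<mu>r by simp
  qed
  have "(\<integral>\<^sup>+x\<in>E. ennreal (norm (g x)) \<partial>lborel) =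
      (\<integral>\<^sup>+x. (\<integral>\<^sup>+s. indicator {0..} s * indicator (?U s) x \<partial>lborel) \<partial>lborel)"
  proof (rule nn_integral_cong)
    fix x
    have "(\<integral>\<^sup>+s. indicator {0..} s * indicator (?U s) x \<partial>lborel) =
      (\<integral>\<^sup>+s. indicator E x * indicator {0..<norm (g x)} s \<partial>lborel)"
      by (intro nn_integral_cong) (auto simp: indicator_def ennreal_less_iff)
    also have "\<dots> = ennreal (norm (g x)) * indicator E x" by (simp add: nn_integral_cmult mult.commute)
    finally show "ennreal (norm (g x)) * indicator E x =
      (\<integral>\<^sup>+s. indicator {0..} s * indicator (?U s) x \<partial>lborel)" by simp
  qed
  also have "\<dots> = (\<integral>\<^sup>+s. (\<integral>\<^sup>+x. indicator {0..} s * indicator (?U s) x \<partial>lborel) \<partial>lborel)"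
    by (rule lborel_pair.Fubini'[symmetric]) measurable
  also have "\<dots> = (\<integral>\<^sup>+s. indicator {0..} s * emeasure lborel (?U s) \<partial>lborel)"
    by (intro nn_integral_cong) (simp add: nn_integral_cmult)
  also have "\<dots> \<le> (\<integral>\<^sup>+s. indicator {0..} s * emeasure lborel (?V s) \<partial>lborel)"
    by (intro nn_integral_mono mult_left_mono dist) simp
  also have "\<dots> = (\<integral>\<^sup>+s. (\<integral>\<^sup>+t. indicator {0..} s * indicator (?V s) t \<partial>lborel) \<partial>lborel)"
    by (intro nn_integral_cong) (simp add: nn_integral_cmult)
  also have "\<dots> = (\<integral>\<^sup>+t. (\<integral>\<^sup>+s. indicator {0..} s * indicator (?V s) t \<partial>lborel) \<partial>lborel)"
    by (rule lborel_pair.Fubini') measurable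
  also have "\<dots> = (\<integral>\<^sup>+t\<in>{0<..<T}. rearrangement g t \<partial>lborel)"
  proof (rule nn_integral_cong)
    fix t
    have "(\<integral>\<^sup>+s. indicator {0..} s * indicator (?V s) t \<partial>lborel) =
      (\<integral>\<^sup>+s. indicator {0<..<T} t * indicator (?W t) s \<partial>lborel)"
      by (intro nn_integral_cong) (auto simp: indicator_def)
    also have "\<dots> = indicator {0<..<T} t * emeasure lborel (?W t)"
    proof -
      have "{s \<in> space borel. 0 \<le> s \<and> ennreal s \<le> rearrangement g t} \<in> sets borel" by measurable
      then show ?thesis by (simp add: nn_integral_cmult)
    qed
    also have "emeasure lborel (?W t) = rearrangement g t"
    proof (cases "rearrangement g t" rule: ennreal_cases)
      case (real r)
      then have "(?W t) = {0..r}" by (auto simp: ennreal_le_iff)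
      then show ?thesis using real by simp
    next
      case top
      then have "(?W t) = {0::real..}" by auto
      then show ?thesis using top by (simp add: emeasure_lborel_atLeast)
    qed
    finally show "(\<integral>\<^sup>+s. indicator {0..} s * indicator (?V s) t \<partial>lborel) =
      rearrangement g t * indicator {0<..<T} t" by (simp add: mult.commute)
  qed
  finally show ?thesis .
qed

section \<open>Estimates for Lorentz--Zygmund quasi-norms\<close>

lemma ennreal_powr_ennreal: "0 \<le> a \<Longrightarrow> ennreal_powr (ennreal a) r = ennreal (a powr r)"
  by (simp add: ennreal_powr_def)

lemma ennreal_powr_mono:
  assumes "0 < r" "x \<le> y" shows "ennreal_powr x r \<le> ennreal_powr y r"
proof (cases y rule: ennreal_cases)
  case (real b)
  then obtain a where "x = ennreal a" "0 \<le> a" using assms(2) by (cases x rule: ennreal_cases) (auto simp: top_unique)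
  with real assms show ?thesis by (simp add: ennreal_powr_ennreal ennreal_leI powr_mono2)
qed (simp add: ennreal_powr_def)

lemma ennreal_powr_mult:
  assumes "0 < r" shows "ennreal_powr (x * y) r = ennreal_powr x r * ennreal_powr y r"
proof -
  have top: "ennreal_powr (top * z) r = top * ennreal_powr z r" for z
  proof (cases "z = 0")
    case True then show ?thesis using assms by (simp add: ennreal_powr_def)
  next
    case False
    then have "ennreal_powr z r \<noteq> 0" by (cases z rule: ennreal_cases) (auto simp: ennreal_powr_def)
    with False show ?thesis by (simp add: ennreal_top_mult ennreal_powr_def)
  qed
  show ?thesis
  proof (cases x rule: ennreal_cases)
    case x: (real a)
    show ?thesis
    proof (cases y rule: ennreal_cases)
      case y: (real b)
      with x show ?thesis by (simp add: ennreal_mult[symmetric] ennreal_powr_ennreal powr_mult)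
    next
      case y: top
      have "ennreal_powr top r = top" by (simp add: ennreal_powr_def)
      with y top[of x] show ?thesis by (simp add: mult.commute)
    qed
  next
    case x: top
    have "ennreal_powr top r = top" by (simp add: ennreal_powr_def)
    with x top[of y] show ?thesis by simp
  qed
qed

lemma ennreal_powr_powr:
  assumes "0 < r" shows "ennreal_powr (ennreal_powr x r) (1 / r) = x"
  using assms by (cases x rule: ennreal_cases) (simp_all add: ennreal_powr_ennreal powr_powr, simp add: ennreal_powr_def)

lemma ennreal_powr_powr':
  assumes "0 < r" shows "ennreal_powr (ennreal_powr x (1 / r)) r = x"
  using ennreal_powr_powr[of "1 / r" x] assms by simp

lemma ennreal_powr_measurable [measurable]: "(\<lambda>x. ennreal_powr x r) \<in> borel_measurable borel"
  unfolding ennreal_powr_def by measurable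

lemma recip_eq: "0 < p \<Longrightarrow> p < \<infinity> \<Longrightarrow> recip p = 1 / enn2real p"
  unfolding recip_def by (cases p rule: ennreal_cases) (auto simp: inverse_ennreal divide_inverse)

lemma recip_top: "recip top = 0" by (simp add: recip_def)

lemma Lp_quasinorm_finite_exponent:
  assumes "0 < b" "b < \<infinity>"
  shows "Lp_quasinorm M b h = ennreal_powr (\<integral>\<^sup>+t. ennreal_powr (h t) (enn2real b) \<partial>M) (1 / enn2real b)"
  using assms recip_eq[OF assms] by (cases "b = \<infinity>") (simp_all add: Lp_quasinorm_def)

lemma nn_integral_lebesgue_on_positive:
  "(\<integral>\<^sup>+t. f t \<partial>lebesgue_on {0<..}) = (\<integral>\<^sup>+t\<in>{0::real<..}. f t \<partial>lborel)"
  by (simp add: nn_integral_restrict_space nn_integral_completion)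

lemma AE_lebesgue_on_positive:
  "(AE t in lebesgue_on {0<..}. P t) \<longleftrightarrow> (AE t in lborel. 0 < (t::real) \<longrightarrow> P t)"
  by (subst AE_restrict_space_iff) (auto simp: AE_completion_iff)

lemma nn_integral_powr_le:
  fixes e T :: real
  assumes "0 < e" "0 \<le> T"
  shows "(\<integral>\<^sup>+t\<in>{0<..<T}. ennreal (t powr (e - 1)) \<partial>lborel) \<le> ennreal (T powr e / e)"
proof -
  have "(\<integral>\<^sup>+t\<in>{0<..<T}. ennreal (t powr (e - 1)) \<partial>lborel) \<le>
      (\<integral>\<^sup>+t\<in>{0..T}. ennreal (t powr (e - 1)) \<partial>lborel)"
    by (intro nn_integral_mono mult_left_mono) (auto simp: indicator_def)
  also have "\<dots> = ennreal (T powr e / e)"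
    using nn_integral_has_integral_lebesgue'[OF _ has_integral_powr_from_0[of "e - 1" T]] assms by simp
  finally show ?thesis .
qed

lemma powr_ge_on_half:
  fixes s t e :: real
  assumes "0 < t" "t / 2 < s" "s < t"
  shows "2 powr (- \<bar>e\<bar>) * t powr e \<le> s powr e"
proof (cases "0 \<le> e")
  case True
  have "2 powr (- \<bar>e\<bar>) * t powr e = (t / 2) powr e"
    using assms True by (simp add: powr_divide powr_minus_divide)
  also have "\<dots> \<le> s powr e" using assms True by (intro powr_mono2) auto
  finally show ?thesis .
next
  case False
  have "2 powr (- \<bar>e\<bar>) * t powr e \<le> 1 * t powr e"
    using powr_mono[of "- \<bar>e\<bar>" 0 2] by (intro mult_right_mono) auto
  also have "\<dots> \<le> s powr e" using assms False by (simp add: powr_mono2')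
  finally show ?thesis .
qed

text \<open>Embedding into the corresponding weak space. On (t/2, t) the rearrangement is at least
  its value at \<open>t\<close> and the weight is comparable with its value at \<open>t\<close>, so
  this interval alone bounds the quasi-norm from below. For finite \<open>c\<close> its length
  supplies the power t^(1/c) by which the exponent of the weight falls short of 1/q.\<close>

lemma rearrangement_le_lz_norm:
  fixes B :: "real \<times> real" and c :: ennreal
  assumes c: "0 < c"
  obtains C where "0 < C"
    "\<And>(g :: real ^ 'n \<Rightarrow> complex) t. 0 < t \<Longrightarrow>
      ennreal (t powr recip q * broken_log B t) * rearrangement g t \<le> ennreal C * lz_norm q c B g"
proof -
  obtain K where K: "1 \<le> K"
    "\<And>s t. 0 < t \<Longrightarrow> t \<le> s \<Longrightarrow> broken_log B s \<le> K * (s / t) powr 1 * broken_log B t"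
    using broken_log_powr_bound[of 1 B] by (metis zero_less_one)
  define e where "e = recip q - recip c"
  \<comment> \<open>Lower bound for the weight on (t/2, t): \<open>2 powr (- \<bar>e\<bar>)\<close>
    from the power and 1 / (2 K) from the logarithm, as t / s \<le> 2.\<close>
  define \<kappa> where "\<kappa> = 2 powr (- \<bar>e\<bar>) / (2 * K)"
  have \<kappa>: "0 < \<kappa>" using K(1) by (simp add: \<kappa>_def)
  have weight: "\<kappa> * (t powr e * broken_log B t) \<le> s powr e * broken_log B s" if "0 < t" "t / 2 < s" "s < t" for s t
  proof -
    have "t / s \<le> 2" using that by (simp add: field_simps)
    have "broken_log B t \<le> K * (t / s) powr 1 * broken_log B s" using that by (intro K) auto
    also have "\<dots> \<le> K * 2 * broken_log B s"
      using K(1) \<open>t / s \<le> 2\<close> that by (intro mult_right_mono mult_left_mono) auto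
    finally have "broken_log B t / (2 * K) \<le> broken_log B s" using K(1) by (simp add: field_simps)
    then have "(2 powr (- \<bar>e\<bar>) * t powr e) * (broken_log B t / (2 * K)) \<le> s powr e * broken_log B s"
      using powr_ge_on_half[OF that, of e] K(1) by (intro mult_mono) auto
    then show ?thesis by (simp add: \<kappa>_def mult_ac)
  qed
  have le_h: "ennreal (\<kappa> * (t powr e * broken_log B t)) * rearrangement g t \<le>
      ennreal (s powr e * broken_log B s) * rearrangement g s"
    if "0 < t" "t / 2 < s" "s < t" for s t and g :: "real ^ 'n \<Rightarrow> complex"
    using that by (intro mult_mono ennreal_leI weight rearrangement_antimono) auto
  have lz: "lz_norm q c B g = Lp_quasinorm (lebesgue_on {0<..}) c
      (\<lambda>s. ennreal (s powr e * broken_log B s) * rearrangement g s)" for g :: "real ^ 'n \<Rightarrow> complex"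
    by (simp add: lz_norm_def e_def)
  have cases: "ennreal (\<kappa> * 2 powr (- recip c)) * (ennreal (t powr recip q * broken_log B t) * rearrangement g t) \<le> lz_norm q c B g"
    if t: "0 < t" for t and g :: "real ^ 'n \<Rightarrow> complex"
  proof (cases "c = \<infinity>")
    case True
    let ?h = "\<lambda>s. ennreal (s powr e * broken_log B s) * rearrangement g s"
    have D: "lz_norm q c B g = esssup (lebesgue_on {0<..}) ?h" unfolding lz Lp_quasinorm_def using True by simp
    have ae: "AE s in lborel. 0 < s \<longrightarrow> ?h s \<le> lz_norm q c B g"
      unfolding D using esssup_AE[of ?h "lebesgue_on {0<..}"] by (simp only: AE_lebesgue_on_positive)
    \<comment> \<open>An almost everywhere bound holds at some point of any interval of positive
      length.\<close>
    have "\<exists>s\<in>{t/2<..<t}. ?h s \<le> lz_norm q c B g"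
    proof (rule ccontr)
      assume no: "\<not> (\<exists>s\<in>{t/2<..<t}. ?h s \<le> lz_norm q c B g)"
      from ae have "AE s in lborel. s \<notin> {t/2<..<t}"
        by eventually_elim (use no t in auto)
      then have "{t/2<..<t} \<in> null_sets lborel" by (subst (asm) AE_iff_null_sets[symmetric]) auto
      then show False using t by (simp add: null_sets_def)
    qed
    then obtain s where s: "t / 2 < s" "s < t" "?h s \<le> lz_norm q c B g" by auto
    have "ennreal (\<kappa> * (t powr e * broken_log B t)) * rearrangement g t \<le> lz_norm q c B g"
      using le_h[OF t s(1,2)] s(3) by (rule order_trans)
    then show ?thesis
      using \<kappa> True by (simp add: e_def recip_top ennreal_mult mult.assoc)
  next
    case False
    then have cf: "c < \<infinity>" by (simp add: less_top)
    define p where "p = enn2real c"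
    have p: "0 < p" using c cf by (simp add: p_def enn2real_positive_iff)
    have rc: "recip c = 1 / p" using recip_eq[OF c cf] by (simp add: p_def)
    define X where "X = ennreal (\<kappa> * (t powr e * broken_log B t)) * rearrangement g t"
    have "ennreal (t / 2) * ennreal_powr X p = (\<integral>\<^sup>+s\<in>{t/2<..<t}. ennreal_powr X p \<partial>lborel)"
      using t by (simp add: nn_integral_cmult mult.commute)
    also have "\<dots> \<le> (\<integral>\<^sup>+s\<in>{0<..}. ennreal_powr (ennreal (s powr e * broken_log B s) * rearrangement g s) p \<partial>lborel)"
    proof (rule nn_integral_mono)
      fix s
      show "ennreal_powr X p * indicator {t/2<..<t} s \<le>
        ennreal_powr (ennreal (s powr e * broken_log B s) * rearrangement g s) p * indicator {0<..} s"
        using t ennreal_powr_mono[OF p le_h[OF t, of s g]]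
        by (cases "s \<in> {t/2<..<t}") (auto simp: X_def)
    qed
    finally have "ennreal_powr (ennreal (t / 2) * ennreal_powr X p) (1 / p) \<le> lz_norm q c B g"
      unfolding lz Lp_quasinorm_finite_exponent[OF c cf] nn_integral_lebesgue_on_positive p_def[symmetric]
      using p by (intro ennreal_powr_mono) auto
    moreover have "ennreal_powr (ennreal (t / 2) * ennreal_powr X p) (1 / p) = ennreal ((t / 2) powr (1 / p)) * X"
      using p t by (simp add: ennreal_powr_mult ennreal_powr_powr ennreal_powr_ennreal)
    moreover have "ennreal ((t / 2) powr (1 / p)) * X =
      ennreal (\<kappa> * 2 powr (- recip c)) * (ennreal (t powr recip q * broken_log B t) * rearrangement g t)"
    proof -
      have "(t / 2) powr (1 / p) * (\<kappa> * (t powr e * broken_log B t)) =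
          \<kappa> * 2 powr (- recip c) * (t powr recip q * broken_log B t)"
      proof -
        have "t powr recip q = t powr (1 / p) * t powr e" using t by (simp add: powr_add[symmetric] e_def rc)
        moreover have "(t / 2) powr (1 / p) = t powr (1 / p) * 2 powr (- recip c)"
          using t by (simp add: powr_divide rc powr_minus_divide)
        ultimately show ?thesis by simp
      qed
      then have "ennreal ((t / 2) powr (1 / p)) * ennreal (\<kappa> * (t powr e * broken_log B t)) =
          ennreal (\<kappa> * 2 powr (- recip c)) * ennreal (t powr recip q * broken_log B t)"
        using \<kappa> by (simp only: ennreal_mult[symmetric] mult_nonneg_nonneg powr_ge_zero broken_log_nonneg less_imp_le)
      then show ?thesis by (simp add: X_def mult.assoc[symmetric])
    qed
    ultimately show ?thesis by simp
  qed
  define C where "C = 1 / (\<kappa> * 2 powr (- recip c))"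
  have C: "0 < C" using \<kappa> by (simp add: C_def)
  show thesis
  proof (rule that[OF C], goal_cases)
    case (1 g t)
    let ?Y = "ennreal (t powr recip q * broken_log B t) * rearrangement g t"
    have "?Y = ennreal (C * (\<kappa> * 2 powr (- recip c))) * ?Y" using \<kappa> by (simp add: C_def)
    also have "\<dots> = ennreal C * (ennreal (\<kappa> * 2 powr (- recip c)) * ?Y)"
      using \<kappa> C by (simp add: ennreal_mult mult.assoc)
    also have "\<dots> \<le> ennreal C * lz_norm q c B g"
      by (intro mult_left_mono cases 1) simp
    finally show ?case .
  qed
qed

section \<open>Local integrals of the rearrangement\<close>

lemma broken_log_0: "broken_log (0, 0) t = 1"
proof -
  have "1 + \<bar>ln t\<bar> \<noteq> 0" by linarith
  then show ?thesis
    by (simp only: broken_log_def fst_conv snd_conv powr_zero_eq_one if_cancel if_False)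
qed

lemma lz_norm_1_1: "lz_norm 1 1 (0, 0) g = (\<integral>\<^sup>+t\<in>{0<..}. rearrangement g t \<partial>lborel)"
proof -
  have "enn2real 1 = 1" "recip 1 = 1" by (simp_all add: recip_def)
  moreover have "ennreal_powr x 1 = x" for x by (cases x rule: ennreal_cases) (simp_all add: ennreal_powr_def)
  moreover have "ennreal (t powr 0 * broken_log (0, 0) t) * y * indicator {0<..} t = y * indicator {0<..} t" for t y
    by (auto simp: broken_log_0 indicator_def)
  moreover have "1 \<noteq> (\<infinity> :: ennreal)" by simp
  ultimately show ?thesis
    unfolding lz_norm_def Lp_quasinorm_def
    by (simp only: if_False nn_integral_lebesgue_on_positive diff_self)
qed

text \<open>For q > 1 the weak bound dominates the rearrangement by a multiple of t^(-1/q) divided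
  by the logarithm, which is integrable at 0. Moving the logarithm from \<open>t\<close> to
  \<open>T\<close> and on to \<open>t0\<close> costs small powers, and all growth in T / t0 is
  rounded up to a square. For q = c = 1 the quasi-norm already is the full integral.\<close>

lemma nn_integral_rearrangement_le:
  fixes B :: "real \<times> real" and q c :: ennreal
  assumes q: "1 \<le> q" "q < \<infinity>" and c: "0 < c" and cs: "(q = 1 \<and> c = 1 \<and> B = (0, 0)) \<or> 1 < q"
  obtains C where "0 < C"
    "\<And>(g :: real ^ 'n \<Rightarrow> complex) t0 T d. 0 < t0 \<Longrightarrow> t0 \<le> T \<Longrightarrow> 0 \<le> d \<Longrightarrow> lz_norm q c B g = ennreal d \<Longrightarrow>
      (\<integral>\<^sup>+t\<in>{0<..<T}. rearrangement g t \<partial>lborel) \<le>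
        ennreal (C * d * (t0 powr (1 - recip q) / broken_log B t0) * (T / t0)\<^sup>2)"
proof (cases "1 < q")
  case False
  then have eq: "q = 1" "c = 1" "B = (0, 0)" using cs by auto
  show thesis
  proof (rule that[of 1], goal_cases)
    case (2 g t0 T d)
    note t = 2(1,2) and d = 2(3,4)
    have "(\<integral>\<^sup>+t\<in>{0<..<T}. rearrangement g t \<partial>lborel) \<le> (\<integral>\<^sup>+t\<in>{0<..}. rearrangement g t \<partial>lborel)"
      by (intro nn_integral_mono mult_left_mono) (auto simp: indicator_def)
    also have "\<dots> = ennreal d" using d(2) by (simp add: eq lz_norm_1_1)
    also have "\<dots> \<le> ennreal (1 * d * (t0 powr (1 - recip q) / broken_log B t0) * (T / t0)\<^sup>2)"
    proof (rule ennreal_leI)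
      have "1 \<le> (T / t0)\<^sup>2" using t by simp
      then have "d * 1 \<le> d * (T / t0)\<^sup>2" using d by (intro mult_left_mono) auto
      moreover have "t0 powr (1 - recip q) = 1" using t by (simp add: eq recip_def)
      ultimately show "d \<le> 1 * d * (t0 powr (1 - recip q) / broken_log B t0) * (T / t0)\<^sup>2"
        by (simp add: eq broken_log_0)
    qed
    finally show ?case .
  qed simp
next
  case True
  define k where "k = recip q"
  have k: "0 < k" "k < 1"
  proof -
    obtain x where x: "q = ennreal x" "0 \<le> x" using q(2) by (cases q rule: ennreal_cases) auto
    with True have "1 < x" by (simp add: ennreal_less_iff flip: ennreal_1)
    then show "0 < k" "k < 1" using x by (auto simp: k_def recip_def inverse_ennreal inverse_less_1_iff)
  qed
  \<comment> \<open>Half of the room 1 - k: the exponent 1 - k - e stays positive, so the integral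
    converges at 0, and 1 - k + e is still at most 2.\<close>
  define e where "e = (1 - k) / 2"
  have e: "0 < e" "0 < 1 - k - e" "1 - k + e \<le> 2" using k by (auto simp: e_def field_simps)
  obtain C1 where C1: "0 < C1"
    "\<And>(g :: real ^ 'n \<Rightarrow> complex) t. 0 < t \<Longrightarrow>
      ennreal (t powr k * broken_log B t) * rearrangement g t \<le> ennreal C1 * lz_norm q c B g"
    using rearrangement_le_lz_norm[OF c, of q B] unfolding k_def by blast
  obtain K where K: "1 \<le> K"
    "\<And>s t. 0 < t \<Longrightarrow> t \<le> s \<Longrightarrow> broken_log B s \<le> K * (s / t) powr e * broken_log B t"
    "\<And>s t. 0 < t \<Longrightarrow> t \<le> s \<Longrightarrow> broken_log B t \<le> K * (s / t) powr e * broken_log B s"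
    using broken_log_powr_bound[OF e(1), of B] by metis
  define C where "C = C1 * K * K / (1 - k - e)"
  have C: "0 < C" using C1 K(1) e by (simp add: C_def)
  show thesis
  proof (rule that[OF C], goal_cases)
    case (1 g t0 T d)
    note t0 = 1(1,2) and d = 1(3,4)
    let ?e = "1 - k - e" and ?c = "\<lambda>k. t0 powr (1 - k) / broken_log B t0"
    have T: "0 < T" using t0 by simp
    \<comment> \<open>The two factors \<open>K\<close> belong to the two moves of the logarithm:
      \<open>T\<close> to \<open>t0\<close> gives (T / t0)^e, and \<open>t\<close> to
      \<open>T\<close> gives T^e, its other factor t^(-e) staying in the integrand.\<close>
    define M where "M = C1 * d * K * K * (T / t0) powr e / broken_log B t0 * T powr e"
    have M: "0 \<le> M" using C1 K(1) d by (simp add: M_def)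
    have pt: "rearrangement g t \<le> ennreal (M * t powr (- k - e))" if t: "0 < t" "t < T" for t
    proof -
      let ?v = "t powr k * broken_log B t"
      have "ennreal ?v * rearrangement g t \<le> ennreal (C1 * d)"
        using C1(2)[OF t(1), of g] C1(1) d by (simp add: ennreal_mult)
      then have "ennreal (1 / ?v) * (ennreal ?v * rearrangement g t) \<le>
          ennreal (1 / ?v) * ennreal (C1 * d)"
        by (rule mult_left_mono) simp
      moreover have "ennreal (1 / ?v) * ennreal ?v = 1"
        using t(1) by (subst ennreal_mult[symmetric]) simp_all
      ultimately have "rearrangement g t \<le> ennreal (1 / ?v) * ennreal (C1 * d)"
        by (simp only: mult.assoc[symmetric] mult_1_left)
      also have "\<dots> = ennreal (1 / ?v * (C1 * d))"
        using C1(1) d by (intro ennreal_mult[symmetric]) auto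
      also have "\<dots> \<le> ennreal (M * t powr (- k - e))"
      proof (rule ennreal_leI)
        have a: "broken_log B t0 \<le> K * (T / t0) powr e * broken_log B T" using t0 by (intro K) auto
        have b: "broken_log B T \<le> K * (T / t) powr e * broken_log B t" using t by (intro K) auto
        have "broken_log B t0 \<le> K * (T / t0) powr e * (K * (T / t) powr e * broken_log B t)"
          using K(1) by (intro order_trans[OF a] mult_left_mono b) auto
        then have "1 / broken_log B t \<le> K * (T / t0) powr e * (K * (T / t) powr e) / broken_log B t0"
          by (simp add: divide_simps mult_ac)
        then have "(C1 * d * t powr (- k)) * (1 / broken_log B t) \<le>
            (C1 * d * t powr (- k)) * (K * (T / t0) powr e * (K * (T / t) powr e) / broken_log B t0)"
          using C1(1) d by (intro mult_left_mono) auto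
        moreover have "1 / ?v * (C1 * d) = (C1 * d * t powr (- k)) * (1 / broken_log B t)"
          by (simp add: powr_minus_divide)
        moreover have "(T / t) powr e = T powr e * t powr (- e)"
          using t T by (simp add: powr_divide powr_minus_divide)
        moreover have "t powr (- k - e) = t powr (- k) * t powr (- e)"
          using t by (simp add: powr_add[symmetric])
        ultimately show "1 / ?v * (C1 * d) \<le> M * t powr (- k - e)"
          unfolding M_def by (simp add: mult_ac)
      qed
      finally show ?thesis .
    qed
    have "(\<integral>\<^sup>+t\<in>{0<..<T}. rearrangement g t \<partial>lborel) \<le>
        (\<integral>\<^sup>+t. ennreal M * (ennreal (t powr (?e - 1)) * indicator {0<..<T} t) \<partial>lborel)"
    proof (rule nn_integral_mono)
      fix t
      have "rearrangement g t \<le> ennreal M * ennreal (t powr (- k - e))" if "0 < t" "t < T"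
        using pt[OF that] M by (simp add: ennreal_mult)
      then show "rearrangement g t * indicator {0<..<T} t \<le> ennreal M * (ennreal (t powr (?e - 1)) * indicator {0<..<T} t)"
        by (auto simp: indicator_def)
    qed
    also have "\<dots> = ennreal M * (\<integral>\<^sup>+t\<in>{0<..<T}. ennreal (t powr (?e - 1)) \<partial>lborel)"
      by (rule nn_integral_cmult) measurable
    also have "\<dots> \<le> ennreal M * ennreal (T powr ?e / ?e)"
      using T e by (intro mult_left_mono nn_integral_powr_le) auto
    also have "\<dots> = ennreal (M * (T powr ?e / ?e))"
      using M e by (intro ennreal_mult[symmetric]) auto
    also have "\<dots> \<le> ennreal (C * d * ?c (recip q) * (T / t0)\<^sup>2)"
    proof (rule ennreal_leI)
      have "(T / t0) powr (1 - k + e) \<le> (T / t0) powr 2"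
        using t0 e by (intro powr_mono) auto
      also have "\<dots> = (T / t0)\<^sup>2" using t0 T by simp
      finally have le: "(T / t0) powr (1 - k + e) \<le> (T / t0)\<^sup>2" .
      have "T powr e * T powr ?e = T powr (1 - k)"
        using T by (simp add: powr_add[symmetric])
      also have "\<dots> = t0 powr (1 - k) * (T / t0) powr (1 - k)"
        using T t0 by (simp add: powr_divide)
      finally have eq1: "T powr e * T powr ?e = t0 powr (1 - k) * (T / t0) powr (1 - k)" .
      have "M * (T powr ?e / ?e) =
          C * d * ((T / t0) powr e / broken_log B t0) * (T powr e * T powr ?e)"
        by (simp add: M_def C_def mult_ac)
      also have "\<dots> = C * d * ?c k * ((T / t0) powr (1 - k) * (T / t0) powr e)"
        unfolding eq1 by simp
      also have "(T / t0) powr (1 - k) * (T / t0) powr e = (T / t0) powr (1 - k + e)"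
        using T t0 by (simp add: powr_add)
      also have "C * d * ?c k * (T / t0) powr (1 - k + e) \<le>
          C * d * ?c k * (T / t0)\<^sup>2"
        using C d by (intro mult_left_mono le) auto
      finally show "M * (T powr ?e / ?e) \<le>
          C * d * ?c (recip q) * (T / t0)\<^sup>2"
        by (simp add: k_def)
    qed
    finally show ?case .
  qed
qed

text \<open>Turns the integrand of a quasi-norm with exponent \<open>r\<close> into (t^k v)^r dt /
  t, where the power t^k is the same for every \<open>r\<close>.\<close>

lemma powr_div_self:
  fixes t v r :: real
  assumes "0 < t" "0 \<le> v" "0 < r"
  shows "(t powr (k - 1 / r) * v) powr r = (t powr k * v) powr r / t"
proof -
  have "(t powr (k - 1 / r)) powr r = (t powr k) powr r / t"
  proof -
    have "(k - 1 / r) * r = k * r - 1" using assms by (simp add: left_diff_distrib)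
    then have "(t powr (k - 1 / r)) powr r = t powr (k * r - 1)" by (simp only: powr_powr)
    also have "\<dots> = (t powr k) powr r / t" using assms by (simp add: powr_powr powr_diff)
    finally show ?thesis .
  qed
  then show ?thesis using assms by (simp add: powr_mult)
qed

text \<open>Below \<open>t0\<close> the uniform bound on the rearrangement leaves a factor (t /
  t0)^e, whose powers are integrable against dt / t. Above \<open>t0\<close> the antitone quotient
  replaces the weight of \<open>A\<close> by that of \<open>B\<close>, and the second exponent rises
  from \<open>c\<close> to \<open>b\<close> by estimating the surplus power r - p with the weak
  bound.\<close>

lemma lz_norm_le_of_bounded_rearrangement:
  fixes A B :: "real \<times> real" and q c b :: ennreal
  assumes q: "0 < q" "q < \<infinity>" and c: "0 < c" "c \<le> b" and AB: "snd A \<le> snd B" "fst B \<le> fst A" and C0: "0 \<le> C0"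
  obtains C where "0 < C"
    "\<And>(g :: real ^ 'n \<Rightarrow> complex) t0 d. 0 < t0 \<Longrightarrow> 0 \<le> d \<Longrightarrow> lz_norm q c B g = ennreal d \<Longrightarrow>
      (\<And>t. rearrangement g t \<le> ennreal (C0 * d * (t0 powr (- recip q) / broken_log B t0))) \<Longrightarrow>
      lz_norm q b A g \<le> ennreal (C * (broken_log A t0 / broken_log B t0) * d)"
proof -
  define k where "k = recip q"
  have k: "0 < k" using recip_eq[OF q] q by (simp add: k_def enn2real_positive_iff)
  \<comment> \<open>One half of t^k pays for the logarithm, the other half remains for convergence
    at 0.\<close>
  define e where "e = k / 2"
  have e: "0 < e" "k = e + e" using k by (auto simp: e_def)
  obtain C1 where C1: "0 < C1"
    "\<And>(g :: real ^ 'n \<Rightarrow> complex) t. 0 < t \<Longrightarrow>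
      ennreal (t powr k * broken_log B t) * rearrangement g t \<le> ennreal C1 * lz_norm q c B g"
    using rearrangement_le_lz_norm[OF c(1), of q B] unfolding k_def by blast
  obtain K where K: "1 \<le> K"
    "\<And>s t. 0 < t \<Longrightarrow> t \<le> s \<Longrightarrow> broken_log A t \<le> K * (s / t) powr e * broken_log A s"
    using broken_log_powr_bound[OF e(1), of A] by metis
  let ?l = "\<lambda>t0. broken_log A t0 / broken_log B t0" and ?N = "\<lambda>t0 d k. C0 * d * (t0 powr (- k) / broken_log B t0)"
  have small_large: "(t \<le> t0 \<longrightarrow> t powr k * broken_log A t * y \<le> K * C0 * ?l t0 * d * (t / t0) powr e) \<and>
      (t0 \<le> t \<longrightarrow> t powr k * broken_log A t * y \<le> ?l t0 * (t powr k * broken_log B t * y)) \<and>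
      t powr k * broken_log B t * y \<le> C1 * d"
    if t: "0 < t" "0 < t0" and d: "0 \<le> d" "lz_norm q c B g = ennreal d"
      and y: "rearrangement g t = ennreal y" "0 \<le> y" "y \<le> ?N t0 d k"
    for t t0 d y and g :: "real ^ 'n \<Rightarrow> complex"
  proof (intro conjI impI)
    assume le: "t \<le> t0"
    have "t powr k * broken_log A t * y \<le>
        t powr k * (K * (t0 / t) powr e * broken_log A t0) * (?N t0 d k)"
      using t le y K(1) by (intro mult_mono mult_left_mono K) auto
    also have "\<dots> = K * C0 * ?l t0 * d * (t powr k * (t0 / t) powr e * t0 powr (- k))"
      by simp
    also have "t powr k * (t0 / t) powr e * t0 powr (- k) = (t / t0) powr e"
    proof -
      have "t powr k = t powr e * t powr e" "t0 powr (- k) = 1 / (t0 powr e * t0 powr e)"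
        unfolding e(2) by (simp_all only: powr_add powr_minus_divide)
      moreover have "(t0 / t) powr e = t0 powr e / t powr e" "(t / t0) powr e = t powr e / t0 powr e"
        using t by (simp_all add: powr_divide)
      ultimately show ?thesis using t by simp
    qed
    finally show "t powr k * broken_log A t * y \<le> K * C0 * ?l t0 * d * (t / t0) powr e" .
  next
    assume le: "t0 \<le> t"
    have "broken_log A t / broken_log B t \<le> broken_log A t0 / broken_log B t0"
      by (rule broken_log_ratio_antimono[OF t(2) le AB])
    then have "broken_log A t \<le> ?l t0 * broken_log B t"
      by (simp only: pos_divide_le_eq[OF broken_log_pos])
    then have "(t powr k * y) * broken_log A t \<le> (t powr k * y) * (?l t0 * broken_log B t)"
      using y by (intro mult_left_mono) auto
    then show "t powr k * broken_log A t * y \<le> ?l t0 * (t powr k * broken_log B t * y)"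
      by (simp add: mult_ac)
  next
    have "ennreal (t powr k * broken_log B t * y) \<le> ennreal (C1 * d)"
      using C1(2)[OF t(1), of g] C1(1) d y by (simp add: ennreal_mult)
    then show "t powr k * broken_log B t * y \<le> C1 * d"
      using C1(1) d by (subst (asm) ennreal_le_iff) auto
  qed
  have real_values: "\<exists>y. rearrangement g t = ennreal y \<and> 0 \<le> y \<and> y \<le> N"
    if "rearrangement g t \<le> ennreal N" "0 \<le> N" for g :: "real ^ 'n \<Rightarrow> complex" and t N
    using that by (cases "rearrangement g t" rule: ennreal_cases) (auto simp: ennreal_le_iff top_unique)
  have N0: "0 \<le> ?N t0 d k" if "0 \<le> d" for d t0
    using C0 that by simp
  show thesis
  proof (cases "b = \<infinity>")
    case True
    define C where "C = K * C0 + C1"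
    have C: "0 < C" using K(1) C0 C1(1) by (auto simp: C_def intro: add_nonneg_pos)
    show thesis
    proof (rule that[OF C], goal_cases)
      case (1 g t0 d)
      note t0 = 1(1) and d = 1(2,3) and bd = 1(4)
      define l where "l = broken_log A t0 / broken_log B t0"
      have l: "0 \<le> l" by (simp add: l_def)
      let ?h = "\<lambda>t. ennreal (t powr k * broken_log A t) * rearrangement g t"
      have "ennreal (t powr k * broken_log A t) * rearrangement g t \<le> ennreal (C * l * d)" if t: "0 < t" for t
      proof -
        obtain y where y: "rearrangement g t = ennreal y" "0 \<le> y" "y \<le> ?N t0 d k"
          using real_values[OF bd N0[OF d(1), unfolded k_def]] unfolding k_def by blast
        note sl = small_large[OF t t0 d y, folded l_def]
        have "t powr k * broken_log A t * y \<le> C * l * d"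
        proof (cases "t \<le> t0")
          case True
          have "(t / t0) powr e \<le> 1 powr e" using t t0 True e by (intro powr_mono2) auto
          then have "K * C0 * l * d * (t / t0) powr e \<le> K * C0 * l * d * 1"
            using K(1) C0 l d by (intro mult_left_mono) auto
          moreover have "0 \<le> C1 * (l * d)" using C1(1) l d by simp
          ultimately show ?thesis using sl True by (auto simp: C_def algebra_simps)
        next
          case False
          have "l * (t powr k * broken_log B t * y) \<le> l * (C1 * d)" using sl l by (intro mult_left_mono) auto
          moreover have "0 \<le> K * C0 * (l * d)" using K(1) C0 l d by simp
          ultimately show ?thesis using sl False by (auto simp: C_def algebra_simps)
        qed
        then show ?thesis using y by (simp add: ennreal_mult[symmetric] ennreal_leI)
      qed
      then have "esssup (lebesgue_on {0<..}) ?h \<le> ennreal (C * l * d)"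
      proof (intro esssup_I)
        have "?h \<in> borel_measurable lborel" by measurable
        then show "?h \<in> borel_measurable (lebesgue_on {0<..})"
          by (intro measurable_restrict_space1 measurable_completion)
      qed (simp add: AE_lebesgue_on_positive)
      then show ?case
        unfolding lz_norm_def Lp_quasinorm_def if_P[OF True] using True
        by (simp add: recip_top k_def l_def)
    qed
  next
    case False
    then have bf: "b < \<infinity>" by (simp add: less_top)
    have b: "0 < b" using c by (rule less_le_trans)
    have cf: "c < \<infinity>" using c(2) bf by (rule le_less_trans)
    define r where "r = enn2real b"
    define p where "p = enn2real c"
    have p: "0 < p" using c(1) cf by (simp add: p_def enn2real_positive_iff)
    have r: "0 < r" using b bf by (simp add: r_def enn2real_positive_iff)
    have pr: "p \<le> r" unfolding p_def r_def using c(2) bf by (intro enn2real_mono) auto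
    \<comment> \<open>The contributions of (0, t0) and of the rest. The integral of (t / t0)^(e r)
      dt / t over (0, t0) is 1 / (e r).\<close>
    define Q where "Q = (K * C0) powr r / (e * r) + C1 powr (r - p)"
    have Q: "0 < Q" unfolding Q_def using C1(1) e r by (intro add_nonneg_pos) auto
    define C where "C = Q powr (1 / r)"
    have C: "0 < C" using Q by (simp add: C_def)
    show thesis
    proof (rule that[OF C], goal_cases)
      case (1 g t0 d)
      note t0 = 1(1) and d = 1(2,3) and bd = 1(4)
      define l where "l = broken_log A t0 / broken_log B t0"
      have l: "0 \<le> l" by (simp add: l_def)
      let ?hA = "\<lambda>t. ennreal_powr (ennreal (t powr (k - 1 / r) * broken_log A t) * rearrangement g t) r"
      let ?hB = "\<lambda>t. ennreal_powr (ennreal (t powr (k - 1 / p) * broken_log B t) * rearrangement g t) p"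
      have IB: "(\<integral>\<^sup>+t\<in>{0<..}. ?hB t \<partial>lborel) = ennreal (d powr p)"
      proof -
        have "ennreal_powr (\<integral>\<^sup>+t\<in>{0<..}. ?hB t \<partial>lborel) (1 / p) = ennreal d"
          using d(2) unfolding lz_norm_def Lp_quasinorm_finite_exponent[OF c(1) cf]
          by (simp add: nn_integral_lebesgue_on_positive recip_eq[OF c(1) cf] p_def k_def)
        then have "(\<integral>\<^sup>+t\<in>{0<..}. ?hB t \<partial>lborel) = ennreal_powr (ennreal d) p"
          using ennreal_powr_powr'[OF p] by metis
        then show ?thesis using d(1) by (simp add: ennreal_powr_ennreal)
      qed
      define M where "M = (K * C0 * l * d) powr r * t0 powr (- (e * r))"
      define L where "L = l powr r * (C1 * d) powr (r - p)"
      have nonneg: "0 \<le> M" "0 \<le> L" by (simp_all add: M_def L_def)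
      have pt: "?hA t * indicator {0<..} t \<le>
          ennreal M * (ennreal (t powr (e * r - 1)) * indicator {0<..<t0} t) + ennreal L * (?hB t * indicator {0<..} t)" for t
      proof (cases "0 < t")
        case t: True
        obtain y where y: "rearrangement g t = ennreal y" "0 \<le> y" "y \<le> ?N t0 d k"
          using real_values[OF bd N0[OF d(1), unfolded k_def]] unfolding k_def by blast
        note sl = small_large[OF t t0 d y, folded l_def]
        define z where "z = t powr k * (broken_log A t * y)"
        define w where "w = t powr k * (broken_log B t * y)"
        have zw: "0 \<le> z" "0 \<le> w" using y by (auto simp: z_def w_def)
        have sl': "t \<le> t0 \<Longrightarrow> z \<le> K * C0 * l * d * (t / t0) powr e" "t0 \<le> t \<Longrightarrow> z \<le> l * w" "w \<le> C1 * d"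
          using sl unfolding z_def w_def by (simp_all only: mult.assoc simp_thms)
        have hA: "?hA t = ennreal (z powr r / t)"
        proof -
          have "?hA t = ennreal ((t powr (k - 1 / r) * (broken_log A t * y)) powr r)"
            unfolding y(1) using y(2)
            by (subst ennreal_mult[symmetric], simp, simp, subst ennreal_powr_ennreal) (simp_all add: mult.assoc)
          also have "\<dots> = ennreal (z powr r / t)"
            unfolding z_def using t y(2) r by (subst powr_div_self) auto
          finally show ?thesis .
        qed
        have hB: "?hB t = ennreal (w powr p / t)"
        proof -
          have "?hB t = ennreal ((t powr (k - 1 / p) * (broken_log B t * y)) powr p)"
            unfolding y(1) using y(2)
            by (subst ennreal_mult[symmetric], simp, simp, subst ennreal_powr_ennreal) (simp_all add: mult.assoc)
          also have "\<dots> = ennreal (w powr p / t)"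
            unfolding w_def using t y(2) p by (subst powr_div_self) auto
          finally show ?thesis .
        qed
        show ?thesis
        proof (cases "t < t0")
          case True
          have "z powr r \<le> (K * C0 * l * d * (t / t0) powr e) powr r"
            using sl'(1) True zw r by (intro powr_mono2) auto
          also have "\<dots> = (K * C0 * l * d) powr r * (t / t0) powr (e * r)"
            by (simp add: powr_mult[of _ "(t / t0) powr e"] powr_powr)
          also have "(t / t0) powr (e * r) = t powr (e * r) * t0 powr (- (e * r))"
            using t t0 by (simp add: powr_divide powr_minus_divide)
          finally have "z powr r \<le> M * t powr (e * r)" by (simp add: M_def mult_ac)
          then have "z powr r / t \<le> M * t powr (e * r) / t"
            using t by (intro divide_right_mono) auto
          also have "\<dots> = M * t powr (e * r - 1)"
            using t by (simp add: powr_diff)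
          finally have "ennreal (z powr r / t) \<le> ennreal M * ennreal (t powr (e * r - 1))"
            using nonneg by (simp add: ennreal_mult[symmetric] ennreal_leI)
          then show ?thesis
            using True t unfolding hA by (simp add: add_increasing2)
        next
          case False
          have "z powr r \<le> (l * w) powr r" using sl'(2) False zw r by (intro powr_mono2) auto
          also have "\<dots> = l powr r * w powr r" using l zw by (simp add: powr_mult)
          also have "w powr r = w powr (r - p) * w powr p" by (simp add: powr_add[symmetric])
          also have "l powr r * (w powr (r - p) * w powr p) \<le> l powr r * ((C1 * d) powr (r - p) * w powr p)"
            using sl'(3) zw pr by (intro mult_left_mono mult_right_mono powr_mono2) auto
          finally have "z powr r / t \<le> (L * w powr p) / t"
            using t by (intro divide_right_mono) (auto simp: L_def mult.assoc)
          then have "ennreal (z powr r / t) \<le> ennreal L * ennreal (w powr p / t)"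
            using nonneg t by (simp add: ennreal_mult[symmetric] ennreal_leI)
          then show ?thesis
            using False t unfolding hA hB by simp
        qed
      qed simp
      have "(\<integral>\<^sup>+t\<in>{0<..}. ?hA t \<partial>lborel) \<le>
          (\<integral>\<^sup>+t. ennreal M * (ennreal (t powr (e * r - 1)) * indicator {0<..<t0} t) + ennreal L * (?hB t * indicator {0<..} t) \<partial>lborel)"
        by (intro nn_integral_mono pt)
      also have "\<dots> = ennreal M * (\<integral>\<^sup>+t\<in>{0<..<t0}. ennreal (t powr (e * r - 1)) \<partial>lborel) + ennreal L * (\<integral>\<^sup>+t\<in>{0<..}. ?hB t \<partial>lborel)"
        by (subst nn_integral_add) (auto simp: nn_integral_cmult)
      also have "\<dots> \<le> ennreal M * ennreal (t0 powr (e * r) / (e * r)) + ennreal L * ennreal (d powr p)"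
        unfolding IB using e r t0 by (intro add_mono mult_left_mono nn_integral_powr_le order_refl) auto
      also have "\<dots> = ennreal (M * (t0 powr (e * r) / (e * r)) + L * d powr p)"
        using nonneg e r by (simp add: ennreal_mult[symmetric] ennreal_plus[symmetric] del: ennreal_plus)
      also have "M * (t0 powr (e * r) / (e * r)) + L * d powr p = (C * l * d) powr r"
      proof -
        have "t0 powr (- (e * r)) * t0 powr (e * r) = 1" using t0 by (simp add: powr_add[symmetric])
        then have "M * (t0 powr (e * r) / (e * r)) = (K * C0 * l * d) powr r / (e * r)"
          by (simp add: M_def)
        also have "(K * C0 * l * d) powr r = (K * C0) powr r * (l powr r * d powr r)"
          using K(1) C0 l d by (simp add: powr_mult)
        finally have 1: "M * (t0 powr (e * r) / (e * r)) = (K * C0) powr r / (e * r) * (l powr r * d powr r)" by simp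
        have "L * d powr p = C1 powr (r - p) * (l powr r * (d powr (r - p) * d powr p))"
          using C1(1) d by (simp add: L_def powr_mult)
        also have "d powr (r - p) * d powr p = d powr r" by (simp add: powr_add[symmetric])
        finally have 2: "L * d powr p = C1 powr (r - p) * (l powr r * d powr r)" .
        have "(C * l * d) powr r = C powr r * (l powr r * d powr r)"
          using C l d by (simp add: powr_mult)
        also have "C powr r = Q" using Q r by (simp add: C_def powr_powr)
        finally show ?thesis unfolding 1 2 by (simp add: Q_def distrib_right)
      qed
      finally have "(\<integral>\<^sup>+t\<in>{0<..}. ?hA t \<partial>lborel) \<le> ennreal ((C * l * d) powr r)" .
      then have "ennreal_powr (\<integral>\<^sup>+t\<in>{0<..}. ?hA t \<partial>lborel) (1 / r) \<le> ennreal_powr (ennreal ((C * l * d) powr r)) (1 / r)"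
        using r by (intro ennreal_powr_mono) auto
      also have "\<dots> = ennreal (C * l * d)"
        using C l d r by (subst ennreal_powr_ennreal) (auto simp: powr_powr)
      finally show ?case
        unfolding lz_norm_def Lp_quasinorm_finite_exponent[OF b bf]
        by (simp add: nn_integral_lebesgue_on_positive recip_eq[OF b bf] r_def k_def l_def)
    qed
  qed
qed

section \<open>Embedding of Besov-type spaces\<close>

lemma broken_log_add: "broken_log (A + B) t = broken_log A t * broken_log B t"
  by (simp add: broken_log_def powr_add)

lemma broken_log_diff: "broken_log (A - B) t = broken_log A t / broken_log B t"
  by (simp add: broken_log_def powr_diff)

text \<open>Passing from 2^k to 2^(-k n) exchanges the two branches, whence the swap, and multiplies
  |ln| by \<open>n\<close>. That only helps under the nonpositive exponent and costs at most n^(fst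
  A) under the nonnegative one. It is applied to the difference of the two weights.\<close>

lemma broken_log_dyadic_swap_le:
  fixes n :: nat
  assumes n: "1 \<le> n" and A: "snd A \<le> 0" "0 \<le> fst A"
  shows "broken_log A ((2 powi (- k)) ^ n) \<le> real n powr fst A * broken_log (prod.swap A) (2 powi k)"
proof -
  define x where "x = \<bar>real_of_int k * ln 2\<bar>"
  have x: "0 \<le> x" by (simp add: x_def)
  have lnp: "ln (2 powi j) = real_of_int j * ln 2" for j
    using ln_powr[of 2 "real_of_int j"] by (simp add: powr_real_of_int')
  have l1: "\<bar>ln ((2 powi (- k)) ^ n)\<bar> = real n * x"
    unfolding ln_realpow lnp by (simp add: x_def abs_mult)
  have l2: "\<bar>ln (2 powi k)\<bar> = x"
    unfolding lnp by (simp add: x_def)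
  have n1: "1 \<le> real n powr fst A" using n A by (intro ge_one_powr_ge_zero) auto
  consider "k = 0" | "k < 0" | "0 < k" by linarith
  then show ?thesis
  proof cases
    case 1
    then show ?thesis using n1 by (simp add: broken_log_def)
  next
    case 2
    have "\<not> (2 powi (- k)) ^ n \<le> (1::real)"
    proof -
      have "(2::real) powi 0 < 2 powi (- k)" using 2 by (intro power_int_strict_increasing) auto
      then show ?thesis using n by (simp add: not_le one_less_power)
    qed
    moreover have "(2::real) powi k \<le> 1"
      using 2 power_int_increasing[of k 0 "2::real"] by simp
    moreover have "(1 + real n * x) powr snd A \<le> (1 + x) powr snd A"
      using n x A mult_right_mono[of 1 "real n" x] by (intro powr_mono2') auto
    moreover have "1 * (1 + x) powr snd A \<le> real n powr fst A * (1 + x) powr snd A"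
      using n1 by (intro mult_right_mono) auto
    ultimately show ?thesis unfolding broken_log_def l1 l2 by simp
  next
    case 3
    have "(2 powi (- k)) ^ n \<le> (1::real)"
    proof -
      have "(2::real) powi (- k) \<le> 2 powi 0" using 3 by (intro power_int_increasing) auto
      then show ?thesis by (intro power_le_one) auto
    qed
    moreover have "\<not> (2::real) powi k \<le> 1"
      using 3 power_int_strict_increasing[of 0 k "2::real"] by simp
    moreover have "(1 + real n * x) powr fst A \<le> (real n * (1 + x)) powr fst A"
      using n x A by (intro powr_mono2) (auto simp: algebra_simps)
    ultimately show ?thesis unfolding broken_log_def l1 l2 using x by (simp add: powr_mult)
  qed
qed

text \<open>Three estimates are chained at t0 = 2^(-k n): ball masses from the rearrangement, the
  supremum from ball masses, the target quasi-norm from the supremum. The factor (2^k)^n of the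
  supremum bound is exactly 1 / t0, which turns t0^(1 - 1/q) into t0^(-1/q).\<close>

lemma lz_norm_dyadic_block_le:
  fixes \<phi> :: "real ^ 'n \<Rightarrow> complex" and q c b :: ennreal and A B :: "real \<times> real"
  assumes res: "dyadic_resolution \<phi>"
    and q: "1 \<le> q" "q < \<infinity>" and c: "0 < c"
    and cs: "(q = 1 \<and> c = 1 \<and> B = (0, 0)) \<or> 1 < q"
    and cb: "c \<le> b" and AB: "snd A \<le> snd B" "fst B \<le> fst A"
  obtains C where "0 < C"
    "\<And>k T g. T \<in> tempered_distributions \<Longrightarrow> represents g (dyadic_block \<phi> k T) \<Longrightarrow>
      lz_norm q b A g \<le> ennreal (C * broken_log (prod.swap A - prod.swap B) (2 powi k)) * lz_norm q c B g"
proof -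
  define n where "n = CARD('n)"
  have n: "1 \<le> n" by (simp add: n_def Suc_leI)
  define v where "v = unit_ball_vol (real n)"
  have v: "0 < v" by (simp add: v_def)
  obtain C1 where C1: "0 \<le> C1"
    "\<And>k T (g :: real ^ 'n \<Rightarrow> complex) L. T \<in> tempered_distributions \<Longrightarrow> represents g (dyadic_block \<phi> k T) \<Longrightarrow> 0 \<le> L \<Longrightarrow>
      (\<And>y R. 1 \<le> R \<Longrightarrow> (\<integral>\<^sup>+x\<in>ball y (R * 2 powi (- k)). ennreal (norm (g x)) \<partial>lebesgue)
          \<le> ennreal (L * R ^ (2 * CARD('n)))) \<Longrightarrow>
      AE x in lebesgue. norm (g x) \<le> C1 * (2 powi k) ^ CARD('n) * L"
    using dyadic_block_sup_bound[OF res] by blast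
  obtain C2 where C2: "0 < C2"
    "\<And>(g :: real ^ 'n \<Rightarrow> complex) t0 T d. 0 < t0 \<Longrightarrow> t0 \<le> T \<Longrightarrow> 0 \<le> d \<Longrightarrow> lz_norm q c B g = ennreal d \<Longrightarrow>
      (\<integral>\<^sup>+t\<in>{0<..<T}. rearrangement g t \<partial>lborel) \<le>
        ennreal (C2 * d * (t0 powr (1 - recip q) / broken_log B t0) * (T / t0)\<^sup>2)"
    using nn_integral_rearrangement_le[OF q c cs] by blast
  define C0 where "C0 = C1 * C2 * (v + 1)\<^sup>2"
  have C0: "0 \<le> C0" using C1 C2 by (simp add: C0_def)
  have q0: "0 < q" using q(1) by (rule less_le_trans[OF zero_less_one])
  obtain C3 where C3: "0 < C3"
    "\<And>(g :: real ^ 'n \<Rightarrow> complex) t0 d. 0 < t0 \<Longrightarrow> 0 \<le> d \<Longrightarrow> lz_norm q c B g = ennreal d \<Longrightarrow>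
      (\<And>t. rearrangement g t \<le> ennreal (C0 * d * (t0 powr (- recip q) / broken_log B t0))) \<Longrightarrow>
      lz_norm q b A g \<le> ennreal (C3 * (broken_log A t0 / broken_log B t0) * d)"
    using lz_norm_le_of_bounded_rearrangement[OF q0 q(2) c cb AB C0] by blast
  define C where "C = C3 * real n powr fst (A - B)"
  have C: "0 < C" using C3 n by (simp add: C_def)
  show thesis
  proof (rule that[OF C], goal_cases)
    case (1 k T g)
    note T = 1(1) and rep = 1(2)
    define a :: real where "a = 2 powi (- k)"
    have a: "0 < a" by (simp add: a_def)
    define t0 where "t0 = a ^ n"
    have t0: "0 < t0" using a by (simp add: t0_def)
    let ?l = "broken_log (prod.swap A - prod.swap B) (2 powi k)"
    show ?case
    proof (cases "lz_norm q c B g" rule: ennreal_cases)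
      case top
      \<comment> \<open>The right-hand side is infinite only if the factor is nonzero, since 0 times
        infinity is 0.\<close>
      have "ennreal (C * ?l) \<noteq> 0" using C by simp
      then show ?thesis using top by (simp add: ennreal_mult_top)
    next
      case (real d)
      have gm: "g \<in> borel_measurable lebesgue" using rep by (simp add: represents_def)
      obtain g' where g': "g' \<in> borel_measurable borel" and gg': "AE x in lborel. g x = g' x"
        using lebesgue_borel_version[OF gm] by blast
      have rr: "rearrangement g' = rearrangement g"
      proof (rule rearrangement_cong_AE)
        show "g' \<in> borel_measurable lebesgue" using g' by (intro measurable_completion) simp
        show "AE x in lebesgue. g' x = g x"
          by (rule AE_completion) (use gg' in eventually_elim, simp)
      qed (rule gm)
      define L where "L = C2 * d * (t0 powr (1 - recip q) / broken_log B t0) * (v + 1)\<^sup>2"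
      have L: "0 \<le> L" using C2(1) real by (simp add: L_def)
      have balls: "(\<integral>\<^sup>+x\<in>ball y (R * 2 powi (- k)). ennreal (norm (g x)) \<partial>lebesgue)
          \<le> ennreal (L * R ^ (2 * CARD('n)))" if R: "1 \<le> R" for y R
      proof -
        \<comment> \<open>With v + 1 in place of \<open>v\<close>, T' is at least \<open>t0\<close>
          as well as at least the volume of the ball, also when \<open>v\<close> < 1.\<close>
        define T' where "T' = (v + 1) * R ^ n * t0"
        have R1: "1 \<le> R ^ n" using R by simp
        have T'0: "t0 \<le> T'"
        proof -
          have "1 * 1 \<le> (v + 1) * R ^ n" using v R1 by (intro mult_mono) auto
          then have "1 * t0 \<le> (v + 1) * R ^ n * t0" using t0 by (intro mult_right_mono) auto
          then show ?thesis by (simp add: T'_def)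
        qed
        have "emeasure lborel (ball y (R * a)) = ennreal (v * (R * a) ^ n)"
          using R a by (simp add: emeasure_ball v_def n_def)
        also have "\<dots> \<le> ennreal T'"
        proof (rule ennreal_leI)
          have "v * (R ^ n * t0) \<le> (v + 1) * (R ^ n * t0)" using R1 t0 by (intro mult_right_mono) auto
          then show "v * (R * a) ^ n \<le> T'" by (simp add: T'_def t0_def power_mult_distrib mult.assoc)
        qed
        finally have meas: "emeasure lborel (ball y (R * a)) \<le> ennreal T'" .
        have "(\<integral>\<^sup>+x\<in>ball y (R * a). ennreal (norm (g x)) \<partial>lebesgue) =
            (\<integral>\<^sup>+x\<in>ball y (R * a). ennreal (norm (g x)) \<partial>lborel)"
          by (rule nn_integral_completion)
        also have "\<dots> = (\<integral>\<^sup>+x\<in>ball y (R * a). ennreal (norm (g' x)) \<partial>lborel)"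
          by (rule nn_integral_cong_AE) (use gg' in eventually_elim, simp)
        also have "\<dots> \<le> (\<integral>\<^sup>+t\<in>{0<..<T'}. rearrangement g' t \<partial>lborel)"
          by (rule nn_integral_le_rearrangement_borel[OF g' _ meas]) simp
        also have "\<dots> \<le> ennreal (C2 * d * (t0 powr (1 - recip q) / broken_log B t0) * (T' / t0)\<^sup>2)"
          unfolding rr using real by (intro C2 t0 T'0) auto
        also have "(T' / t0)\<^sup>2 = (v + 1)\<^sup>2 * R ^ (2 * n)"
          using t0 by (simp add: T'_def power_mult_distrib power_mult[symmetric] mult.commute)
        finally show ?thesis by (simp add: a_def L_def n_def mult.assoc)
      qed
      have "AE x in lebesgue. norm (g x) \<le> C1 * (2 powi k) ^ CARD('n) * L"
        by (rule C1(2)[OF T rep L balls])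
      then have "rearrangement g t \<le> ennreal (C1 * (2 powi k) ^ CARD('n) * L)" for t
        by (rule rearrangement_le)
      moreover have "C1 * (2 powi k) ^ CARD('n) * L = C0 * d * (t0 powr (- recip q) / broken_log B t0)"
      proof -
        have "(2 powi k) ^ CARD('n) = 1 / t0"
          by (simp add: t0_def a_def n_def power_int_minus power_inverse divide_inverse)
        moreover have "t0 powr (- recip q) = t0 powr (1 - recip q) / t0"
          using t0 powr_diff[of t0 "1 - recip q" 1] by simp
        ultimately show ?thesis by (simp add: L_def C0_def)
      qed
      ultimately have "lz_norm q b A g \<le> ennreal (C3 * (broken_log A t0 / broken_log B t0) * d)"
        using real t0 by (intro C3) auto
      also have "\<dots> \<le> ennreal (C * ?l * d)"
      proof (rule ennreal_leI)
        have "prod.swap A - prod.swap B = prod.swap (A - B)" by (cases A, cases B) simp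
        then have "broken_log (A - B) t0 \<le> real n powr fst (A - B) * ?l"
          unfolding t0_def a_def using broken_log_dyadic_swap_le[OF n, of "A - B" k] AB by simp
        then have "C3 * (broken_log A t0 / broken_log B t0) * d \<le> C3 * (real n powr fst (A - B) * ?l) * d"
          unfolding broken_log_diff using C3(1) real by (intro mult_left_mono mult_right_mono) auto
        then show "C3 * (broken_log A t0 / broken_log B t0) * d \<le> C * ?l * d"
          by (simp only: C_def mult.assoc)
      qed
      also have "\<dots> = ennreal (C * ?l) * ennreal d"
        using C real by (intro ennreal_mult) auto
      finally show ?thesis using real by simp
    qed
  qed
qed

text \<open>Moving \<open>M\<close> to the left side leaves a plain lower bound for an infimum; if
  no function represents \<open>S\<close>, both infima are infinite.\<close>

lemma lz_norm_dist_le: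
  assumes M: "0 < M" and le: "\<And>g. represents g S \<Longrightarrow> lz_norm q b A g \<le> ennreal M * lz_norm q c B g"
  shows "lz_norm_dist q b A S \<le> ennreal M * lz_norm_dist q c B S"
proof -
  have one: "ennreal M * ennreal (1 / M) = 1" using M by (simp add: ennreal_mult[symmetric])
  have "ennreal (1 / M) * lz_norm_dist q b A S \<le> lz_norm_dist q c B S"
    unfolding lz_norm_dist_def[of q c]
  proof (rule INF_greatest)
    fix g assume g: "g \<in> {g. represents g S}"
    then have "lz_norm_dist q b A S \<le> ennreal M * lz_norm q c B g"
      unfolding lz_norm_dist_def using le by (intro INF_lower2) auto
    then have "ennreal (1 / M) * lz_norm_dist q b A S \<le> ennreal (1 / M) * (ennreal M * lz_norm q c B g)"
      by (rule mult_left_mono) simp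
    also have "\<dots> = lz_norm q c B g"
      using one by (simp only: mult.assoc[symmetric] mult.commute[of "ennreal (1 / M)"] mult_1_left)
    finally show "ennreal (1 / M) * lz_norm_dist q b A S \<le> lz_norm q c B g" .
  qed
  then have "ennreal M * (ennreal (1 / M) * lz_norm_dist q b A S) \<le> ennreal M * lz_norm_dist q c B S"
    by (rule mult_left_mono) simp
  then show ?thesis using one by (simp only: mult.assoc[symmetric] mult_1_left)
qed

section \<open>Summation over the dyadic blocks\<close>

lemma infsum_ennreal_eq_SUP:
  fixes f :: "'a \<Rightarrow> ennreal"
  shows "infsum f A = (SUP F\<in>{F. finite F \<and> F \<subseteq> A}. sum f F)"
  by (rule nonneg_infsum_complete) simp

lemma infsum_ennreal_le_cmult:
  fixes f g :: "'a \<Rightarrow> ennreal"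
  assumes le: "\<And>x. x \<in> A \<Longrightarrow> f x \<le> c * g x"
  shows "infsum f A \<le> c * infsum g A"
  unfolding infsum_ennreal_eq_SUP[of f]
proof (rule SUP_least)
  fix F assume F: "F \<in> {F. finite F \<and> F \<subseteq> A}"
  then have "sum f F \<le> (\<Sum>x\<in>F. c * g x)" by (intro sum_mono le) auto
  also have "\<dots> = c * sum g F" by (simp add: sum_distrib_left)
  also have "\<dots> \<le> c * infsum g A"
    unfolding infsum_ennreal_eq_SUP using F by (intro mult_left_mono SUP_upper) auto
  finally show "sum f F \<le> c * infsum g A" .
qed

text \<open>Broken logarithms multiply by adding their exponents, so the factor with \<Delta> from
  each block merges into the weight of the smoothness index. What remains is the constant
  \<open>C\<close>, independent of \<open>k\<close>, which passes through the sum or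
  supremum.\<close>

lemma besov_norm_le:
  assumes u: "0 < u" and C: "0 < C"
    and le: "\<And>k. lz_norm_dist p b A (dyadic_block \<phi> k f) \<le>
      ennreal (C * broken_log \<Delta> (2 powi k)) * lz_norm_dist p c B (dyadic_block \<phi> k f)"
  shows "besov_norm \<phi> \<sigma> \<Gamma> p b A u f \<le> ennreal C * besov_norm \<phi> \<sigma> (\<Gamma> + \<Delta>) p c B u f"
proof -
  define s where "s k = ennreal (2 powr (\<sigma> * of_int k) * broken_log \<Gamma> (2 powi k)) *
    lz_norm_dist p b A (dyadic_block \<phi> k f)" for k :: int
  define s' where "s' k = ennreal (2 powr (\<sigma> * of_int k) * broken_log (\<Gamma> + \<Delta>) (2 powi k)) *
    lz_norm_dist p c B (dyadic_block \<phi> k f)" for k :: int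
  have ss': "s k \<le> ennreal C * s' k" for k
  proof -
    let ?w = "2 powr (\<sigma> * of_int k) * broken_log \<Gamma> (2 powi k)"
    have "s k \<le> ennreal ?w * (ennreal (C * broken_log \<Delta> (2 powi k)) * lz_norm_dist p c B (dyadic_block \<phi> k f))"
      unfolding s_def by (intro mult_left_mono le) simp
    also have "\<dots> = ennreal (?w * (C * broken_log \<Delta> (2 powi k))) * lz_norm_dist p c B (dyadic_block \<phi> k f)"
      using C by (subst ennreal_mult) (auto simp: mult.assoc)
    also have "?w * (C * broken_log \<Delta> (2 powi k)) = C * (2 powr (\<sigma> * of_int k) * broken_log (\<Gamma> + \<Delta>) (2 powi k))"
      by (simp only: broken_log_add mult.assoc mult.left_commute mult.commute)
    also have "ennreal \<dots> * lz_norm_dist p c B (dyadic_block \<phi> k f) = ennreal C * s' k"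
      unfolding s'_def using C by (subst ennreal_mult) (auto simp: mult.assoc)
    finally show ?thesis .
  qed
  show ?thesis
  proof (cases "u = \<infinity>")
    case True
    have "(SUP k. s k) \<le> ennreal C * (SUP k. s' k)"
      by (intro SUP_least order_trans[OF ss'] mult_left_mono SUP_upper) auto
    then show ?thesis using True by (simp add: besov_norm_def s_def s'_def)
  next
    case False
    then have uf: "u < \<infinity>" by (simp add: less_top)
    define r where "r = enn2real u"
    have r: "0 < r" using u uf by (simp add: r_def enn2real_positive_iff)
    have "ennreal_powr (s k) r \<le> ennreal_powr (ennreal C) r * ennreal_powr (s' k) r" for k
      using ennreal_powr_mono[OF r ss'] by (simp add: ennreal_powr_mult[OF r])
    then have "(\<Sum>\<^sub>\<infinity>k. ennreal_powr (s k) r) \<le> ennreal_powr (ennreal C) r * (\<Sum>\<^sub>\<infinity>k. ennreal_powr (s' k) r)"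
      by (rule infsum_ennreal_le_cmult)
    then have "ennreal_powr (\<Sum>\<^sub>\<infinity>k. ennreal_powr (s k) r) (1 / r) \<le>
        ennreal_powr (ennreal_powr (ennreal C) r * (\<Sum>\<^sub>\<infinity>k. ennreal_powr (s' k) r)) (1 / r)"
      using r by (intro ennreal_powr_mono) auto
    also have "\<dots> = ennreal C * ennreal_powr (\<Sum>\<^sub>\<infinity>k. ennreal_powr (s' k) r) (1 / r)"
      using r by (simp add: ennreal_powr_mult ennreal_powr_powr)
    finally show ?thesis
      using False by (simp add: besov_norm_def s_def s'_def r_def recip_eq[OF u uf])
  qed
qed

theorem corollary25:
  fixes \<phi> :: "real ^ 'n \<Rightarrow> complex"
    and q c b u :: ennreal
    and \<sigma> :: real
    and A B \<Gamma> :: "real \<times> real"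
  assumes "dyadic_resolution \<phi>"
    and "1 \<le> q" and "q < \<infinity>" and "0 < c"
    and "(q = 1 \<and> c = 1 \<and> B = (0, 0)) \<or> 1 < q"
    and "0 < u" and "c \<le> b"
    and "snd A < snd B" and "fst B \<le> fst A"
  shows "continuously_embedded
    (besov_space \<phi> \<sigma> (\<Gamma> + prod.swap A - prod.swap B) q c B u)
    (besov_norm \<phi> \<sigma> (\<Gamma> + prod.swap A - prod.swap B) q c B u)
    (besov_space \<phi> \<sigma> \<Gamma> q b A u)
    (besov_norm \<phi> \<sigma> \<Gamma> q b A u)"
proof -
  let ?\<Delta> = "prod.swap A - prod.swap B"
  have \<Gamma>: "\<Gamma> + prod.swap A - prod.swap B = \<Gamma> + ?\<Delta>" by (rule add_diff_eq[symmetric])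
  obtain C where C: "0 < C"
    "\<And>k T g. T \<in> tempered_distributions \<Longrightarrow> represents g (dyadic_block \<phi> k T) \<Longrightarrow>
      lz_norm q b A g \<le> ennreal (C * broken_log ?\<Delta> (2 powi k)) * lz_norm q c B g"
    using lz_norm_dyadic_block_le[OF assms(1-5) assms(7) less_imp_le[OF assms(8)] assms(9)] by blast
  have le: "besov_norm \<phi> \<sigma> \<Gamma> q b A u f \<le> ennreal C * besov_norm \<phi> \<sigma> (\<Gamma> + ?\<Delta>) q c B u f"
    if "f \<in> tempered_distributions" for f
    using C(1) that by (intro besov_norm_le assms lz_norm_dist_le C) auto
  show ?thesis
    unfolding continuously_embedded_def \<Gamma>
  proof (intro conjI exI ballI subsetI)
    fix f assume f: "f \<in> besov_space \<phi> \<sigma> (\<Gamma> + ?\<Delta>) q c B u"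
    then have T: "f \<in> tempered_distributions" and fin: "besov_norm \<phi> \<sigma> (\<Gamma> + ?\<Delta>) q c B u f < \<infinity>"
      by (auto simp: besov_space_def)
    show "besov_norm \<phi> \<sigma> \<Gamma> q b A u f \<le> ennreal C * besov_norm \<phi> \<sigma> (\<Gamma> + ?\<Delta>) q c B u f"
      by (rule le[OF T])
    also have "\<dots> < \<infinity>" using fin by (simp add: ennreal_mult_less_top)
    finally show "f \<in> besov_space \<phi> \<sigma> \<Gamma> q b A u" using T by (simp add: besov_space_def)
  qed
qed

end
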